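(* Let $(f,\hat f),(h,\hat h)\in\mathcal{A}$, $\alpha\in(0,\infty)$, $q\in[1,\infty]$ and assume that $f-h+\alpha(\hat f-\hat h)\in L^{q}(S)$ with probability one. Then $$\mathbb{P}\left(\left\{\omega\in\Omega:\ \|f(\omega)-h(\omega)\|_{L^{q}(S)}\le\|f(\omega)-h(\omega)+\alpha(\hat f(\omega)-\hat h(\omega))\|_{L^{q}(S)}\right\}\right)=1.$$ Particularly, $A$ as well as $\mathcal{A}$ are accretive.
   Context: Setting. $n\in\mathbb{N}$, $n\ge 2$; $p\in(1,\infty)\setminus\{2\}$; $S\subseteq\mathbb{R}^{n}$ is a nonempty open, bounded, connected set of class $C^{1}$; $\lambda$ is Lebesgue measure; $0<g_{1}\le g_{2}<\infty$ are constants. $(\Omega,\mathcal{F},\mathbb{P})$ is a complete probability space. For a Banach space $X$, $L^{1}(\Omega;X)$ is the space of $\mathcal{F}$-$\mathfrak{B}(X)$-measurable $f:\Omega\to X$ with $\int_{\Omega}\|f\|_{X}\,d\mathbb{P}<\infty$ (with its usual norm). $L^{1}_{g_{1},g_{2}}(S):=\{\gamma\in L^{1}(S): g_{1}\le\gamma\le g_{2}\text{ a.e. on }S\}$, and $g\in L^{1}(\Omega;L^{1}(S))$ is fixed with $\mathbb{P}(g\in L^{1}_{g_{1},g_{2}}(S))=1$. Convention: $|x|^{p-2}x:=0$ if $x=0$. Operators. $A$ is the operator on $L^{1}(\Omega;L^{1}(S))$ with $(f,\hat f)\in A$ if and only if $f,\hat f\in L^{1}(\Omega;L^{1}(S))$,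 $\mathbb{P}(f\in W^{1,p}(S)\cap L^{\infty}(S))=1$, and with probability one $\int_{S}g|\nabla f|^{p-2}\nabla f\cdot\nabla\varphi\,d\lambda=\int_{S}\hat f\varphi\,d\lambda$ for all $\varphi\in W^{1,p}(S)\cap L^{\infty}(S)$. $\mathcal{A}$ is the closure of $A$ in $L^{1}(\Omega;L^{1}(S))^{2}$. An operator $B$ on a Banach space $X$ is accretive if $\|f-h\|_{X}\le\|f-h+\alpha(\hat f-\hat h)\|_{X}$ for all $(f,\hat f),(h,\hat h)\in B$ and $\alpha>0$. *)

theory Defs
  imports "HOL-Probability.Probability"
begin

text \<open>
  Elements of function spaces are represented by functions, not by equivalence classes; two
  functions denote the same element iff their distance is 0. All notions below (norms, spaces,
  weak gradients, topologies, operators) respect this identification. Norms are extended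
  nonnegative reals; a measurable function outside the respective space has norm \<open>\<infinity>\<close>.
\<close>

subsection \<open>Spaces given by a (pseudo-)distance\<close>

definition dist_open :: "'x set \<Rightarrow> ('x \<Rightarrow> 'x \<Rightarrow> ennreal) \<Rightarrow> 'x set \<Rightarrow> bool" where
  "dist_open C d U \<longleftrightarrow> U \<subseteq> C \<and> (\<forall>u\<in>U. \<exists>e>0. \<forall>v\<in>C. d u v < e \<longrightarrow> v \<in> U)"

definition dist_topology :: "'x set \<Rightarrow> ('x \<Rightarrow> 'x \<Rightarrow> ennreal) \<Rightarrow> 'x topology" where
  "dist_topology C d = topology (dist_open C d)"

lemma istopology_dist_open: "istopology (dist_open C d)"
  unfolding istopology_def
proof (intro conjI allI impI)
  fix U V assume UV: "dist_open C d U" "dist_open C d V"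
  show "dist_open C d (U \<inter> V)"
    unfolding dist_open_def
  proof (intro conjI ballI)
    show "U \<inter> V \<subseteq> C" using UV by (auto simp: dist_open_def)
    fix u assume u: "u \<in> U \<inter> V"
    obtain e1 where e1: "e1 > 0" "\<forall>v\<in>C. d u v < e1 \<longrightarrow> v \<in> U"
      using UV u unfolding dist_open_def by blast
    obtain e2 where e2: "e2 > 0" "\<forall>v\<in>C. d u v < e2 \<longrightarrow> v \<in> V"
      using UV u unfolding dist_open_def by blast
    have "min e1 e2 > 0" "\<forall>v\<in>C. d u v < min e1 e2 \<longrightarrow> v \<in> U \<inter> V"
      using e1 e2 by auto
    then show "\<exists>e>0. \<forall>v\<in>C. d u v < e \<longrightarrow> v \<in> U \<inter> V" by blast
  qed
next
  fix K assume "\<forall>U\<in>K. dist_open C d U"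
  then show "dist_open C d (\<Union>K)" unfolding dist_open_def by (meson Sup_le_iff UnionE UnionI)
qed

lemma openin_dist_topology: "openin (dist_topology C d) U \<longleftrightarrow> dist_open C d U"
  by (simp add: dist_topology_def istopology_dist_open topology_inverse')

lemma topspace_dist_topology [simp]: "topspace (dist_topology C d) = C"
proof
  show "topspace (dist_topology C d) \<subseteq> C"
    unfolding topspace_def by (auto simp: openin_dist_topology dist_open_def)
  have "dist_open C d C" unfolding dist_open_def using zero_less_one by blast
  then show "C \<subseteq> topspace (dist_topology C d)"
    by (meson openin_dist_topology openin_subset)
qed

definition borel_sigma :: "'x topology \<Rightarrow> 'x measure" where
  "borel_sigma X = sigma (topspace X) {U. openin X U}"

subsection \<open>Lebesgue and Sobolev spaces on a subset of Euclidean space\<close>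

definition Lq_norm :: "(real^'n) set \<Rightarrow> ennreal \<Rightarrow> (real^'n \<Rightarrow> real) \<Rightarrow> ennreal" where
  "Lq_norm S q u =
     (if q = \<infinity> then esssup (lebesgue_on S) (\<lambda>x. ennreal \<bar>u x\<bar>)
      else let I = (\<integral>\<^sup>+x. ennreal (\<bar>u x\<bar> powr enn2real q) \<partial>lebesgue_on S)
           in if I = \<infinity> then \<infinity> else ennreal (enn2real I powr (1 / enn2real q)))"

definition Lq :: "(real^'n) set \<Rightarrow> ennreal \<Rightarrow> (real^'n \<Rightarrow> real) set" where
  "Lq S q = {u \<in> borel_measurable (lebesgue_on S). Lq_norm S q u < \<infinity>}"

primrec Ck :: "nat \<Rightarrow> (real^'n \<Rightarrow> real) \<Rightarrow> bool" where
  "Ck 0 \<phi> \<longleftrightarrow> continuous_on UNIV \<phi>"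
| "Ck (Suc k) \<phi> \<longleftrightarrow> (\<forall>x. \<phi> differentiable (at x)) \<and>
     (\<forall>i. Ck k (\<lambda>x. frechet_derivative \<phi> (at x) (axis i 1)))"

text \<open>The space of smooth functions with compact support in \<open>S\<close>.\<close>

definition test_functions :: "(real^'n) set \<Rightarrow> (real^'n \<Rightarrow> real) set" where
  "test_functions S =
     {\<phi>. (\<forall>k. Ck k \<phi>) \<and> compact (closure {x. \<phi> x \<noteq> 0}) \<and> closure {x. \<phi> x \<noteq> 0} \<subseteq> S}"

definition has_weak_gradient ::
    "(real^'n) set \<Rightarrow> (real^'n \<Rightarrow> real) \<Rightarrow> (real^'n \<Rightarrow> real^'n) \<Rightarrow> bool" where
  "has_weak_gradient S u G \<longleftrightarrow>
     (\<forall>K. compact K \<and> K \<subseteq> S \<longrightarrow> integrable (lebesgue_on K) u \<and> integrable (lebesgue_on K) G) \<and>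
     (\<forall>\<phi>\<in>test_functions S. \<forall>i.
        (\<integral>x. u x * frechet_derivative \<phi> (at x) (axis i 1) \<partial>lebesgue_on S)
          = - (\<integral>x. (G x $ i) * \<phi> x \<partial>lebesgue_on S))"

text \<open>On open \<open>S\<close> the weak gradient, if it exists, is unique almost everywhere.\<close>

definition weak_gradient :: "(real^'n) set \<Rightarrow> (real^'n \<Rightarrow> real) \<Rightarrow> real^'n \<Rightarrow> real^'n" where
  "weak_gradient S u = (SOME G. has_weak_gradient S u G)"

definition sobolev :: "(real^'n) set \<Rightarrow> real \<Rightarrow> (real^'n \<Rightarrow> real) set" where
  "sobolev S p = {u \<in> Lq S (ennreal p).
     \<exists>G. has_weak_gradient S u G \<and> (\<forall>i. (\<lambda>x. G x $ i) \<in> Lq S (ennreal p))}"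

text \<open>
  Class \<open>C\<^sup>1\<close>: locally at each boundary point, after a rigid change of coordinates with \<open>v\<close> as last
  coordinate direction, \<open>S\<close> is the region strictly above the graph of a \<open>C\<^sup>1\<close> function of the
  remaining coordinates. That function lives on the hyperplane orthogonal to \<open>v\<close>; it is given by
  \<open>\<gamma>\<close>, which is evaluated only there.
\<close>

definition C1_domain :: "(real^'n) set \<Rightarrow> bool" where
  "C1_domain S \<longleftrightarrow> (\<forall>x\<in>frontier S. \<exists>r>0. \<exists>v \<gamma>. norm v = 1 \<and> Ck 1 \<gamma> \<and>
     S \<inter> ball x r = {y \<in> ball x r. y \<bullet> v > \<gamma> (y - (y \<bullet> v) *\<^sub>R v)})"

definition L1_between :: "(real^'n) set \<Rightarrow> real \<Rightarrow> real \<Rightarrow> (real^'n \<Rightarrow> real) set" where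
  "L1_between S g1 g2 = {\<gamma> \<in> Lq S 1. AE x in lebesgue_on S. g1 \<le> \<gamma> x \<and> \<gamma> x \<le> g2}"

subsection \<open>The space of integrable random elements of $L^1(S)$\<close>

definition L1_topology :: "(real^'n) set \<Rightarrow> (real^'n \<Rightarrow> real) topology" where
  "L1_topology S = dist_topology (Lq S 1) (\<lambda>u v. Lq_norm S 1 (\<lambda>x. u x - v x))"

definition L1L1_norm :: "'w measure \<Rightarrow> (real^'n) set \<Rightarrow> ('w \<Rightarrow> real^'n \<Rightarrow> real) \<Rightarrow> ennreal" where
  "L1L1_norm P S f = (\<integral>\<^sup>+\<omega>. Lq_norm S 1 (f \<omega>) \<partial>P)"

definition L1L1 :: "'w measure \<Rightarrow> (real^'n) set \<Rightarrow> ('w \<Rightarrow> real^'n \<Rightarrow> real) set" where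
  "L1L1 P S = {f \<in> P \<rightarrow>\<^sub>M borel_sigma (L1_topology S). L1L1_norm P S f < \<infinity>}"

definition L1L1_topology :: "'w measure \<Rightarrow> (real^'n) set \<Rightarrow> ('w \<Rightarrow> real^'n \<Rightarrow> real) topology" where
  "L1L1_topology P S = dist_topology (L1L1 P S) (\<lambda>f h. L1L1_norm P S (\<lambda>\<omega> x. f \<omega> x - h \<omega> x))"

subsection \<open>The operators\<close>

text \<open>Where the gradient vanishes, so does the flux, since \<open>scaleR\<close> is applied to the zero vector.\<close>

definition A_op :: "'w measure \<Rightarrow> (real^'n) set \<Rightarrow> real \<Rightarrow> ('w \<Rightarrow> real^'n \<Rightarrow> real)
    \<Rightarrow> (('w \<Rightarrow> real^'n \<Rightarrow> real) \<times> ('w \<Rightarrow> real^'n \<Rightarrow> real)) set" where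
  "A_op P S p g = {(f, f'). f \<in> L1L1 P S \<and> f' \<in> L1L1 P S \<and>
     \<P>(\<omega> in P. f \<omega> \<in> sobolev S p \<inter> Lq S \<infinity>) = 1 \<and>
     \<P>(\<omega> in P. \<forall>\<phi>\<in>sobolev S p \<inter> Lq S \<infinity>.
        (\<integral>x. g \<omega> x * ((norm (weak_gradient S (f \<omega>) x) powr (p - 2)) *\<^sub>R weak_gradient S (f \<omega>) x
                 \<bullet> weak_gradient S \<phi> x) \<partial>lebesgue_on S)
          = (\<integral>x. f' \<omega> x * \<phi> x \<partial>lebesgue_on S)) = 1}"

definition A_closure :: "'w measure \<Rightarrow> (real^'n) set \<Rightarrow> real \<Rightarrow> ('w \<Rightarrow> real^'n \<Rightarrow> real)
    \<Rightarrow> (('w \<Rightarrow> real^'n \<Rightarrow> real) \<times> ('w \<Rightarrow> real^'n \<Rightarrow> real)) set" where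
  "A_closure P S p g =
     prod_topology (L1L1_topology P S) (L1L1_topology P S) closure_of A_op P S p g"

text \<open>Accretivity of an operator on $L^1(\Omega; L^1(S))$.\<close>

definition accretive :: "'w measure \<Rightarrow> (real^'n) set
    \<Rightarrow> (('w \<Rightarrow> real^'n \<Rightarrow> real) \<times> ('w \<Rightarrow> real^'n \<Rightarrow> real)) set \<Rightarrow> bool" where
  "accretive P S B \<longleftrightarrow> (\<forall>(f, f')\<in>B. \<forall>(h, h')\<in>B. \<forall>\<alpha>::real. \<alpha> > 0 \<longrightarrow>
     L1L1_norm P S (\<lambda>\<omega> x. f \<omega> x - h \<omega> x)
       \<le> L1L1_norm P S (\<lambda>\<omega> x. f \<omega> x - h \<omega> x + \<alpha> * (f' \<omega> x - h' \<omega> x)))"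

end

theory Submission
  imports Defs
begin

text \<open>
  Two facts carry the theorem. Write \<open>u = f - h\<close> and \<open>v = f' - h'\<close> for two pairs \<open>(f, f')\<close>, \<open>(h, h')\<close>
  at a fixed \<open>\<omega>\<close>.

  For pairs in the operator itself, \<open>T u\<close> is an admissible test function whenever \<open>T\<close> is \<open>C\<^sup>1\<close> and
  nondecreasing with \<open>T\<close> and \<open>T'\<close> bounded. By the chain rule its gradient is \<open>T' u\<close> times the difference
  of the two gradients, so subtracting the two weak equations gives
  \<open>\<integral> v * T u = \<integral> g * T' u * (flux (grad f) - flux (grad h)) \<bullet> (grad f - grad h) \<ge> 0\<close>,
  because the flux is a monotone vector field (\<open>weak_solution_pairing_nonneg\<close>). The property
  \<open>\<integral> v * T u \<ge> 0\<close> for all such \<open>T\<close> is \<open>pairing_nonneg\<close>.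

  This property alone implies \<open>\<parallel>u\<parallel>\<^sub>q \<le> \<parallel>u + \<alpha> v\<parallel>\<^sub>q\<close> for every \<open>q\<close> (\<open>pairing_Lq_norm_le\<close>): it extends to all
  bounded continuous nondecreasing \<open>T\<close>, and for \<open>q < \<infinity>\<close> one takes for \<open>T\<close> a truncation of the
  derivative of \<open>|s|\<^sup>q\<close> and uses that a convex function lies above its tangents, whereas for \<open>q = \<infinity>\<close>
  one takes a \<open>T\<close> that vanishes exactly on \<open>[-K, K]\<close>, with \<open>K\<close> the norm on the right.

  The property is also stable under convergence in \<open>L\<^sup>1\<close> (\<open>pairing_nonneg_closed\<close>), which passes it on to
  the closure: convergence in \<open>L\<^sup>1(\<Omega>; L\<^sup>1(S))\<close> yields, for almost every \<open>\<omega>\<close>, approximating pairs of the operator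
  that are arbitrarily close in \<open>L\<^sup>1(S)\<close>. Here the distance of two random elements has to be a measurable
  function of \<open>\<omega>\<close>, which holds because \<open>L\<^sup>1(S)\<close> is separable. Accretivity is the case \<open>q = 1\<close>, integrated
  over \<open>\<Omega>\<close>.

  The chain rule is proved with difference quotients instead of mollifiers. For a weakly
  differentiable \<open>u\<close> the quotient \<open>(u (x + k e) - u x) / k\<close> is almost everywhere the average of the partial
  derivative over the segment from \<open>x\<close> to \<open>x + k e\<close> (\<open>weak_increment\<close>), and such averages converge in
  \<open>L\<^sup>1\<close> since translations act continuously on \<open>L\<^sup>1\<close>. Density of step functions over boxes with rational
  corners gives both this continuity and the separability.
\<close>

section \<open>Density of step functions in $L^1$\<close>

lemma norm_mult_bounded_le:
  fixes v f :: real
  assumes "\<bar>f\<bar> \<le> B" shows "norm (v * f) \<le> B * \<bar>v\<bar>"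
  using mult_left_mono[OF assms abs_ge_zero[of v]] by (simp add: abs_mult mult.commute)

lemma integrable_mult_bounded:
  fixes v f :: "'a \<Rightarrow> real"
  assumes v: "integrable M v" and [measurable]: "f \<in> borel_measurable M" and B: "\<And>x. \<bar>f x\<bar> \<le> B"
  shows "integrable M (\<lambda>x. v x * f x)"
proof (rule Bochner_Integration.integrable_bound[OF integrable_mult_right[OF v, of B]])
  have [measurable]: "v \<in> borel_measurable M" using v by auto
  show "(\<lambda>x. v x * f x) \<in> borel_measurable M" by measurable
  have "norm (v x * f x) \<le> norm (B * v x)" for x
    using norm_mult_bounded_le[OF B, of "v x"] B[of undefined] by (simp add: abs_mult)
  then show "AE x in M. norm (v x * f x) \<le> norm (B * v x)" by (rule AE_I2)
qed

lemma integral_mult_bounded_le: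
  fixes v f :: "'a \<Rightarrow> real"
  assumes v: "integrable M v" and f: "f \<in> borel_measurable M" and B: "\<And>x. \<bar>f x\<bar> \<le> B"
  shows "norm (\<integral>x. v x * f x \<partial>M) \<le> B * (\<integral>x. \<bar>v x\<bar> \<partial>M)"
proof -
  have "norm (\<integral>x. v x * f x \<partial>M) \<le> (\<integral>x. B * \<bar>v x\<bar> \<partial>M)"
    by (intro order_trans[OF integral_norm_bound integral_mono] integrable_norm integrable_mult_right
        integrable_abs integrable_mult_bounded[OF v f B] v norm_mult_bounded_le B)
  then show ?thesis by simp
qed

definition rat_box :: "('n::finite \<Rightarrow> rat) \<Rightarrow> ('n \<Rightarrow> rat) \<Rightarrow> (real^'n) set" where
  "rat_box a b = box (\<chi> i. of_rat (a i)) (\<chi> i. of_rat (b i))"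

lemma mem_rat_box: "x \<in> rat_box a b \<longleftrightarrow> (\<forall>i. of_rat (a i) < x $ i \<and> x $ i < of_rat (b i))"
  by (simp add: rat_box_def mem_box_cart)

lemma rat_box_Int: "rat_box a b \<inter> rat_box c d = rat_box (\<lambda>i. max (a i) (c i)) (\<lambda>i. min (b i) (d i))"
proof -
  have "real_of_rat (max r s) = max (of_rat r) (of_rat s)" "real_of_rat (min r s) = min (of_rat r) (of_rat s)"
    for r s by (auto simp: max_def min_def of_rat_less_eq)
  then show ?thesis by (auto simp: mem_rat_box)
qed

lemma sets_rat_box [measurable]: "rat_box a b \<in> sets borel"
  by (simp add: rat_box_def)

lemma emeasure_rat_box: "emeasure lborel (rat_box a b) < \<infinity>"
  unfolding rat_box_def by (rule emeasure_bounded_finite) simp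

lemma rat_box_neighbourhood:
  fixes x :: "real^'n"
  assumes "open S" "x \<in> S"
  obtains a b where "x \<in> rat_box a b" "closure (rat_box a b) \<subseteq> S"
proof -
  obtain e where e: "e > 0" "cball x e \<subseteq> S" using assms open_contains_cball by blast
  from rational_boxes[OF e(1), of x] obtain a b where ab: "\<forall>i\<in>Basis. a \<bullet> i \<in> \<rat> \<and> b \<bullet> i \<in> \<rat>"
        "x \<in> box a b" "box a b \<subseteq> ball x e" by auto
  have "\<forall>i. a $ i \<in> \<rat>" "\<forall>i. b $ i \<in> \<rat>"
    using ab by (auto simp: inner_axis' Basis_vec_def cart_eq_inner_axis)
  then obtain a' b' where "\<forall>i. a $ i = of_rat (a' i)" "\<forall>i. b $ i = of_rat (b' i)"
    unfolding Rats_def image_iff by metis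
  then have eq: "rat_box a' b' = box a b" by (auto simp: mem_rat_box mem_box_cart)
  have "closure (box a b) \<subseteq> cball x e" using ab(3) by (intro closure_minimal) auto
  then show ?thesis using that[of a' b'] eq ab e by auto
qed

lemma eventually_in_rat_cube:
  "eventually (\<lambda>n. x \<in> rat_box (\<lambda>i. - of_nat n) (\<lambda>i. of_nat n)) sequentially"
proof -
  obtain k where k: "norm x < real k" using reals_Archimedean2 by blast
  have "x \<in> rat_box (\<lambda>i. - of_nat n) (\<lambda>i. of_nat n)" if "n \<ge> k" for n
  proof -
    have "\<bar>x $ i\<bar> < real n" for i using k component_le_norm_cart[of x i] that by linarith
    then show ?thesis unfolding mem_rat_box by (auto simp: of_rat_minus abs_less_iff) (metis minus_less_iff)
  qed
  then show ?thesis unfolding eventually_sequentially by blast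
qed

lemma borel_eq_rat_box: "borel = sigma UNIV (range (\<lambda>(a, b). rat_box a b :: (real^'n) set))"
proof (rule borel_eq_sigmaI1[OF borel_def])
  fix M :: "(real^'n) set" assume "M \<in> {S. open S}"
  then have M: "open M" by simp
  have "x \<in> \<Union>{B \<in> range (\<lambda>(a, b). rat_box a b). B \<subseteq> M}" if x: "x \<in> M" for x
  proof -
    obtain a b where "x \<in> rat_box a b" "closure (rat_box a b) \<subseteq> M" by (rule rat_box_neighbourhood[OF M x])
    moreover have "rat_box a b \<subseteq> closure (rat_box a b)" by (rule closure_subset)
    ultimately show ?thesis by fastforce
  qed
  then have eq: "M = \<Union>{B \<in> range (\<lambda>(a, b). rat_box a b). B \<subseteq> M}" by blast
  have "countable {B \<in> range (\<lambda>(a, b). rat_box a b :: (real^'n) set). B \<subseteq> M}" by simp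
  then show "M \<in> sigma UNIV (range (\<lambda>(a, b). rat_box a b))"
    by (subst eq) (rule sets.countable_Union, auto)
qed (auto simp: rat_box_def)

lemmas integrable_arith = Bochner_Integration.integrable_add Bochner_Integration.integrable_diff
  integrable_abs integrable_mult_right

text \<open>
  The description of a step function is an element of a countable type, so the step functions form a
  countable family.
\<close>

definition step_fun :: "(rat \<times> ('n::finite \<Rightarrow> rat) \<times> ('n \<Rightarrow> rat)) list \<Rightarrow> real^'n \<Rightarrow> real" where
  "step_fun l x = (\<Sum>(c, a, b)\<leftarrow>l. of_rat c * indicator (rat_box a b) x)"

lemma step_fun_Nil [simp]: "step_fun [] = (\<lambda>x. 0)"
  by (auto simp: step_fun_def)

lemma step_fun_Cons: "step_fun ((c, a, b) # l) = (\<lambda>x. of_rat c * indicator (rat_box a b) x + step_fun l x)"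
  by (auto simp: step_fun_def)

lemma step_fun_append: "step_fun (l @ m) x = step_fun l x + step_fun m x"
  by (simp add: step_fun_def)

lemma step_fun_scale: "step_fun (map (\<lambda>(c, ab). (r * c, ab)) l) x = of_rat r * step_fun l x"
  by (induction l) (auto simp: step_fun_Cons algebra_simps of_rat_mult)

lemma integrable_step_fun: "integrable lborel (step_fun l)"
proof (induction l)
  case (Cons t l)
  then show ?case
    by (cases t) (auto simp: step_fun_Cons emeasure_rat_box[unfolded infinity_ennreal_def]
        intro!: integrable_real_indicator integrable_arith)
qed simp

definition step_approx :: "(real^'n \<Rightarrow> real) \<Rightarrow> bool" where
  "step_approx f \<longleftrightarrow> integrable lborel f \<and> (\<forall>e>0. \<exists>l. (\<integral>x. \<bar>f x - step_fun l x\<bar> \<partial>lborel) < e)"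

lemma step_approx_add:
  assumes "step_approx f" "step_approx h" shows "step_approx (\<lambda>x. f x + h x)"
  unfolding step_approx_def
proof (intro conjI allI impI)
  have i: "integrable lborel f" "integrable lborel h" using assms by (auto simp: step_approx_def)
  then show "integrable lborel (\<lambda>x. f x + h x)" by auto
  fix e :: real assume "e > 0"
  then obtain l m where l: "(\<integral>x. \<bar>f x - step_fun l x\<bar> \<partial>lborel) < e/2" 
    and m: "(\<integral>x. \<bar>h x - step_fun m x\<bar> \<partial>lborel) < e/2"
    using assms unfolding step_approx_def by (meson half_gt_zero)
  note [intro!] = integrable_arith integrable_step_fun i
  have "(\<integral>x. \<bar>f x + h x - step_fun (l @ m) x\<bar> \<partial>lborel)
      \<le> (\<integral>x. \<bar>f x - step_fun l x\<bar> + \<bar>h x - step_fun m x\<bar> \<partial>lborel)"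
    by (rule integral_mono) (auto simp: step_fun_append)
  also have "\<dots> = (\<integral>x. \<bar>f x - step_fun l x\<bar> \<partial>lborel) + (\<integral>x. \<bar>h x - step_fun m x\<bar> \<partial>lborel)"
    by (rule Bochner_Integration.integral_add) auto
  also have "\<dots> < e" using l m by simp
  finally show "\<exists>l. (\<integral>x. \<bar>f x + h x - step_fun l x\<bar> \<partial>lborel) < e" by blast
qed

text \<open>
  The real factor \<open>c\<close> is not available as a coefficient. It is replaced by a rational number chosen after
  the approximating step function, whose norm controls the resulting error.
\<close>

lemma step_approx_cmult:
  assumes "step_approx f" shows "step_approx (\<lambda>x. c * f x)"
  unfolding step_approx_def
proof (intro conjI allI impI)
  have i: "integrable lborel f" using assms by (auto simp: step_approx_def)
  then show "integrable lborel (\<lambda>x. c * f x)" by auto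
  fix e :: real assume e: "e > 0"
  then have "e / 2 / (\<bar>c\<bar> + 1) > 0" by (auto intro!: divide_pos_pos add_nonneg_pos)
  then obtain l where l: "(\<integral>x. \<bar>f x - step_fun l x\<bar> \<partial>lborel) < e / 2 / (\<bar>c\<bar> + 1)" 
    using assms unfolding step_approx_def by blast
  define I where "I = (\<integral>x. \<bar>step_fun l x\<bar> \<partial>lborel)"
  have I: "I \<ge> 0" unfolding I_def by simp
  have "e / 2 / (I + 1) > 0" using e I by (auto intro!: divide_pos_pos add_nonneg_pos)
  then obtain r where r: "\<bar>c - of_rat r\<bar> < e / 2 / (I + 1)"
    using of_rat_dense[of "c - e / 2 / (I + 1)" c] by (smt (verit) )
  note [intro!] = integrable_arith integrable_step_fun i
  have "(\<integral>x. \<bar>c * f x - of_rat r * step_fun l x\<bar> \<partial>lborel)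
      \<le> (\<integral>x. \<bar>c\<bar> * \<bar>f x - step_fun l x\<bar> + \<bar>c - of_rat r\<bar> * \<bar>step_fun l x\<bar> \<partial>lborel)"
  proof (rule integral_mono)
    fix x
    have "c * f x - of_rat r * step_fun l x = c * (f x - step_fun l x) + (c - of_rat r) * step_fun l x"
      by (simp add: algebra_simps)
    then show "\<bar>c * f x - of_rat r * step_fun l x\<bar> \<le> \<bar>c\<bar> * \<bar>f x - step_fun l x\<bar> + \<bar>c - of_rat r\<bar> * \<bar>step_fun l x\<bar>"
      by (metis abs_mult abs_triangle_ineq)
  qed auto
  also have "\<dots> = \<bar>c\<bar> * (\<integral>x. \<bar>f x - step_fun l x\<bar> \<partial>lborel) + \<bar>c - of_rat r\<bar> * I"
    unfolding I_def by (subst Bochner_Integration.integral_add) auto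
  also have "\<dots> < e"
  proof -
    have "\<bar>c\<bar> * (\<integral>x. \<bar>f x - step_fun l x\<bar> \<partial>lborel) \<le> \<bar>c\<bar> * (e / 2 / (\<bar>c\<bar> + 1))"
      using l by (intro mult_left_mono) auto
    also have "\<dots> < e / 2" using e by (auto simp: field_simps add_nonneg_pos)
    finally have 1: "\<bar>c\<bar> * (\<integral>x. \<bar>f x - step_fun l x\<bar> \<partial>lborel) < e / 2" .
    have "\<bar>c - of_rat r\<bar> * I \<le> e / 2 / (I + 1) * I" using r I by (intro mult_right_mono) auto
    also have "\<dots> \<le> e / 2" using e I by (auto simp: field_simps add_nonneg_pos)
    finally show ?thesis using 1 by simp
  qed
  finally show "\<exists>l. (\<integral>x. \<bar>c * f x - step_fun l x\<bar> \<partial>lborel) < e"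
    unfolding step_fun_scale[symmetric] by blast
qed

lemma step_approx_lim:
  assumes s: "\<And>n. step_approx (s n)" and f: "f \<in> borel_measurable lborel" and w: "integrable lborel w"
    and lim: "\<And>x. (\<lambda>n. s n x) \<longlonglongrightarrow> f x" and bd: "\<And>n x. \<bar>s n x\<bar> \<le> w x"
  shows "step_approx f"
  unfolding step_approx_def
proof (intro conjI allI impI)
  have i: "integrable lborel (s n)" for n using s by (auto simp: step_approx_def)
  have [measurable]: "s n \<in> borel_measurable lborel" for n using i by auto
  have bf: "\<bar>f x\<bar> \<le> w x" for x
    by (rule LIMSEQ_le_const2[OF tendsto_rabs[OF lim]]) (use bd in auto)
  show fi: "integrable lborel f"
    by (rule Bochner_Integration.integrable_bound[OF w f]) (use bf in \<open>auto intro: order_trans[OF _ abs_ge_self]\<close>)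
  have "(\<lambda>n. \<integral>x. \<bar>f x - s n x\<bar> \<partial>lborel) \<longlonglongrightarrow> (\<integral>x. 0 \<partial>(lborel :: (real^'a) measure))"
  proof (rule integral_dominated_convergence[where w = "\<lambda>x. 2 * w x"])
    show "AE x in lborel. (\<lambda>n. \<bar>f x - s n x\<bar>) \<longlonglongrightarrow> 0"
    proof (rule AE_I2)
      fix x show "(\<lambda>n. \<bar>f x - s n x\<bar>) \<longlonglongrightarrow> 0"
        using tendsto_rabs[OF tendsto_diff[OF tendsto_const[of "f x"] lim[of x]]] by simp
    qed
    have "\<bar>f x - s n x\<bar> \<le> 2 * w x" for n x using bf[of x] bd[of n x] by linarith
    then show "AE x in lborel. norm \<bar>f x - s n x\<bar> \<le> 2 * w x" for n by simp
  qed (use w f in auto)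
  then have lim0: "(\<lambda>n. \<integral>x. \<bar>f x - s n x\<bar> \<partial>lborel) \<longlonglongrightarrow> 0" by simp
  fix e :: real assume e: "e > 0"
  then have "eventually (\<lambda>n. (\<integral>x. \<bar>f x - s n x\<bar> \<partial>lborel) < e/2) sequentially"
    by (intro order_tendstoD(2)[OF lim0]) auto
  then obtain n where n: "(\<integral>x. \<bar>f x - s n x\<bar> \<partial>lborel) < e/2"
    using eventually_happens' sequentially_bot by blast
  obtain l where l: "(\<integral>x. \<bar>s n x - step_fun l x\<bar> \<partial>lborel) < e/2"
    using s e unfolding step_approx_def by (meson half_gt_zero)
  note [intro!] = integrable_arith integrable_step_fun i fi
  have "(\<integral>x. \<bar>f x - step_fun l x\<bar> \<partial>lborel)
      \<le> (\<integral>x. \<bar>f x - s n x\<bar> + \<bar>s n x - step_fun l x\<bar> \<partial>lborel)"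
    by (rule integral_mono) auto
  also have "\<dots> = (\<integral>x. \<bar>f x - s n x\<bar> \<partial>lborel) + (\<integral>x. \<bar>s n x - step_fun l x\<bar> \<partial>lborel)"
    by (rule Bochner_Integration.integral_add) auto
  also have "\<dots> < e" using l n by simp
  finally show "\<exists>l. (\<integral>x. \<bar>f x - step_fun l x\<bar> \<partial>lborel) < e" by blast
qed

lemma step_approx_rat_box: "step_approx (indicator (rat_box a b))"
proof -
  have "step_fun [(1, a, b)] = (indicator (rat_box a b) :: _ \<Rightarrow> real)" by (auto simp: step_fun_Cons)
  then show ?thesis using integrable_step_fun[of "[(1, a, b)]"]
    unfolding step_approx_def by (metis (no_types, lifting) Bochner_Integration.integral_cong abs_zero integral_zero diff_self)
qed

text \<open>
  Rational boxes are stable under intersection and generate the Borel sets, so it suffices that the approximable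
  sets form a Dynkin system. Inside a fixed box all indicators are dominated by an integrable function.
\<close>

lemma step_approx_indicator_Int:
  fixes A :: "(real^'n) set"
  assumes "A \<in> sets borel"
  shows "step_approx (indicator (A \<inter> rat_box a b))"
proof -
  have G: "A \<in> sigma_sets UNIV (range (\<lambda>(a, b). rat_box a b))"
    using assms by (subst (asm) borel_eq_rat_box) simp
  have stable: "Int_stable (range (\<lambda>(a, b). rat_box a b :: (real^'n) set))"
    by (auto simp: Int_stable_def rat_box_Int)
  show ?thesis using stable subset_Pow_Union[THEN order_trans, OF Pow_mono[OF subset_UNIV]] G
  proof (induction rule: sigma_sets_induct_disjoint)
    case (basic A) then show ?case by (auto simp: rat_box_Int step_approx_rat_box)
  next
    case empty then show ?case using step_approx_cmult[OF step_approx_rat_box, of 0] by (simp add: indicator_def [abs_def])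
  next
    case (compl A)
    have "indicator ((UNIV - A) \<inter> rat_box a b) = (\<lambda>x. indicator (rat_box a b) x + (-1) * indicator (A \<inter> rat_box a b) x :: real)"
      by (auto simp: indicator_def)
    then show ?case using compl by (simp only: step_approx_add step_approx_cmult step_approx_rat_box)
  next
    case (union A)
    have m [measurable]: "A i \<in> sets borel" for i using union(2) by (subst borel_eq_rat_box) auto
    define s where "s n x = (\<Sum>i<n. indicator (A i \<inter> rat_box a b) x :: real)" for n x
    have s: "s n x = indicator ((\<Union>i<n. A i) \<inter> rat_box a b) x" for n x
      unfolding s_def by (subst indicator_UN_disjoint[symmetric])
        (use union(1) in \<open>auto simp: disjoint_family_on_def\<close>)
    show ?case
    proof (rule step_approx_lim)
      show "step_approx (s n)" for n
      proof (induction n)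
        case 0 show ?case using step_approx_cmult[OF step_approx_rat_box, of 0] by (simp add: s_def [abs_def])
      next
        case (Suc n) then show ?case using step_approx_add[OF Suc union(3)[of n]]
          by (simp add: s_def [abs_def])
      qed
      show "integrable lborel (indicator (rat_box a b) :: _ \<Rightarrow> real)"
        using step_approx_rat_box by (auto simp: step_approx_def)
      show "\<bar>s n x\<bar> \<le> indicator (rat_box a b) x" for n x by (simp add: s indicator_def)
      show "(\<lambda>n. s n x) \<longlonglongrightarrow> indicator (\<Union> (range A) \<inter> rat_box a b) x" for x
      proof (cases "x \<in> \<Union> (range A)")
        case True
        then obtain k where "x \<in> A k" by auto
        then have "eventually (\<lambda>n. s n x = indicator (\<Union> (range A) \<inter> rat_box a b) x) sequentially"
          unfolding eventually_sequentially s by (intro exI[of _ "Suc k"]) (auto simp: indicator_def)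
        then show ?thesis by (rule tendsto_eventually)
      next
        case False then show ?thesis by (simp add: s indicator_def)
      qed
    qed auto
  qed
qed

lemma step_approx_integrable:
  fixes f :: "real^'n \<Rightarrow> real"
  assumes "integrable lborel f"
  shows "step_approx f"
  using assms
proof (induction rule: integrable_induct)
  case (base A c)
  then have A [measurable]: "A \<in> sets borel" by simp
  define C :: "nat \<Rightarrow> (real^'n) set" where "C n = rat_box (\<lambda>i. - of_nat n) (\<lambda>i. of_nat n)" for n
  have "step_approx (indicator A)"
  proof (rule step_approx_lim)
    show "step_approx (indicator (A \<inter> C n))" for n unfolding C_def by (rule step_approx_indicator_Int) simp
    show "integrable lborel (indicator A :: _ \<Rightarrow> real)" using base by auto
    show "\<bar>indicator (A \<inter> C n) x\<bar> \<le> (indicator A x :: real)" for n x by (auto simp: indicator_def)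
    show "(\<lambda>n. indicator (A \<inter> C n) x :: real) \<longlonglongrightarrow> indicator A x" for x
    proof -
      have "eventually (\<lambda>n. indicator (A \<inter> C n) x = (indicator A x :: real)) sequentially"
        using eventually_in_rat_cube[of x] unfolding C_def by eventually_elim (auto simp: indicator_def)
      then show ?thesis by (rule tendsto_eventually)
    qed
  qed auto
  from step_approx_cmult[OF this, of c] show ?case by (simp add: mult.commute)
next
  case (lim f s)
  show ?case
    by (rule step_approx_lim[of s _ "\<lambda>x. 2 * \<bar>f x\<bar>"]) (use lim in auto)
qed (rule step_approx_add)

lemma step_fun_dense_L1:
  assumes "integrable lborel f" "e > 0"
  obtains l where "(\<integral>x. \<bar>f x - step_fun l x\<bar> \<partial>lborel) < e"
  using step_approx_integrable[OF assms(1)] assms(2) unfolding step_approx_def by blast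

section \<open>Continuity of translations in $L^1$\<close>

lemma integrable_translate:
  fixes f :: "'a::euclidean_space \<Rightarrow> 'b::{banach, second_countable_topology}"
  assumes "integrable lborel f" shows "integrable lborel (\<lambda>x. f (x + d))"
proof -
  have [measurable]: "f \<in> borel_measurable borel" using assms by auto
  have "integrable (distr lborel borel ((+) d)) f" using assms by (simp add: lborel_distr_plus)
  then show ?thesis by (subst (asm) integrable_distr_eq) (auto simp: add.commute)
qed

lemma integral_translate:
  fixes f :: "'a::euclidean_space \<Rightarrow> 'b::{banach, second_countable_topology}"
  assumes [measurable]: "f \<in> borel_measurable borel"
  shows "(\<integral>x. f (x + d) \<partial>lborel) = (\<integral>x. f x \<partial>lborel)"
proof -
  have "(\<integral>x. f x \<partial>lborel) = (\<integral>x. f x \<partial>distr lborel borel ((+) d))" by (simp add: lborel_distr_plus)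
  then show ?thesis by (subst (asm) integral_distr) (auto simp: add.commute)
qed

text \<open>
  The norm of the difference of two indicators is expressed by the integral of their product. The product of \<open>1\<^sub>B\<close>
  with its translates converges to \<open>1\<^sub>B\<close> everywhere: outside \<open>B\<close> it vanishes, and \<open>B\<close> is open.
\<close>

lemma translation_continuous_rat_box:
  fixes d :: "nat \<Rightarrow> real^'n"
  assumes d: "d \<longlonglongrightarrow> 0"
  shows "(\<lambda>n. \<integral>x. \<bar>indicator (rat_box a b) (x + d n) - indicator (rat_box a b) x\<bar> \<partial>lborel) \<longlonglongrightarrow> (0::real)"
proof -
  let ?B = "rat_box a b" let ?f = "indicator (rat_box a b) :: real^'n \<Rightarrow> real"
  have i: "integrable lborel ?f" using step_approx_rat_box by (auto simp: step_approx_def)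
  have pi: "integrable lborel (\<lambda>x. ?f x * ?f (x + d n))" for n
    by (rule Bochner_Integration.integrable_bound[OF i]) (auto simp: indicator_def)
  have "(\<lambda>n. \<integral>x. ?f x * ?f (x + d n) \<partial>lborel) \<longlonglongrightarrow> (\<integral>x. ?f x \<partial>lborel)"
  proof (rule integral_dominated_convergence[OF _ _ i])
    show "AE x in lborel. (\<lambda>n. ?f x * ?f (x + d n)) \<longlonglongrightarrow> ?f x"
    proof (rule AE_I2)
      fix x
      show "(\<lambda>n. ?f x * ?f (x + d n)) \<longlonglongrightarrow> ?f x"
      proof (cases "x \<in> ?B")
        case True
        have "open ?B" unfolding rat_box_def by (rule open_box)
        moreover have "(\<lambda>n. x + d n) \<longlonglongrightarrow> x" using tendsto_add[OF tendsto_const d, of x] by simp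
        ultimately have "eventually (\<lambda>n. x + d n \<in> ?B) sequentially" using True topological_tendstoD by blast
        then have "eventually (\<lambda>n. ?f x * ?f (x + d n) = ?f x) sequentially"
          by eventually_elim (auto simp: indicator_def)
        then show ?thesis by (rule tendsto_eventually)
      qed simp
    qed
  qed (auto simp: indicator_def)
  then have "(\<lambda>n. 2 * (\<integral>x. ?f x \<partial>lborel) - 2 * (\<integral>x. ?f x * ?f (x + d n) \<partial>lborel)) \<longlonglongrightarrow> 2 * (\<integral>x. ?f x \<partial>lborel) - 2 * (\<integral>x. ?f x \<partial>lborel)"
    by (intro tendsto_intros)
  moreover have "(\<integral>x. \<bar>?f (x + d n) - ?f x\<bar> \<partial>lborel) = 2 * (\<integral>x. ?f x \<partial>lborel) - 2 * (\<integral>x. ?f x * ?f (x + d n) \<partial>lborel)" for n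
  proof -
    have "(\<integral>x. \<bar>?f (x + d n) - ?f x\<bar> \<partial>lborel) = (\<integral>x. (?f (x + d n) + ?f x) - 2 * (?f x * ?f (x + d n)) \<partial>lborel)"
      by (rule Bochner_Integration.integral_cong) (auto simp: indicator_def)
    also have "\<dots> = (\<integral>x. ?f (x + d n) \<partial>lborel) + (\<integral>x. ?f x \<partial>lborel) - 2 * (\<integral>x. ?f x * ?f (x + d n) \<partial>lborel)"
      using i pi[of n] integrable_translate[OF i, of "d n"] by (simp add: Bochner_Integration.integral_diff Bochner_Integration.integral_add)
    finally show ?thesis using integral_translate[of ?f "d n"] by simp
  qed
  ultimately show ?thesis by simp
qed

lemma translation_continuous_step_fun:
  fixes d :: "nat \<Rightarrow> real^'n"
  assumes d: "d \<longlonglongrightarrow> 0"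
  shows "(\<lambda>n. \<integral>x. \<bar>step_fun l (x + d n) - step_fun l x\<bar> \<partial>lborel) \<longlonglongrightarrow> 0"
proof (induction l)
  case (Cons t l)
  obtain c a b where t: "t = (c, a, b)" by (cases t)
  let ?f = "indicator (rat_box a b) :: real^'n \<Rightarrow> real" and ?s = "step_fun l"
  have i: "integrable lborel ?f" using step_approx_rat_box by (auto simp: step_approx_def)
  note [intro!] = integrable_arith integrable_step_fun i integrable_translate[OF i]
    integrable_translate[OF integrable_step_fun]
  have le: "(\<integral>x. \<bar>step_fun (t # l) (x + d n) - step_fun (t # l) x\<bar> \<partial>lborel)
      \<le> \<bar>of_rat c\<bar> * (\<integral>x. \<bar>?f (x + d n) - ?f x\<bar> \<partial>lborel) + (\<integral>x. \<bar>?s (x + d n) - ?s x\<bar> \<partial>lborel)" for n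
  proof -
    have "(\<integral>x. \<bar>step_fun (t # l) (x + d n) - step_fun (t # l) x\<bar> \<partial>lborel)
       \<le> (\<integral>x. \<bar>of_rat c\<bar> * \<bar>?f (x + d n) - ?f x\<bar> + \<bar>?s (x + d n) - ?s x\<bar> \<partial>lborel)"
    proof (rule integral_mono)
      fix x
      have "step_fun (t # l) (x + d n) - step_fun (t # l) x = of_rat c * (?f (x + d n) - ?f x) + (?s (x + d n) - ?s x)"
        by (simp add: t step_fun_Cons algebra_simps)
      then show "\<bar>step_fun (t # l) (x + d n) - step_fun (t # l) x\<bar> \<le> \<bar>of_rat c\<bar> * \<bar>?f (x + d n) - ?f x\<bar> + \<bar>?s (x + d n) - ?s x\<bar>"
        by (metis abs_mult abs_triangle_ineq)
    qed auto
    also have "\<dots> = \<bar>of_rat c\<bar> * (\<integral>x. \<bar>?f (x + d n) - ?f x\<bar> \<partial>lborel) + (\<integral>x. \<bar>?s (x + d n) - ?s x\<bar> \<partial>lborel)"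
      by (subst Bochner_Integration.integral_add) auto
    finally show ?thesis .
  qed
  have lim: "(\<lambda>n. \<bar>of_rat c\<bar> * (\<integral>x. \<bar>?f (x + d n) - ?f x\<bar> \<partial>lborel) + (\<integral>x. \<bar>?s (x + d n) - ?s x\<bar> \<partial>lborel)) \<longlonglongrightarrow> \<bar>of_rat c\<bar> * 0 + 0"
    by (rule tendsto_add[OF tendsto_mult[OF tendsto_const translation_continuous_rat_box[OF d]] Cons.IH])
  show ?case
  proof (rule tendsto_sandwich[OF _ _ tendsto_const])
    show "\<forall>\<^sub>F n in sequentially. 0 \<le> (\<integral>x. \<bar>step_fun (t # l) (x + d n) - step_fun (t # l) x\<bar> \<partial>lborel)"
      by simp
    show "\<forall>\<^sub>F n in sequentially. (\<integral>x. \<bar>step_fun (t # l) (x + d n) - step_fun (t # l) x\<bar> \<partial>lborel)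
        \<le> \<bar>of_rat c\<bar> * (\<integral>x. \<bar>?f (x + d n) - ?f x\<bar> \<partial>lborel) + (\<integral>x. \<bar>?s (x + d n) - ?s x\<bar> \<partial>lborel)"
      using le by (intro always_eventually allI)
  qed (use lim in simp)
qed simp

text \<open>
  Translations are isometries of \<open>L\<^sup>1\<close>, so the continuity carries over from the dense step functions.
\<close>

lemma translation_continuous_L1:
  fixes f :: "real^'n \<Rightarrow> real"
  assumes f: "integrable lborel f" and d: "d \<longlonglongrightarrow> 0"
  shows "(\<lambda>n. \<integral>x. \<bar>f (x + d n) - f x\<bar> \<partial>lborel) \<longlonglongrightarrow> 0"
proof (rule LIMSEQ_I)
  fix e :: real assume e: "e > 0"
  then obtain l where l: "(\<integral>x. \<bar>f x - step_fun l x\<bar> \<partial>lborel) < e/3" using step_fun_dense_L1[OF f, of "e/3"] by auto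
  obtain N where N: "\<And>n. n \<ge> N \<Longrightarrow> (\<integral>x. \<bar>step_fun l (x + d n) - step_fun l x\<bar> \<partial>lborel) < e/3"
    using LIMSEQ_D[OF translation_continuous_step_fun[OF d, of l], of "e/3"] e by auto
  note [intro!] = integrable_arith integrable_step_fun f integrable_translate[OF f]
    integrable_translate[OF integrable_step_fun]
  have "(\<integral>x. \<bar>f (x + d n) - f x\<bar> \<partial>lborel) < e" if n: "n \<ge> N" for n
  proof -
    have "(\<integral>x. \<bar>f (x + d n) - f x\<bar> \<partial>lborel) \<le> (\<integral>x. \<bar>f (x + d n) - step_fun l (x + d n)\<bar> 
        + \<bar>step_fun l (x + d n) - step_fun l x\<bar> + \<bar>f x - step_fun l x\<bar> \<partial>lborel)"
      by (rule integral_mono) auto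
    also have "\<dots> = (\<integral>x. \<bar>f (x + d n) - step_fun l (x + d n)\<bar> \<partial>lborel)
        + (\<integral>x. \<bar>step_fun l (x + d n) - step_fun l x\<bar> \<partial>lborel) + (\<integral>x. \<bar>f x - step_fun l x\<bar> \<partial>lborel)"
    proof -
      have "integrable lborel (\<lambda>x. \<bar>f (x + d n) - step_fun l (x + d n)\<bar>)"
        "integrable lborel (\<lambda>x. \<bar>step_fun l (x + d n) - step_fun l x\<bar>)"
        "integrable lborel (\<lambda>x. \<bar>f x - step_fun l x\<bar>)" by auto
      then show ?thesis by simp
    qed
    also have "(\<integral>x. \<bar>f (x + d n) - step_fun l (x + d n)\<bar> \<partial>lborel) = (\<integral>x. \<bar>f x - step_fun l x\<bar> \<partial>lborel)"
    proof -
      have [measurable]: "f \<in> borel_measurable borel" "step_fun l \<in> borel_measurable borel"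
        using f integrable_step_fun[of l] by auto
      show ?thesis using integral_translate[of "\<lambda>x. \<bar>f x - step_fun l x\<bar>" "d n"] by simp
    qed
    finally show ?thesis using l N[OF n] by simp
  qed
  then show "\<exists>N. \<forall>n\<ge>N. norm ((\<integral>x. \<bar>f (x + d n) - f x\<bar> \<partial>lborel) - 0) < e" by auto
qed

section \<open>Test functions that approximate boxes\<close>

text \<open>
  The function \<open>t\<^sup>-\<^sup>m exp (-1/t)\<close>, extended by \<open>0\<close> to \<open>t \<le> 0\<close>. The family over all \<open>m\<close> is closed under
  differentiation up to linear combinations, so that smoothness follows by induction on the order.
\<close>

definition flat_exp :: "nat \<Rightarrow> real \<Rightarrow> real" where
  "flat_exp m t = (if t > 0 then exp (- (1 / t)) / t ^ m else 0)"

lemma exp_minus_inverse_le: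
  fixes t :: real
  assumes t: "t > 0" shows "exp (- (1 / t)) \<le> fact N * t ^ N"
proof -
  have s: "(\<lambda>n. (1 / t) ^ n / fact n) sums exp (1 / t)"
    using exp_converges[of "1 / t"] by (simp add: scaleR_conv_of_real divide_inverse mult.commute)
  have "(\<Sum>n\<in>{N}. (1 / t) ^ n / fact n) \<le> (\<Sum>n. (1 / t) ^ n / fact n)"
    by (rule sum_le_suminf) (use s t in \<open>auto simp: sums_iff\<close>)
  then have "(1 / t) ^ N / fact N \<le> exp (1 / t)" using s by (simp add: sums_iff)
  then have "(1 / t) ^ N / fact N * (fact N * t ^ N) \<le> exp (1 / t) * (fact N * t ^ N)"
    by (rule mult_right_mono) (use t in auto)
  moreover have "(1 / t) ^ N / fact N * (fact N * t ^ N) = 1"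
    using t by (simp add: power_one_over)
  ultimately have "1 / exp (1 / t) \<le> fact N * t ^ N" by (simp add: divide_le_eq mult.commute)
  then show ?thesis by (simp add: exp_minus inverse_eq_divide)
qed

text \<open>
  A quadratic bound at \<open>0\<close>, uniform in the sign of \<open>t\<close>, which makes the derivative at \<open>0\<close> vanish.
\<close>

lemma flat_exp_le: "\<bar>flat_exp m t\<bar> \<le> fact (m + 2) * t\<^sup>2"
proof (cases "t > 0")
  case True
  have "t ^ (m + 2) = t\<^sup>2 * t ^ m" by (simp only: power_add mult.commute)
  then have "exp (- (1 / t)) / t ^ m \<le> fact (m + 2) * t\<^sup>2 * t ^ m / t ^ m"
    using exp_minus_inverse_le[OF True, of "m + 2"] True by (intro divide_right_mono) (simp_all only: mult.assoc zero_le_power less_imp_le)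
  also have "\<dots> = fact (m + 2) * t\<^sup>2" using True by (intro nonzero_mult_div_cancel_right) simp
  finally have "flat_exp m t \<le> fact (m + 2) * t\<^sup>2" using True by (simp only: flat_exp_def if_True)
  moreover have "0 \<le> flat_exp m t" by (auto simp: flat_exp_def)
  ultimately show ?thesis by (simp only: abs_of_nonneg)
next
  case False
  then have "flat_exp m t = 0" by (simp add: flat_exp_def)
  moreover have "0 \<le> fact (m + 2) * t\<^sup>2" by (rule mult_nonneg_nonneg[OF fact_ge_zero zero_le_power2])
  ultimately show ?thesis by (simp only: abs_zero)
qed

lemma flat_exp_bounds: "0 \<le> flat_exp 0 t" "flat_exp 0 t \<le> 1"
  by (auto simp: flat_exp_def)

lemma DERIV_flat_exp: 
  "(flat_exp m has_real_derivative - real m * flat_exp (m + 1) t + flat_exp (m + 2) t) (at t)"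
proof -
  consider "t > 0" | "t < 0" | "t = 0" by linarith
  then show ?thesis
  proof cases
    case 1
    have "((\<lambda>t. exp (- (1 / t)) / t ^ m) has_real_derivative - real m * flat_exp (m + 1) t + flat_exp (m + 2) t) (at t)"
      using 1
      by (auto intro!: derivative_eq_intros) (cases m; auto simp: flat_exp_def field_simps power2_eq_square)
    then show ?thesis
      by (rule has_field_derivative_transform_within_open[where S = "{0<..}"]) (use 1 in \<open>auto simp: flat_exp_def\<close>)
  next
    case 2
    have "((\<lambda>t. 0) has_real_derivative - real m * flat_exp (m + 1) t + flat_exp (m + 2) t) (at t)"
      using 2 by (auto simp: flat_exp_def)
    then show ?thesis
      by (rule has_field_derivative_transform_within_open[where S = "{..<0}"]) (use 2 in \<open>auto simp: flat_exp_def\<close>)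
  next
    case 3
    have "(\<lambda>h. flat_exp m h / h) \<midarrow>0\<rightarrow> 0"
    proof (rule Lim_null_comparison)
      show "\<forall>\<^sub>F h in at 0. norm (flat_exp m h / h) \<le> fact (m + 2) * \<bar>h\<bar>"
      proof (rule eventually_at_topological[THEN iffD2], intro exI conjI ballI impI)
        fix h :: real assume "h \<noteq> 0"
        then show "norm (flat_exp m h / h) \<le> fact (m + 2) * \<bar>h\<bar>"
          using flat_exp_le[of m h]
          by (simp only: real_norm_def abs_divide divide_le_eq power2_eq_square mult.assoc abs_mult_self_eq zero_less_abs_iff if_True not_False_eq_True simp_thms)
      qed (rule open_UNIV, simp)
      have "((\<lambda>h::real. fact (m + 2) * \<bar>h\<bar>) \<longlongrightarrow> fact (m + 2) * \<bar>0\<bar>) (at 0)" by (intro tendsto_intros)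
      then show "((\<lambda>h::real. fact (m + 2) * \<bar>h\<bar>) \<longlongrightarrow> 0) (at 0)" by simp
    qed
    then show ?thesis using 3 by (simp add: DERIV_def flat_exp_def)
  qed
qed

lemma Ck_SucD: "Ck (Suc k) \<phi> \<Longrightarrow> Ck k \<phi>"
proof (induction k arbitrary: \<phi>)
  case 0 then show ?case
    by (auto simp: continuous_on_eq_continuous_at differentiable_imp_continuous_within)
qed auto

lemma Ck_const: "Ck k (\<lambda>x. c)"
  by (induction k arbitrary: c) (auto simp: frechet_derivative_const)

lemma Ck_add: "Ck k f \<Longrightarrow> Ck k g \<Longrightarrow> Ck k (\<lambda>x. f x + g x)"
proof (induction k arbitrary: f g)
  case (Suc k)
  have "frechet_derivative (\<lambda>x. f x + g x) (at x) v = frechet_derivative f (at x) v + frechet_derivative g (at x) v" for x v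
    using Suc.prems by (subst frechet_derivative_at[symmetric, OF has_derivative_add[OF frechet_derivative_works[THEN iffD1] frechet_derivative_works[THEN iffD1]]]) auto
  with Suc show ?case by auto
qed (auto intro: continuous_intros)

lemma Ck_mult: "Ck k f \<Longrightarrow> Ck k g \<Longrightarrow> Ck k (\<lambda>x. f x * g x)"
proof (induction k arbitrary: f g)
  case (Suc k)
  have "frechet_derivative (\<lambda>x. f x * g x) (at x) v = f x * frechet_derivative g (at x) v + frechet_derivative f (at x) v * g x" for x v
    using Suc.prems by (subst frechet_derivative_at[symmetric, OF has_derivative_mult[OF frechet_derivative_works[THEN iffD1] frechet_derivative_works[THEN iffD1]]]) auto
  moreover have "Ck k f" "Ck k g" using Suc.prems Ck_SucD by blast+
  ultimately show ?case using Suc by (auto intro!: Ck_add)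
qed (auto intro: continuous_intros)

lemma Ck_prod: "finite I \<Longrightarrow> (\<And>i. i \<in> I \<Longrightarrow> Ck k (f i)) \<Longrightarrow> Ck k (\<lambda>x. \<Prod>i\<in>I. f i x)"
  by (induction I rule: finite_induct) (auto intro: Ck_const Ck_mult)

lemma Ck_flat_exp: "Ck k (\<lambda>x. flat_exp m (c * x $ i + d))"
proof (induction k arbitrary: m)
  case 0
  have "continuous_on UNIV (flat_exp m)" using DERIV_flat_exp DERIV_isCont by (blast intro: continuous_at_imp_continuous_on)
  then show ?case by (auto intro!: continuous_on_compose2[of UNIV "flat_exp m"] continuous_intros)
next
  case (Suc k)
  let ?f' = "\<lambda>t. - real m * flat_exp (m + 1) t + flat_exp (m + 2) t"
  have d: "((\<lambda>x. flat_exp m (c * x $ i + d)) has_derivative (\<lambda>v. (c * v $ i) * ?f' (c * x $ i + d))) (at x)" for x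
  proof -
    have "((\<lambda>x. c * x $ i + d) has_derivative (\<lambda>v. c * v $ i)) (at x)"
      by (auto intro!: derivative_eq_intros bounded_linear.has_derivative[OF bounded_linear_vec_nth])
    from has_derivative_compose[OF this DERIV_flat_exp[of m "c * x $ i + d", unfolded has_field_derivative_def]]
    show ?thesis by (simp add: mult.commute)
  qed
  have fd: "frechet_derivative (\<lambda>x. flat_exp m (c * x $ i + d)) (at x) v = (c * v $ i) * ?f' (c * x $ i + d)" for x v
    using frechet_derivative_at[OF d] by metis
  have "Ck k (\<lambda>x. ?f' (c * x $ i + d))" by (intro Ck_add Ck_mult Ck_const Suc)
  then have "Ck k (\<lambda>x. (c * v $ i) * ?f' (c * x $ i + d))" for v by (intro Ck_mult Ck_const)
  then show ?case using d by (auto simp: fd differentiable_def)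
qed

text \<open>
  Steepening the profile instead of normalising it: the bumps stay between \<open>0\<close> and \<open>1\<close>, vanish outside the box
  and converge to its indicator pointwise.
\<close>

definition bump :: "('n::finite \<Rightarrow> rat) \<Rightarrow> ('n \<Rightarrow> rat) \<Rightarrow> nat \<Rightarrow> real^'n \<Rightarrow> real" where
  "bump a b n x = (\<Prod>i\<in>UNIV. flat_exp 0 (real (Suc n) * (x $ i - of_rat (a i))) * flat_exp 0 (real (Suc n) * (of_rat (b i) - x $ i)))"

lemma Ck_bump: "Ck k (bump a b n)"
proof -
  have "bump a b n = (\<lambda>x. \<Prod>i\<in>UNIV. flat_exp 0 (real (Suc n) * x $ i + (- real (Suc n) * of_rat (a i))) * flat_exp 0 ((- real (Suc n)) * x $ i + real (Suc n) * of_rat (b i)))"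
    unfolding bump_def by (intro ext prod.cong arg_cong2[where f = "(*)"] arg_cong[where f = "flat_exp 0"]) (auto simp: algebra_simps)
  then show ?thesis by (simp only:) (intro Ck_prod Ck_mult Ck_flat_exp finite)
qed

lemma bump_bounds: "0 \<le> bump a b n x" "bump a b n x \<le> 1"
  unfolding bump_def by (auto intro!: prod_nonneg prod_le_1 mult_le_one mult_nonneg_nonneg flat_exp_bounds)

lemma bump_outside: "x \<notin> rat_box a b \<Longrightarrow> bump a b n x = 0"
proof -
  assume "x \<notin> rat_box a b"
  then obtain i where "\<not> (of_rat (a i) < x $ i \<and> x $ i < of_rat (b i))"
    unfolding mem_rat_box by blast
  then have "x $ i - of_rat (a i) \<le> 0 \<or> of_rat (b i) - x $ i \<le> 0" by auto
  then have "flat_exp 0 (real (Suc n) * (x $ i - of_rat (a i))) * flat_exp 0 (real (Suc n) * (of_rat (b i) - x $ i)) = 0"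
    by (force simp: flat_exp_def not_less zero_less_mult_iff)
  then show ?thesis unfolding bump_def by (intro prod_zero) auto
qed

lemma bump_tendsto:
  fixes x :: "real^'n"
  shows "(\<lambda>n. bump a b n x) \<longlonglongrightarrow> indicator (rat_box a b) x"
proof (cases "x \<in> rat_box a b")
  case True
  have *: "(\<lambda>n. flat_exp 0 (real (Suc n) * t)) \<longlonglongrightarrow> 1" if t: "t > 0" for t
  proof -
    have "(\<lambda>n. inverse (real (Suc n)) * (1 / t)) \<longlonglongrightarrow> 0 * (1 / t)"
      by (intro tendsto_intros LIMSEQ_inverse_real_of_nat)
    then have "(\<lambda>n. exp (- (inverse (real (Suc n)) * (1 / t)))) \<longlonglongrightarrow> exp (- 0)" by (intro tendsto_intros) simp
    then show ?thesis using t by (simp add: flat_exp_def field_simps zero_less_mult_iff add_pos_nonneg)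
  qed
  have "(\<lambda>n. bump a b n x) \<longlonglongrightarrow> (\<Prod>i\<in>(UNIV::'n set). 1 * 1)"
    unfolding bump_def
  proof (rule tendsto_prod)
    fix i
    have "x $ i - of_rat (a i) > 0" "of_rat (b i) - x $ i > 0" using True by (auto simp: mem_rat_box)
    from tendsto_mult[OF *[OF this(1)] *[OF this(2)]]
    show "(\<lambda>n. flat_exp 0 (real (Suc n) * (x $ i - of_rat (a i))) * flat_exp 0 (real (Suc n) * (of_rat (b i) - x $ i))) \<longlonglongrightarrow> 1 * 1" .
  qed
  then show ?thesis using True by simp
qed (simp add: bump_outside)

lemma bump_test_function:
  assumes "closure (rat_box a b) \<subseteq> S"
  shows "bump a b n \<in> test_functions S"
proof -
  have sub: "closure {x. bump a b n x \<noteq> 0} \<subseteq> closure (rat_box a b)"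
    by (rule closure_mono) (use bump_outside in blast)
  moreover have "compact (closure (rat_box a b))" by (simp add: rat_box_def compact_closure)
  ultimately have "compact (closure {x. bump a b n x \<noteq> 0})"
    using compact_Int_closed[OF _ closed_closure] by (metis inf.absorb2)
  with sub assms show ?thesis by (auto simp: test_functions_def Ck_bump)
qed

section \<open>The fundamental lemma of the calculus of variations\<close>

text \<open>
  The sets over which the integral of \<open>f\<close> vanishes form a Dynkin system that contains the generator of the
  Borel sets.
\<close>

lemma AE_zero_if_box_integrals_zero:
  fixes f :: "real^'n \<Rightarrow> real"
  assumes f: "integrable lborel f" and z: "\<And>a b. (\<integral>x. indicator (rat_box a b) x * f x \<partial>lborel) = 0"
  shows "AE x in lborel. f x = 0"
proof (rule sigma_finite_measure.density_zero[OF sigma_finite_lborel f])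
  have tot: "(\<integral>x. f x \<partial>lborel) = 0"
  proof -
    define C :: "nat \<Rightarrow> (real^'n) set" where "C n = rat_box (\<lambda>i. - of_nat n) (\<lambda>i. of_nat n)" for n
    have "(\<lambda>n. \<integral>x. indicator (C n) x * f x \<partial>lborel) \<longlonglongrightarrow> (\<integral>x. f x \<partial>lborel)"
    proof (rule integral_dominated_convergence[where w = "\<lambda>x. \<bar>f x\<bar>"])
      show "AE x in lborel. (\<lambda>n. indicator (C n) x * f x) \<longlonglongrightarrow> f x"
      proof (rule AE_I2)
        fix x :: "real^'n"
        have "eventually (\<lambda>n. indicator (C n) x * f x = f x) sequentially"
          using eventually_in_rat_cube[of x] unfolding C_def by eventually_elim simp
        then show "(\<lambda>n. indicator (C n) x * f x) \<longlonglongrightarrow> f x" by (rule tendsto_eventually)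
      qed
    qed (use f in \<open>auto simp: C_def indicator_def\<close>)
    then show ?thesis using z by (simp add: C_def LIMSEQ_const_iff)
  qed
  fix A :: "(real^'n) set" assume A: "A \<in> sets lborel"
  have G: "A \<in> sigma_sets UNIV (range (\<lambda>(a, b). rat_box a b))"
    using A by (simp, subst (asm) borel_eq_rat_box) simp
  have stable: "Int_stable (range (\<lambda>(a, b). rat_box a b :: (real^'n) set))"
    by (auto simp: Int_stable_def rat_box_Int)
  have si: "set_integrable lborel B f" if "B \<in> sets borel" for B
    unfolding set_integrable_def using f that by (intro integrable_mult_indicator) auto
  show "set_lebesgue_integral lborel A f = 0" using stable subset_Pow_Union[THEN order_trans, OF Pow_mono[OF subset_UNIV]] G
  proof (induction rule: sigma_sets_induct_disjoint)
    case (basic A) then show ?case using z by (auto simp: set_lebesgue_integral_def)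
  next
    case empty then show ?case by (simp add: set_lebesgue_integral_def)
  next
    case (compl A)
    have m: "A \<in> sets borel" using compl(1) by (subst borel_eq_rat_box) simp
    have "(LINT x:A \<union> (UNIV - A)|lborel. f x) = (LINT x:A|lborel. f x) + (LINT x:UNIV - A|lborel. f x)"
      by (rule set_integral_Un) (use m in \<open>auto intro!: si\<close>)
    then show ?case using compl tot by (simp add: set_lebesgue_integral_def)
  next
    case (union A)
    have m: "A i \<in> sets borel" for i using union(2) by (subst borel_eq_rat_box) auto
    have "(LINT x:(\<Union>i. A i)|lborel. f x) = (\<Sum>i. (LINT x:(A i)|lborel. f x))"
      by (rule lebesgue_integral_countable_add) (use m union in \<open>auto intro!: si simp: disjoint_family_on_def\<close>)
    then show ?case using union by simp
  qed
qed

lemma lebesgue_on_eq_indicator: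
  fixes f :: "'a::euclidean_space \<Rightarrow> 'b::{banach, second_countable_topology}"
  assumes "K \<in> sets lebesgue"
  shows "integrable (lebesgue_on K) f \<longleftrightarrow> integrable lebesgue (\<lambda>x. indicator K x *\<^sub>R f x)"
    "integral\<^sup>L (lebesgue_on K) f = (\<integral>x. indicator K x *\<^sub>R f x \<partial>lebesgue)"
  using assms by (auto simp: integrable_restrict_space integral_restrict_space)

text \<open>
  For a Borel function \<open>U\<close> the map \<open>(s, x) \<mapsto> U (x + s d)\<close> is measurable on the product space, as Fubini's
  theorem requires. Lebesgue measurable functions on a part of the space are therefore replaced by Borel functions on the
  whole space.
\<close>

lemma borel_version:
  fixes u :: "'a::euclidean_space \<Rightarrow> real"
  assumes E: "E \<in> sets lebesgue" and u: "integrable (lebesgue_on E) u"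
  obtains U where "integrable lborel U" "AE x in lebesgue. U x = indicator E x * u x"
proof -
  have iv: "integrable lebesgue (\<lambda>x. indicator E x * u x)"
    using u lebesgue_on_eq_indicator(1)[OF E, of u] by simp
  then obtain U where U [measurable]: "U \<in> borel_measurable lborel" and ae: "AE x in lborel. indicator E x * u x = U x"
    using completion_ex_borel_measurable_real[of "\<lambda>x. indicator E x * u x" lborel] by blast
  have Um: "U \<in> borel_measurable lebesgue" using U by (rule measurable_completion)
  have ae': "AE x in lebesgue. indicator E x * u x = U x" using ae by (rule AE_completion)
  have "integrable lebesgue U" using iv integrable_cong_AE[OF _ Um ae'] by auto
  then have "integrable lborel U" using integrable_completion[OF U] by simp
  moreover have "AE x in lebesgue. U x = indicator E x * u x" using ae' by eventually_elim simp
  ultimately show ?thesis by (rule that)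
qed

text \<open>
  Bumps turn the hypothesis into vanishing integrals over all rational boxes with closure in \<open>S\<close>. Locally this
  forces \<open>w = 0\<close> almost everywhere, and countably many of these boxes cover \<open>S\<close>.
\<close>

lemma fundamental_lemma:
  fixes w :: "real^'n \<Rightarrow> real"
  assumes S: "open S" and w: "\<And>K. compact K \<Longrightarrow> K \<subseteq> S \<Longrightarrow> integrable (lebesgue_on K) w"
    and z: "\<And>\<phi>. \<phi> \<in> test_functions S \<Longrightarrow> (\<integral>x. w x * \<phi> x \<partial>lebesgue_on S) = 0"
  shows "AE x in lebesgue_on S. w x = 0"
proof -
  have Sm [measurable]: "S \<in> sets lebesgue" using S by auto
  have box0: "(\<integral>x. indicator (rat_box a b) x * w x \<partial>lebesgue) = 0" if ab: "closure (rat_box a b) \<subseteq> S" for a b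
  proof -
    define K where "K = closure (rat_box a b)"
    have K: "compact K" "K \<subseteq> S" using ab by (simp_all add: K_def rat_box_def compact_closure)
    have Km: "K \<in> sets lebesgue" using K by (simp add: compact_imp_closed)
    have BK: "rat_box a b \<subseteq> K" by (simp add: K_def closure_subset)
    have iK: "integrable lebesgue (\<lambda>x. indicator K x * w x)" using w[OF K] lebesgue_on_eq_indicator(1)[OF Km, of w] by simp
    have eq: "bump a b n x * (indicator K x * w x) = indicator S x * (w x * bump a b n x)" for n x
      using bump_outside[of x a b n] BK K by (cases "x \<in> rat_box a b") (auto simp: indicator_def)
    have [measurable]: "bump a b n \<in> borel_measurable borel" for n
      using Ck_bump[of 0 a b n] by (intro borel_measurable_continuous_onI) simp
    have "(\<lambda>n. \<integral>x. bump a b n x * (indicator K x * w x) \<partial>lebesgue) \<longlonglongrightarrow> (\<integral>x. indicator (rat_box a b) x * (indicator K x * w x) \<partial>lebesgue)"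
    proof (rule integral_dominated_convergence[where w = "\<lambda>x. \<bar>indicator K x * w x\<bar>"])
      show "AE x in lebesgue. (\<lambda>n. bump a b n x * (indicator K x * w x)) \<longlonglongrightarrow> indicator (rat_box a b) x * (indicator K x * w x)"
        by (intro AE_I2 tendsto_intros bump_tendsto)
      show "AE x in lebesgue. norm (bump a b n x * (indicator K x * w x)) \<le> \<bar>indicator K x * w x\<bar>" for n
        by (intro AE_I2) (auto simp: abs_mult bump_bounds intro!: mult_left_le_one_le)
      show "(\<lambda>x. bump a b n x * (indicator K x * w x)) \<in> borel_measurable lebesgue" for n
        by (rule borel_measurable_times[OF measurable_completion borel_measurable_integrable[OF iK]]) simp
      show "(\<lambda>x. indicator (rat_box a b) x * (indicator K x * w x)) \<in> borel_measurable lebesgue"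
        by (rule borel_measurable_times[OF measurable_completion borel_measurable_integrable[OF iK]]) simp
    qed (use iK in auto)
    moreover have "(\<integral>x. bump a b n x * (indicator K x * w x) \<partial>lebesgue) = 0" for n
      unfolding eq using z[OF bump_test_function[OF ab]] lebesgue_on_eq_indicator(2)[OF Sm, of "\<lambda>x. w x * bump a b n x"] by simp
    ultimately have "(\<integral>x. indicator (rat_box a b) x * (indicator K x * w x) \<partial>lebesgue) = 0"
      by (simp add: LIMSEQ_const_iff)
    moreover have "indicator (rat_box a b) x * (indicator K x * w x) = indicator (rat_box a b) x * w x" for x
      using BK by (auto simp: indicator_def)
    ultimately show ?thesis by simp
  qed
  have loc: "AE x in lebesgue. x \<in> rat_box a b \<longrightarrow> w x = 0" if ab: "closure (rat_box a b) \<subseteq> S" for a b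
  proof -
    let ?v = "\<lambda>x. indicator (rat_box a b) x * w x"
    have Bm: "rat_box a b \<in> sets lebesgue" by simp
    define K where "K = closure (rat_box a b)"
    have K: "compact K" "K \<subseteq> S" using ab by (simp_all add: K_def rat_box_def compact_closure)
    have Km: "K \<in> sets lebesgue" using K by (simp add: compact_imp_closed)
    have BK: "rat_box a b \<subseteq> K" by (simp add: K_def closure_subset)
    have iK: "integrable lebesgue (\<lambda>x. indicator K x * w x)" using w[OF K] lebesgue_on_eq_indicator(1)[OF Km, of w] by simp
    have "integrable lebesgue (\<lambda>x. indicator (rat_box a b) x *\<^sub>R (indicator K x * w x))"
      by (rule integrable_mult_indicator[OF Bm iK])
    moreover have "indicator (rat_box a b) x * (indicator K x * w x) = ?v x" for x
      using BK by (auto simp: indicator_def)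
    ultimately have iv: "integrable lebesgue ?v" by simp
    then have "integrable (lebesgue_on (rat_box a b)) w"
      using lebesgue_on_eq_indicator(1)[OF Bm, of w] by simp
    from borel_version[OF Bm this] obtain v' where iv': "integrable lborel v'" and ae: "AE x in lebesgue. v' x = ?v x" .
    have v' [measurable]: "v' \<in> borel_measurable borel" using iv' by auto
    have "AE x in lborel. v' x = 0"
    proof (rule AE_zero_if_box_integrals_zero[OF iv'])
      fix c d
      have "(\<integral>x. indicator (rat_box c d) x * v' x \<partial>lborel) = (\<integral>x. indicator (rat_box c d) x * v' x \<partial>lebesgue)"
        by (rule integral_completion[symmetric]) simp
      also have "\<dots> = (\<integral>x. indicator (rat_box c d) x * ?v x \<partial>lebesgue)"
      proof (rule integral_cong_AE)
        show "(\<lambda>x. indicator (rat_box c d) x * v' x) \<in> borel_measurable lebesgue"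
          by (rule measurable_completion) simp
        show "(\<lambda>x. indicator (rat_box c d) x * ?v x) \<in> borel_measurable lebesgue"
          by (rule borel_measurable_times[OF measurable_completion borel_measurable_integrable[OF iv]]) simp
        show "AE x in lebesgue. indicator (rat_box c d) x * v' x = indicator (rat_box c d) x * ?v x"
          using ae by eventually_elim simp
      qed
      also have "\<dots> = (\<integral>x. indicator (rat_box (\<lambda>i. max (c i) (a i)) (\<lambda>i. min (d i) (b i))) x * w x \<partial>lebesgue)"
        by (rule Bochner_Integration.integral_cong) (auto simp: rat_box_Int[symmetric] indicator_def)
      also have "\<dots> = 0"
      proof (rule box0)
        have "closure (rat_box c d \<inter> rat_box a b) \<subseteq> closure (rat_box a b)" by (rule closure_mono) auto
        then show "closure (rat_box (\<lambda>i. max (c i) (a i)) (\<lambda>i. min (d i) (b i))) \<subseteq> S"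
          using ab by (simp add: rat_box_Int)
      qed
      finally show "(\<integral>x. indicator (rat_box c d) x * v' x \<partial>lborel) = 0" .
    qed
    then have "AE x in lebesgue. v' x = 0" by (rule AE_completion)
    with ae show ?thesis by eventually_elim (auto simp: indicator_def split: if_splits)
  qed
  have "AE x in lebesgue. \<forall>(a, b)\<in>{(a, b). closure (rat_box a b) \<subseteq> S}. x \<in> rat_box a b \<longrightarrow> w x = 0"
    by (rule AE_ball_countable[THEN iffD2]) (use loc in auto)
  then have "AE x in lebesgue. x \<in> S \<longrightarrow> w x = 0"
  proof eventually_elim
    case (elim x)
    show ?case
    proof
      assume "x \<in> S"
      then obtain a b where "x \<in> rat_box a b" "closure (rat_box a b) \<subseteq> S"
        by (rule rat_box_neighbourhood[OF S])
      with elim show "w x = 0" by auto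
    qed
  qed
  then show ?thesis using Sm by (subst AE_restrict_space_iff) auto
qed

section \<open>Test functions under translation\<close>

abbreviation pd :: "(real^'n \<Rightarrow> real) \<Rightarrow> 'n \<Rightarrow> real^'n \<Rightarrow> real" where
  "pd \<phi> i x \<equiv> frechet_derivative \<phi> (at x) (axis i 1)"

lemma Ck_translate: "Ck k \<phi> \<Longrightarrow> Ck k (\<lambda>x. \<phi> (x - d))"
proof (induction k arbitrary: \<phi>)
  case 0 then show ?case
    by (auto intro!: continuous_on_compose2[of UNIV \<phi>] continuous_intros)
next
  case (Suc k)
  have D: "((\<lambda>x. \<phi> (x - d)) has_derivative frechet_derivative \<phi> (at (x - d))) (at x)" for x
  proof -
    have "(\<phi> has_derivative frechet_derivative \<phi> (at (x - d))) (at (x - d))"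
      using Suc.prems by (auto simp: frechet_derivative_works[symmetric])
    moreover have "((\<lambda>x. x - d) has_derivative (\<lambda>v. v)) (at x)" by (auto intro!: derivative_eq_intros)
    ultimately show ?thesis using has_derivative_compose by fastforce
  qed
  have "frechet_derivative (\<lambda>x. \<phi> (x - d)) (at x) = frechet_derivative \<phi> (at (x - d))" for x
    using frechet_derivative_at[OF D] by metis
  moreover have "Ck k (\<lambda>x. pd \<phi> i (x - d))" for i using Suc.IH[of "pd \<phi> i"] Suc.prems by simp
  ultimately show ?case using D by (auto simp: differentiable_def)
qed

lemma pd_translate:
  assumes "Ck (Suc 0) \<phi>" shows "pd (\<lambda>x. \<phi> (x - d)) i x = pd \<phi> i (x - d)"
proof -
  have "(\<phi> has_derivative frechet_derivative \<phi> (at (x - d))) (at (x - d))"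
    using assms by (auto simp: frechet_derivative_works[symmetric])
  moreover have "((\<lambda>x. x - d) has_derivative (\<lambda>v. v)) (at x)" by (auto intro!: derivative_eq_intros)
  ultimately have "((\<lambda>x. \<phi> (x - d)) has_derivative frechet_derivative \<phi> (at (x - d))) (at x)"
    using has_derivative_compose by fastforce
  then show ?thesis using frechet_derivative_at by metis
qed

lemma test_function_props:
  assumes \<phi>: "\<phi> \<in> test_functions S"
  obtains K where "compact K" "K \<subseteq> S" "\<And>x. x \<notin> K \<Longrightarrow> \<phi> x = 0" "\<And>i x. x \<notin> K \<Longrightarrow> pd \<phi> i x = 0"
proof
  let ?K = "closure {x. \<phi> x \<noteq> 0}"
  show "compact ?K" "?K \<subseteq> S" using \<phi> by (auto simp: test_functions_def)
  show z: "\<phi> x = 0" if "x \<notin> ?K" for x using that closure_subset[of "{x. \<phi> x \<noteq> 0}"] by blast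
  show "pd \<phi> i x = 0" if "x \<notin> ?K" for i x
  proof -
    have "((\<lambda>x. 0) has_derivative (\<lambda>v. 0)) (at x)" by simp
    then have "(\<phi> has_derivative (\<lambda>v. 0)) (at x)"
    proof (rule has_derivative_transform_within_open[where s = "- ?K"])
      show "open (- ?K)" by (rule open_Compl[OF closed_closure])
      show "x \<in> - ?K" using that by (simp only: Compl_iff not_False_eq_True simp_thms)
      show "0 = \<phi> y" if "y \<in> - ?K" for y using that by (simp only: Compl_iff z simp_thms)
    qed
    then show ?thesis using frechet_derivative_at by metis
  qed
qed

lemma test_function_cont:
  assumes "\<phi> \<in> test_functions S"
  shows "continuous_on UNIV \<phi>" "continuous_on UNIV (pd \<phi> i)" "\<phi> differentiable (at x)"
    "\<phi> \<in> borel_measurable borel" "pd \<phi> i \<in> borel_measurable borel"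
proof -
  have "Ck 0 \<phi>" "Ck (Suc 0) \<phi>" using assms by (auto simp: test_functions_def)
  then show c: "continuous_on UNIV \<phi>" "continuous_on UNIV (pd \<phi> i)" "\<phi> differentiable (at x)" by auto
  show "\<phi> \<in> borel_measurable borel" "pd \<phi> i \<in> borel_measurable borel"
    using c by (auto intro: borel_measurable_continuous_onI)
qed

lemma bounded_if_compact_support:
  fixes f :: "'a::topological_space \<Rightarrow> real"
  assumes "continuous_on UNIV f" "compact K" "\<And>x. x \<notin> K \<Longrightarrow> f x = 0"
  obtains C where "C > 0" "\<And>x. \<bar>f x\<bar> \<le> C"
proof -
  have "bounded (f ` K)" using assms by (intro compact_imp_bounded compact_continuous_image continuous_on_subset[OF assms(1)]) auto
  then obtain C where C: "C > 0" "\<And>x. x \<in> K \<Longrightarrow> \<bar>f x\<bar> \<le> C" unfolding bounded_pos by auto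
  show ?thesis by (rule that[OF C(1)]) (metis C assms(3) abs_zero less_imp_le)
qed

lemma test_function_bound:
  assumes "\<phi> \<in> test_functions S"
  obtains C where "C > 0" "\<And>x. \<bar>\<phi> x\<bar> \<le> C" "\<And>x. \<bar>pd \<phi> i x\<bar> \<le> C"
proof -
  obtain K where K: "compact K" "\<And>x. x \<notin> K \<Longrightarrow> \<phi> x = 0" "\<And>i x. x \<notin> K \<Longrightarrow> pd \<phi> i x = 0"
    using test_function_props[OF assms] by metis
  obtain C where C: "C > 0" "\<And>x. \<bar>\<phi> x\<bar> \<le> C"
    using bounded_if_compact_support[OF test_function_cont(1)[OF assms] K(1,2)] by metis
  obtain D where D: "D > 0" "\<And>x. \<bar>pd \<phi> i x\<bar> \<le> D"
    using bounded_if_compact_support[OF test_function_cont(2)[OF assms] K(1) K(3)[of _ i]] by metis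
  show ?thesis by (rule that[of "max C D"]) (use C D in \<open>auto simp: le_max_iff_disj\<close>)
qed

lemma test_functions_mono: "S \<subseteq> V \<Longrightarrow> \<phi> \<in> test_functions S \<Longrightarrow> \<phi> \<in> test_functions V"
  by (auto simp: test_functions_def)

lemma test_function_translate:
  assumes \<psi>: "\<psi> \<in> test_functions N" and d: "\<And>x. x \<in> N \<Longrightarrow> x + d \<in> V"
  shows "(\<lambda>x. \<psi> (x - d)) \<in> test_functions V"
proof -
  let ?K = "closure {x. \<psi> x \<noteq> 0}"
  have "{x. \<psi> (x - d) \<noteq> 0} = (\<lambda>x. d + x) ` {x. \<psi> x \<noteq> 0}"
    by (auto simp: image_iff intro!: exI[of _ "_ - d"])
  then have "closure {x. \<psi> (x - d) \<noteq> 0} = (\<lambda>x. d + x) ` ?K" by (simp add: closure_translation)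
  moreover have "compact ((\<lambda>x. d + x) ` ?K)" using \<psi> by (intro compact_translation) (auto simp: test_functions_def)
  moreover have "(\<lambda>x. d + x) ` ?K \<subseteq> V" using \<psi> d by (auto simp: test_functions_def add.commute)
  ultimately have "compact (closure {x. \<psi> (x - d) \<noteq> 0})" "closure {x. \<psi> (x - d) \<noteq> 0} \<subseteq> V"
    by (simp_all only:)
  then show ?thesis using \<psi> Ck_translate unfolding test_functions_def by blast
qed

text \<open>
  The fundamental theorem of calculus along the segment from \<open>x\<close> to \<open>x - k e\<close>, parametrised by \<open>[0, 1]\<close>
  so as to treat both signs of \<open>k\<close> alike.
\<close>

lemma test_function_FTC:
  assumes \<psi>: "\<psi> \<in> test_functions N"
  shows "(\<integral>s. indicator {0..1} s * (k * pd \<psi> i (x - s *\<^sub>R (k *\<^sub>R axis i 1))) \<partial>lborel) = \<psi> x - \<psi> (x - k *\<^sub>R axis i 1)"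
proof -
  let ?e = "axis i 1 :: real^'a"
  let ?F = "\<lambda>s. - \<psi> (x - s *\<^sub>R (k *\<^sub>R ?e))" and ?f = "\<lambda>s. k * pd \<psi> i (x - s *\<^sub>R (k *\<^sub>R ?e))"
  have "(?F has_vector_derivative ?f s) (at s within {0..1})" for s
  proof -
    let ?D = "frechet_derivative \<psi> (at (x - s *\<^sub>R (k *\<^sub>R ?e)))"
    have D: "(\<psi> has_derivative ?D) (at (x - s *\<^sub>R (k *\<^sub>R ?e)))"
      using test_function_cont(3)[OF \<psi>] by (simp add: frechet_derivative_works[symmetric])
    have "((\<lambda>s. x - s *\<^sub>R (k *\<^sub>R ?e)) has_derivative (\<lambda>h. - (h *\<^sub>R (k *\<^sub>R ?e)))) (at s within {0..1})"
      by (auto intro!: derivative_eq_intros)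
    from has_derivative_compose[OF this D]
    have "((\<lambda>s. \<psi> (x - s *\<^sub>R (k *\<^sub>R ?e))) has_derivative (\<lambda>h. ?D (- (h *\<^sub>R (k *\<^sub>R ?e))))) (at s within {0..1})" .
    moreover have "?D (- (h *\<^sub>R (k *\<^sub>R ?e))) = - (h * (k * ?D ?e))" for h
      using has_derivative_linear[OF D] by (simp add: linear_neg linear_scale)
    ultimately have "((\<lambda>s. - \<psi> (x - s *\<^sub>R (k *\<^sub>R ?e))) has_derivative (\<lambda>h. - (- (h * (k * ?D ?e))))) (at s within {0..1})"
      by (intro has_derivative_minus) simp
    then show ?thesis by (simp add: has_vector_derivative_def)
  qed
  moreover have "continuous_on {0..1} ?f"
    by (intro continuous_intros continuous_on_compose2[OF test_function_cont(2)[OF \<psi>]]) auto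
  ultimately have "(\<integral>s. indicator {0..1} s *\<^sub>R ?f s \<partial>lborel) = ?F 1 - ?F 0"
    by (intro integral_FTC_Icc[of 0 1 ?F ?f]) auto
  then show ?thesis by simp
qed

section \<open>Difference quotients of weakly differentiable functions\<close>

lemma integrable_segment_integrand:
  fixes G :: "real^'n \<Rightarrow> real"
  assumes G: "integrable lborel G"
  shows "integrable (lborel \<Otimes>\<^sub>M lborel) (\<lambda>(s, x). indicator {0..1::real} s * G (x + s *\<^sub>R d))"
proof (rule lborel_pair.Fubini_integrable)
  have [measurable]: "G \<in> borel_measurable borel" using G by auto
  show "(\<lambda>(s, x). indicator {0..1::real} s * G (x + s *\<^sub>R d)) \<in> borel_measurable (lborel \<Otimes>\<^sub>M lborel)"
    by (simp add: split_beta)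
  have "(\<integral>x. norm (indicator {0..1} s * G (x + s *\<^sub>R d)) \<partial>lborel) = indicator {0..1::real} s * (\<integral>x. \<bar>G x\<bar> \<partial>lborel)" for s
    using integral_translate[of "\<lambda>x. \<bar>G x\<bar>" "s *\<^sub>R d"] by (simp add: abs_mult)
  then show "integrable lborel (\<lambda>s. \<integral>x. norm (case (s, x) of (s, x) \<Rightarrow> indicator {0..1::real} s * G (x + s *\<^sub>R d)) \<partial>lborel)"
    by (auto intro!: integrable_mult_left integrable_real_indicator)
  show "AE s in lborel. integrable lborel (\<lambda>x. case (s, x) of (s, x) \<Rightarrow> indicator {0..1::real} s * G (x + s *\<^sub>R d))"
    using integrable_translate[OF G] by auto
qed

definition segment_average :: "(real^'n \<Rightarrow> real) \<Rightarrow> real^'n \<Rightarrow> real^'n \<Rightarrow> real" where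
  "segment_average G d x = (\<integral>s. indicator {0..1::real} s * G (x + s *\<^sub>R d) \<partial>lborel)"

lemma integrable_segment_average:
  assumes "integrable lborel G" shows "integrable lborel (segment_average G d)"
  using lborel_pair.integrable_snd[OF integrable_segment_integrand[OF assms, of d]]
  unfolding segment_average_def by simp

text \<open>
  By Fubini's theorem the distance of \<open>G\<close> to its segment average is at most the average of
  \<open>\<omega> (s d)\<close> over \<open>s\<close> in \<open>[0, 1]\<close>, where \<open>\<omega> h\<close> is the distance of \<open>G\<close> to its translate by \<open>h\<close>.
\<close>

lemma segment_average_tendsto_L1:
  fixes G :: "real^'n \<Rightarrow> real"
  assumes G: "integrable lborel G" and d: "d \<longlonglongrightarrow> 0"
  shows "(\<lambda>n. \<integral>x. \<bar>segment_average G (d n) x - G x\<bar> \<partial>lborel) \<longlonglongrightarrow> 0"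
proof -
  have [measurable]: "G \<in> borel_measurable borel" using G by auto
  define \<omega> where "\<omega> h = (\<integral>x. \<bar>G (x + h) - G x\<bar> \<partial>lborel)" for h
  note [intro!] = integrable_arith integrable_translate[OF G] G
  have \<omega>_le: "\<omega> h \<le> 2 * (\<integral>x. \<bar>G x\<bar> \<partial>lborel)" for h
  proof -
    have "\<omega> h \<le> (\<integral>x. \<bar>G (x + h)\<bar> + \<bar>G x\<bar> \<partial>lborel)" unfolding \<omega>_def by (rule integral_mono) auto
    also have "\<dots> = (\<integral>x. \<bar>G (x + h)\<bar> \<partial>lborel) + (\<integral>x. \<bar>G x\<bar> \<partial>lborel)" 
      by (rule Bochner_Integration.integral_add) auto
    finally show ?thesis using integral_translate[of "\<lambda>x. \<bar>G x\<bar>" h] by simp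
  qed
  have \<omega>_nonneg: "0 \<le> \<omega> h" for h unfolding \<omega>_def by simp
  have \<omega>_m: "(\<lambda>s. \<omega> (s *\<^sub>R h)) \<in> borel_measurable lborel" for h
    unfolding \<omega>_def by measurable
  have le: "(\<integral>x. \<bar>segment_average G h x - G x\<bar> \<partial>lborel) \<le> (\<integral>s. indicator {0..1::real} s * \<omega> (s *\<^sub>R h) \<partial>lborel)" for h
  proof -
    let ?f = "\<lambda>s x. indicator {0..1::real} s * G (x + s *\<^sub>R h)" and ?g = "\<lambda>s x. indicator {0..1::real} s * G (x + s *\<^sub>R 0)"
    let ?h = "\<lambda>s x. \<bar>?f s x - ?g s x\<bar>"
    have i: "integrable (lborel \<Otimes>\<^sub>M lborel) (\<lambda>(s, x). ?f s x)" "integrable (lborel \<Otimes>\<^sub>M lborel) (\<lambda>(s, x). ?g s x)"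
      using integrable_segment_integrand[OF G] by blast+
    then have ih: "integrable (lborel \<Otimes>\<^sub>M lborel) (\<lambda>(s, x). ?h s x)"
      using integrable_abs[OF Bochner_Integration.integrable_diff[OF i]] by (simp add: case_prod_beta')
    have ae: "AE x in lborel. integrable lborel (\<lambda>s. ?f s x)" "AE x in lborel. integrable lborel (\<lambda>s. ?g s x)"
      using lborel_pair.AE_integrable_snd[OF i(1)] lborel_pair.AE_integrable_snd[OF i(2)] by auto
    have "(\<integral>x. \<bar>segment_average G h x - G x\<bar> \<partial>lborel) \<le> (\<integral>x. (\<integral>s. ?h s x \<partial>lborel) \<partial>lborel)"
    proof (rule integral_mono_AE)
      show "integrable lborel (\<lambda>x. \<bar>segment_average G h x - G x\<bar>)"
        using integrable_segment_average[OF G] by auto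
      show "integrable lborel (\<lambda>x. \<integral>s. ?h s x \<partial>lborel)" using lborel_pair.integrable_snd[OF ih] by simp
      show "AE x in lborel. \<bar>segment_average G h x - G x\<bar> \<le> (\<integral>s. ?h s x \<partial>lborel)"
        using ae
      proof eventually_elim
        case (elim x)
        have "segment_average G h x - G x = (\<integral>s. ?f s x \<partial>lborel) - (\<integral>s. ?g s x \<partial>lborel)"
          by (simp add: segment_average_def)
        also have "\<dots> = (\<integral>s. ?f s x - ?g s x \<partial>lborel)" by (rule Bochner_Integration.integral_diff[OF elim, symmetric])
        finally show ?case using integral_abs_bound[of lborel "\<lambda>s. ?f s x - ?g s x"] by simp
      qed
    qed
    also have "\<dots> = (\<integral>s. (\<integral>x. ?h s x \<partial>lborel) \<partial>lborel)"
      by (rule lborel_pair.Fubini_integral[OF ih])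
    also have "\<dots> = (\<integral>s. indicator {0..1::real} s * \<omega> (s *\<^sub>R h) \<partial>lborel)"
    proof (rule Bochner_Integration.integral_cong[OF refl])
      fix s
      have "?h s x = indicator {0..1} s * \<bar>G (x + s *\<^sub>R h) - G x\<bar>" for x by (auto simp: indicator_def)
      then show "(\<integral>x. ?h s x \<partial>lborel) = indicator {0..1::real} s * \<omega> (s *\<^sub>R h)" by (simp add: \<omega>_def)
    qed
    finally show ?thesis .
  qed
  have lim: "(\<lambda>n. \<integral>s. indicator {0..1::real} s * \<omega> (s *\<^sub>R d n) \<partial>lborel) \<longlonglongrightarrow> (\<integral>s. 0 \<partial>(lborel :: real measure))"
  proof (rule integral_dominated_convergence[where w = "\<lambda>s. indicator {0..1::real} s * (2 * (\<integral>x. \<bar>G x\<bar> \<partial>lborel))"])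
    show "(\<lambda>s. indicator {0..1::real} s * \<omega> (s *\<^sub>R d n)) \<in> borel_measurable lborel" for n
      using \<omega>_m[of "d n"] by measurable
    show "integrable lborel (\<lambda>s. indicator {0..1::real} s * (2 * (\<integral>x. \<bar>G x\<bar> \<partial>lborel)))"
      by (auto intro!: integrable_mult_left integrable_real_indicator)
    show "AE s in lborel. norm (indicator {0..1::real} s * \<omega> (s *\<^sub>R d n)) \<le> indicator {0..1::real} s * (2 * (\<integral>x. \<bar>G x\<bar> \<partial>lborel))" for n
      using \<omega>_le \<omega>_nonneg by (intro AE_I2) (auto simp: indicator_def)
    show "AE s in lborel. (\<lambda>n. indicator {0..1::real} s * \<omega> (s *\<^sub>R d n)) \<longlonglongrightarrow> 0"
    proof (rule AE_I2)
      fix s :: real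
      have "(\<lambda>n. s *\<^sub>R d n) \<longlonglongrightarrow> 0" using tendsto_scaleR[OF tendsto_const d, of s] by simp
      from translation_continuous_L1[OF G this] have "(\<lambda>n. \<omega> (s *\<^sub>R d n)) \<longlonglongrightarrow> 0" by (simp add: \<omega>_def)
      from tendsto_mult[OF tendsto_const this] show "(\<lambda>n. indicator {0..1::real} s * \<omega> (s *\<^sub>R d n)) \<longlonglongrightarrow> 0" by simp
    qed
  qed simp
  show ?thesis
    by (rule tendsto_sandwich[OF _ _ tendsto_const]) (use le lim in \<open>auto intro!: always_eventually\<close>)
qed


text \<open>
  Both sides are tested against \<open>\<psi>\<close>. Fubini's theorem and translation invariance move the segment average of \<open>G\<close>
  onto \<open>\<psi>\<close>; weak differentiability exchanges \<open>G\<close> for \<open>U\<close> and \<open>\<psi>\<close> for its derivative, and the fundamental theorem of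
  calculus evaluates the integral along the segment. The fundamental lemma then removes \<open>\<psi>\<close>. The translated test
  functions must have support in \<open>V\<close>, whence the condition that segments starting in \<open>N\<close> stay in \<open>V\<close>.
\<close>

lemma weak_increment:
  fixes U G :: "real^'n \<Rightarrow> real"
  assumes U: "integrable lborel U" and G: "integrable lborel G"
    and weak: "\<And>\<psi>. \<psi> \<in> test_functions V \<Longrightarrow> (\<integral>x. U x * pd \<psi> i x \<partial>lborel) = - (\<integral>x. G x * \<psi> x \<partial>lborel)"
    and N: "open N" and NV: "\<And>x s. x \<in> N \<Longrightarrow> 0 \<le> s \<Longrightarrow> s \<le> 1 \<Longrightarrow> x + s *\<^sub>R (k *\<^sub>R axis i 1) \<in> V"
  shows "AE x in lborel. x \<in> N \<longrightarrow> U (x + k *\<^sub>R axis i 1) - U x = k * segment_average G (k *\<^sub>R axis i 1) x"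
proof -
  define d :: "real^'n" where "d = k *\<^sub>R axis i 1"
  have [measurable]: "U \<in> borel_measurable borel" "G \<in> borel_measurable borel" using U G by auto
  define w where "w x = (U (x + d) - U x) - k * segment_average G d x" for x
  have iA: "integrable lborel (segment_average G d)" by (rule integrable_segment_average[OF G])
  have iw: "integrable lborel w" unfolding w_def
    by (intro integrable_arith integrable_translate U iA impI)
  have test: "(\<integral>x. w x * \<psi> x \<partial>lborel) = 0" if \<psi>: "\<psi> \<in> test_functions N" for \<psi>
  proof -
    obtain C where C: "C > 0" "\<And>x. \<bar>\<psi> x\<bar> \<le> C" "\<And>x. \<bar>pd \<psi> i x\<bar> \<le> C" using test_function_bound[OF \<psi>] by metis
    have [measurable]: "\<psi> \<in> borel_measurable borel" "pd \<psi> i \<in> borel_measurable borel"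
      using test_function_cont[OF \<psi>] by auto
    have bdd: "integrable lborel (\<lambda>x. f x * \<psi> x)" if "integrable lborel f" for f :: "real^'n \<Rightarrow> real"
      by (rule integrable_mult_bounded[OF that _ C(2)]) measurable
    have bdd': "integrable lborel (\<lambda>x. f x * \<psi> (x - d))" if "integrable lborel f" for f :: "real^'n \<Rightarrow> real"
      by (rule integrable_mult_bounded[OF that _ C(2)]) measurable
    let ?I = "indicator {0..1::real} :: real \<Rightarrow> real"
    have iG: "integrable (lborel \<Otimes>\<^sub>M lborel) (\<lambda>(s, x). ?I s * G (x + s *\<^sub>R d) * \<psi> x)"
    proof (rule Bochner_Integration.integrable_bound[OF integrable_mult_right[OF integrable_abs[OF integrable_segment_integrand[OF G, of d]], of C]])
      show "(\<lambda>(s, x). ?I s * G (x + s *\<^sub>R d) * \<psi> x) \<in> borel_measurable (lborel \<Otimes>\<^sub>M lborel)"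
        by (simp add: split_beta)
    qed (use C in \<open>auto intro!: AE_I2 simp: abs_mult mult.commute[of C] intro!: mult_left_mono\<close>)
    have iU: "integrable (lborel \<Otimes>\<^sub>M lborel) (\<lambda>(s, x). ?I s * U x * pd \<psi> i (x - s *\<^sub>R d))"
    proof (rule Bochner_Integration.integrable_bound[OF integrable_mult_right[OF integrable_abs[OF integrable_segment_integrand[OF U, of 0]], of C]])
      show "(\<lambda>(s, x). ?I s * U x * pd \<psi> i (x - s *\<^sub>R d)) \<in> borel_measurable (lborel \<Otimes>\<^sub>M lborel)"
        by (simp add: split_beta)
    qed (use C in \<open>auto intro!: AE_I2 simp: abs_mult mult.commute[of C] intro!: mult_left_mono\<close>)
    have "(\<integral>x. segment_average G d x * \<psi> x \<partial>lborel) = (\<integral>x. (\<integral>s. ?I s * G (x + s *\<^sub>R d) * \<psi> x \<partial>lborel) \<partial>lborel)"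
      unfolding segment_average_def by simp
    also have "\<dots> = (\<integral>s. (\<integral>x. ?I s * G (x + s *\<^sub>R d) * \<psi> x \<partial>lborel) \<partial>lborel)"
      by (rule lborel_pair.Fubini_integral[OF iG])
    also have "\<dots> = (\<integral>s. - (\<integral>x. ?I s * U x * pd \<psi> i (x - s *\<^sub>R d) \<partial>lborel) \<partial>lborel)"
    proof (rule Bochner_Integration.integral_cong[OF refl])
      fix s :: real
      show "(\<integral>x. ?I s * G (x + s *\<^sub>R d) * \<psi> x \<partial>lborel) = - (\<integral>x. ?I s * U x * pd \<psi> i (x - s *\<^sub>R d) \<partial>lborel)"
      proof (cases "s \<in> {0..1}")
        case True
        have t: "(\<lambda>x. \<psi> (x - s *\<^sub>R d)) \<in> test_functions V"
          by (rule test_function_translate[OF \<psi>]) (use True NV in \<open>auto simp: d_def\<close>)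
        have "(\<integral>x. G (x + s *\<^sub>R d) * \<psi> x \<partial>lborel) = (\<integral>x. G x * \<psi> (x - s *\<^sub>R d) \<partial>lborel)"
          using integral_translate[of "\<lambda>x. G x * \<psi> (x - s *\<^sub>R d)" "s *\<^sub>R d"] by simp
        also have "\<dots> = - (\<integral>x. U x * pd (\<lambda>x. \<psi> (x - s *\<^sub>R d)) i x \<partial>lborel)"
          using weak[OF t] by simp
        also have "(\<lambda>x. pd (\<lambda>x. \<psi> (x - s *\<^sub>R d)) i x) = (\<lambda>x. pd \<psi> i (x - s *\<^sub>R d))"
          by (rule ext, rule pd_translate) (use \<psi> in \<open>simp add: test_functions_def del: Ck.simps\<close>)
        finally show ?thesis using True by simp
      qed simp
    qed
    also have "\<dots> = - (\<integral>s. (\<integral>x. ?I s * U x * pd \<psi> i (x - s *\<^sub>R d) \<partial>lborel) \<partial>lborel)" by simp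
    also have "\<dots> = - (\<integral>x. (\<integral>s. ?I s * U x * pd \<psi> i (x - s *\<^sub>R d) \<partial>lborel) \<partial>lborel)"
      using lborel_pair.Fubini_integral[OF iU] by simp
    finally have "k * (\<integral>x. segment_average G d x * \<psi> x \<partial>lborel) = - (\<integral>x. k * (\<integral>s. ?I s * U x * pd \<psi> i (x - s *\<^sub>R d) \<partial>lborel) \<partial>lborel)"
      by simp
    also have "\<dots> = - (\<integral>x. U x * (\<psi> x - \<psi> (x - d)) \<partial>lborel)"
    proof -
      have "k * (\<integral>s. ?I s * U x * pd \<psi> i (x - s *\<^sub>R d) \<partial>lborel) = U x * (\<psi> x - \<psi> (x - d))" for x
      proof -
        have "k * (\<integral>s. ?I s * U x * pd \<psi> i (x - s *\<^sub>R d) \<partial>lborel) = (\<integral>s. U x * (?I s * (k * pd \<psi> i (x - s *\<^sub>R d))) \<partial>lborel)"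
          unfolding integral_mult_right_zero[symmetric]
          by (rule Bochner_Integration.integral_cong[OF refl]) (simp only: mult_ac)
        also have "\<dots> = U x * (\<psi> x - \<psi> (x - d))"
          using test_function_FTC[OF \<psi>, where k = k and i = i and x = x] by (simp add: d_def)
        finally show ?thesis .
      qed
      then show ?thesis by simp
    qed
    also have "\<dots> = (\<integral>x. U (x + d) * \<psi> x \<partial>lborel) - (\<integral>x. U x * \<psi> x \<partial>lborel)"
    proof -
      have "(\<integral>x. U x * (\<psi> x - \<psi> (x - d)) \<partial>lborel) = (\<integral>x. U x * \<psi> x \<partial>lborel) - (\<integral>x. U x * \<psi> (x - d) \<partial>lborel)"
        using bdd[OF U] bdd'[OF U] by (simp add: right_diff_distrib)
      then show ?thesis using integral_translate[of "\<lambda>x. U x * \<psi> (x - d)" d] by simp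
    qed
    finally have *: "k * (\<integral>x. segment_average G d x * \<psi> x \<partial>lborel) = (\<integral>x. U (x + d) * \<psi> x \<partial>lborel) - (\<integral>x. U x * \<psi> x \<partial>lborel)" .
    have "(\<integral>x. w x * \<psi> x \<partial>lborel) = (\<integral>x. U (x + d) * \<psi> x - U x * \<psi> x - k * (segment_average G d x * \<psi> x) \<partial>lborel)"
      by (rule Bochner_Integration.integral_cong) (auto simp: w_def algebra_simps)
    also have "\<dots> = (\<integral>x. U (x + d) * \<psi> x \<partial>lborel) - (\<integral>x. U x * \<psi> x \<partial>lborel) - k * (\<integral>x. segment_average G d x * \<psi> x \<partial>lborel)"
      using bdd[OF integrable_translate[OF U, of d]] bdd[OF U] bdd[OF iA] by simp
    finally show ?thesis using * by simp
  qed
  have wm: "w \<in> borel_measurable lborel" using iw by auto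
  have iw': "integrable lebesgue w" using iw integrable_completion[OF wm] by simp
  have "AE x in lebesgue_on N. w x = 0"
  proof (rule fundamental_lemma[OF N])
    show "integrable (lebesgue_on K) w" if "compact K" for K
    proof -
      have Km: "K \<in> sets lebesgue" using that by (simp add: compact_imp_closed)
      show ?thesis unfolding lebesgue_on_eq_indicator[OF Km] by (rule integrable_mult_indicator[OF Km iw'])
    qed
    fix \<psi> assume \<psi>: "\<psi> \<in> test_functions N"
    obtain K where K: "K \<subseteq> N" "\<And>x. x \<notin> K \<Longrightarrow> \<psi> x = 0" using test_function_props[OF \<psi>] by metis
    have Nm: "N \<in> sets lebesgue" using N by auto
    have "(\<lambda>x. indicator N x *\<^sub>R (w x * \<psi> x)) = (\<lambda>x. w x * \<psi> x)"
      using K by (intro ext) (auto simp: indicator_def)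
    then have "(\<integral>x. w x * \<psi> x \<partial>lebesgue_on N) = (\<integral>x. w x * \<psi> x \<partial>lebesgue)"
      unfolding lebesgue_on_eq_indicator[OF Nm] by (simp only:)
    also have "\<dots> = (\<integral>x. w x * \<psi> x \<partial>lborel)"
      by (rule integral_completion) (use wm test_function_cont(4)[OF \<psi>] in measurable)
    finally show "(\<integral>x. w x * \<psi> x \<partial>lebesgue_on N) = 0" using test[OF \<psi>] by simp
  qed
  then have "AE x in lebesgue. x \<in> N \<longrightarrow> w x = 0" using N by (subst (asm) AE_restrict_space_iff) auto
  then have "AE x in lborel. x \<in> N \<longrightarrow> w x = 0" by (simp add: AE_completion_iff)
  then show ?thesis by eventually_elim (auto simp: w_def d_def)
qed

section \<open>The chain rule\<close>

text \<open>
  The difference quotient of \<open>T\<close>, completed on the diagonal by the derivative. The completion makes the identity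
  \<open>slope T T' a b * (b - a) = T b - T a\<close> and the bound by \<open>sup \<bar>T'\<bar>\<close> hold without exception.
\<close>

definition slope :: "(real \<Rightarrow> real) \<Rightarrow> (real \<Rightarrow> real) \<Rightarrow> real \<Rightarrow> real \<Rightarrow> real" where
  "slope T T' a b = (if a = b then T' a else (T b - T a) / (b - a))"

lemma slope_mult: "slope T T' a b * (b - a) = T b - T a"
  by (simp add: slope_def)

lemma slope_bound:
  assumes D: "\<And>x. (T has_real_derivative T' x) (at x)" and L: "\<And>x. \<bar>T' x\<bar> \<le> L"
  shows "\<bar>slope T T' a b\<bar> \<le> L"
proof -
  have *: "\<bar>(T b - T a) / (b - a)\<bar> \<le> L" if ab: "a < b" for a b
  proof -
    obtain z where "T b - T a = (b - a) * T' z" using MVT2[OF ab D] by blast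
    then have "(T b - T a) / (b - a) = T' z" using ab by simp
    then show ?thesis using L by simp
  qed
  consider "a = b" | "a < b" | "b < a" by linarith
  then show ?thesis
  proof cases
    case 3
    have "(T b - T a) / (b - a) = (T a - T b) / (a - b)" using 3 by (simp add: field_simps)
    then show ?thesis using *[OF 3] 3 by (simp add: slope_def)
  qed (use * L in \<open>auto simp: slope_def\<close>)
qed

lemma slope_tendsto:
  assumes D: "(T has_real_derivative T' a) (at a)" and b: "b \<longlonglongrightarrow> a"
  shows "(\<lambda>n. slope T T' a (b n)) \<longlonglongrightarrow> T' a"
proof -
  have "((\<lambda>y. (T y - T a) / (y - a)) \<longlongrightarrow> T' a) (at a)"
    using D by (simp add: has_field_derivative_iff)
  moreover have "\<forall>\<^sub>F y in at a. (T y - T a) / (y - a) = slope T T' a y"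
    by (auto simp: eventually_at_filter slope_def)
  ultimately have "(slope T T' a \<longlongrightarrow> T' a) (at a)" by (rule Lim_transform_eventually)
  then have "isCont (slope T T' a) a" by (simp add: isCont_def slope_def)
  from isCont_tendsto_compose[OF this b] show ?thesis by (simp add: slope_def)
qed

lemma integrable_bounded_support:
  fixes h :: "real^'n \<Rightarrow> real"
  assumes "h \<in> borel_measurable borel" "\<And>x. \<bar>h x\<bar> \<le> c * indicator (cball 0 R) x"
  shows "integrable lborel h"
proof (rule Bochner_Integration.integrable_bound)
  have "emeasure lborel (cball (0 :: real^'n) R) < \<infinity>" by (rule emeasure_bounded_finite) simp
  then show "integrable lborel (\<lambda>x :: real^'n. c * indicator (cball 0 R) x)"
    by (intro integrable_mult_right integrable_real_indicator) auto
  show "AE x in lborel. norm (h x) \<le> norm (c * indicator (cball 0 R) x)"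
    using assms(2) by (intro AE_I2) (metis abs_ge_self order_trans real_norm_def)
qed (use assms in simp)

lemma DERIV_test_function_line:
  assumes \<phi>: "\<phi> \<in> test_functions V"
  shows "((\<lambda>s. \<phi> (x - s *\<^sub>R axis i 1)) has_real_derivative - pd \<phi> i (x - s *\<^sub>R axis i 1)) (at s)"
proof -
  let ?D = "frechet_derivative \<phi> (at (x - s *\<^sub>R axis i 1))"
  have D: "(\<phi> has_derivative ?D) (at (x - s *\<^sub>R axis i 1))"
    using test_function_cont(3)[OF \<phi>] by (simp add: frechet_derivative_works[symmetric])
  have "((\<lambda>s. x - s *\<^sub>R axis i 1) has_derivative (\<lambda>h. - (h *\<^sub>R axis i 1))) (at s)"
    by (auto intro!: derivative_eq_intros)
  from has_derivative_compose[OF this D]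
  have "((\<lambda>s. \<phi> (x - s *\<^sub>R axis i 1)) has_derivative (\<lambda>h. ?D (- (h *\<^sub>R axis i 1)))) (at s)" .
  moreover have "?D (- (h *\<^sub>R axis i 1)) = - ?D (axis i 1) * h" for h
    using has_derivative_linear[OF D] by (simp add: linear_neg linear_scale)
  ultimately have "((\<lambda>s. \<phi> (x - s *\<^sub>R axis i 1)) has_derivative (\<lambda>h. - pd \<phi> i (x - s *\<^sub>R axis i 1) * h)) (at s)"
    by (simp only:)
  then show ?thesis by (rule has_derivative_imp_has_field_derivative) simp
qed

lemma test_function_quotient_bound:
  assumes \<phi>: "\<phi> \<in> test_functions V" and k: "k > 0" and C: "\<And>x. \<bar>pd \<phi> i x\<bar> \<le> C"
  shows "\<bar>(\<phi> (x - k *\<^sub>R axis i 1) - \<phi> x) / k\<bar> \<le> C"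
proof -
  obtain z where "\<phi> (x - k *\<^sub>R axis i 1) - \<phi> (x - 0 *\<^sub>R axis i 1) = (k - 0) * - pd \<phi> i (x - z *\<^sub>R axis i 1)"
    using MVT2[OF k, of "\<lambda>s. \<phi> (x - s *\<^sub>R axis i 1)" "\<lambda>s. - pd \<phi> i (x - s *\<^sub>R axis i 1)"]
      DERIV_test_function_line[OF \<phi>] by blast
  then have "(\<phi> (x - k *\<^sub>R axis i 1) - \<phi> x) / k = - pd \<phi> i (x - z *\<^sub>R axis i 1)" using k by simp
  then show ?thesis using C by simp
qed

lemma test_function_quotient_tendsto:
  assumes \<phi>: "\<phi> \<in> test_functions V" and k: "k \<longlonglongrightarrow> 0" "\<And>n. k n > 0"
  shows "(\<lambda>n. (\<phi> (x - k n *\<^sub>R axis i 1) - \<phi> x) / k n) \<longlonglongrightarrow> - pd \<phi> i x"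
proof -
  have "((\<lambda>h. (\<phi> (x - h *\<^sub>R axis i 1) - \<phi> x) / h) \<longlongrightarrow> - pd \<phi> i x) (at 0)"
    using DERIV_test_function_line[OF \<phi>, of x i 0] by (simp add: DERIV_def)
  moreover have "filterlim k (at 0) sequentially"
    using k by (intro filterlim_atI) (auto intro!: always_eventually simp: less_imp_neq[symmetric])
  ultimately show ?thesis by (rule filterlim_compose)
qed

text \<open>
  The integral \<open>X n\<close> of \<open>T U\<close> against a difference quotient of \<open>\<phi>\<close> is computed in two ways. It tends to the
  integral against \<open>- \<partial>\<phi>\<close>. After a translation the difference quotient falls on \<open>T U\<close>, where it is the slope of \<open>T\<close>
  times the difference quotient of \<open>U\<close>; the second factor is a segment average of \<open>G\<close> and converges in \<open>L\<^sup>1\<close>, while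
  the slopes are bounded and converge almost everywhere.
\<close>

lemma chain_rule_tested:
  fixes U G :: "real^'n \<Rightarrow> real"
  assumes U: "integrable lborel U" and G: "integrable lborel G" and V: "open V"
    and weak: "\<And>\<psi>. \<psi> \<in> test_functions V \<Longrightarrow> (\<integral>x. U x * pd \<psi> i x \<partial>lborel) = - (\<integral>x. G x * \<psi> x \<partial>lborel)"
    and T: "\<And>x. (T has_real_derivative T' x) (at x)" "continuous_on UNIV T'"
    and B: "\<And>x. \<bar>T x\<bar> \<le> B" and L: "\<And>x. \<bar>T' x\<bar> \<le> L"
    and \<phi>: "\<phi> \<in> test_functions V"
  shows "(\<integral>x. T (U x) * pd \<phi> i x \<partial>lborel) = - (\<integral>x. T' (U x) * G x * \<phi> x \<partial>lborel)"
proof -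
  have [measurable]: "U \<in> borel_measurable borel" "G \<in> borel_measurable borel" using U G by auto
  have "continuous_on UNIV T" using T(1) DERIV_isCont by (blast intro: continuous_at_imp_continuous_on)
  then have Tm [measurable]: "T \<in> borel_measurable borel" by (rule borel_measurable_continuous_onI)
  have T'm [measurable]: "T' \<in> borel_measurable borel" using T(2) by (rule borel_measurable_continuous_onI)
  have [measurable]: "\<phi> \<in> borel_measurable borel" "pd \<phi> i \<in> borel_measurable borel"
    using test_function_cont[OF \<phi>] by auto
  obtain K where K: "compact K" "K \<subseteq> V" and K0: "\<And>x. x \<notin> K \<Longrightarrow> \<phi> x = 0"
    using test_function_props[OF \<phi>] by metis
  obtain C where C: "C > 0" "\<And>x. \<bar>\<phi> x\<bar> \<le> C" "\<And>x. \<bar>pd \<phi> i x\<bar> \<le> C" using test_function_bound[OF \<phi>] by metis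
  have B0: "B \<ge> 0" "L \<ge> 0" using B[of 0] L[of 0] by auto
  obtain e where e: "e > 0" "(\<Union>x\<in>K. ball x e) \<subseteq> V" using compact_subset_open_imp_ball_epsilon_subset[OF K(1) V K(2)] .
  obtain R where R: "\<And>x. x \<in> K \<Longrightarrow> norm x \<le> R" using compact_imp_bounded[OF K(1)] unfolding bounded_iff by auto
  define N where "N = (\<Union>x\<in>K. ball x (e/2))"
  have N: "open N" "K \<subseteq> N" using e by (auto simp: N_def)
  let ?a = "axis i 1 :: real^'n"
  \<comment> \<open>Below \<open>e/2\<close>, so that segments starting in \<open>N\<close> stay in \<open>V\<close>, and at most \<open>1\<close>, so that the translated
    test functions live in the ball of radius \<open>R + 1\<close>.\<close>
  define \<kappa> where "\<kappa> n = min (e/3) 1 * inverse (real (Suc n))" for n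
  have \<kappa>: "\<kappa> n > 0" "\<kappa> n \<le> 1" "\<kappa> n < e / 2" for n
  proof -
    have i: "0 < inverse (real (Suc n))" "inverse (real (Suc n)) \<le> 1" by (auto simp: field_simps)
    have m: "min (e/3) 1 > 0" using e by auto
    show "\<kappa> n > 0" using i m by (simp add: \<kappa>_def)
    have "\<kappa> n \<le> min (e/3) 1 * 1" unfolding \<kappa>_def using i m by (intro mult_left_mono) auto
    then show "\<kappa> n \<le> 1" "\<kappa> n < e / 2" using e by auto
  qed
  have \<kappa>0: "\<kappa> \<longlonglongrightarrow> 0"
    using tendsto_mult[OF tendsto_const LIMSEQ_inverse_real_of_nat, of "min (e/3) 1"] by (simp add: \<kappa>_def[abs_def])
  have "(\<lambda>n. \<kappa> n *\<^sub>R ?a) \<longlonglongrightarrow> 0" using tendsto_scaleR[OF \<kappa>0 tendsto_const, of ?a] by simp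
  from translation_continuous_L1[OF U this]
  have "(\<lambda>n. \<integral>x. norm (U (x + \<kappa> n *\<^sub>R ?a) - U x) \<partial>lborel) \<longlonglongrightarrow> 0" by simp
  \<comment> \<open>A subsequence of steps along which the translates of \<open>U\<close> converge almost everywhere, as the slopes require.\<close>
  then obtain r where r: "strict_mono r" and ae1: "AE x in lborel. (\<lambda>n. U (x + \<kappa> (r n) *\<^sub>R ?a) - U x) \<longlonglongrightarrow> 0"
    using tendsto_L1_AE_subseq[of lborel "\<lambda>n x. U (x + \<kappa> n *\<^sub>R ?a) - U x"] integrable_translate[OF U] U by auto
  define k where "k n = \<kappa> (r n)" for n
  define d where "d n = k n *\<^sub>R ?a" for n
  have k: "k n > 0" "k n \<le> 1" "k n < e / 2" for n using \<kappa> by (auto simp: k_def)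
  have k0: "k \<longlonglongrightarrow> 0" using LIMSEQ_subseq_LIMSEQ[OF \<kappa>0 r] by (simp add: k_def[abs_def] comp_def)
  have d0: "d \<longlonglongrightarrow> 0" using tendsto_scaleR[OF k0 tendsto_const, of ?a] by (simp add: d_def[abs_def])
  have nd: "norm (d n) \<le> 1" for n using k[of n] by (simp add: d_def)
  define A where "A n = segment_average G (d n)" for n
  have iA: "integrable lborel (A n)" for n unfolding A_def by (rule integrable_segment_average[OF G])
  have [measurable]: "A n \<in> borel_measurable borel" for n using iA by auto
  have "AE x in lborel. x \<in> N \<longrightarrow> U (x + d n) - U x = k n * A n x" for n
    unfolding d_def A_def
  proof (rule weak_increment[OF U G weak N(1)])
    fix x and s :: real assume x: "x \<in> N" and s: "0 \<le> s" "s \<le> 1"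
    then obtain y where y: "y \<in> K" "dist y x < e/2" by (auto simp: N_def)
    have "\<bar>s\<bar> * \<bar>k n\<bar> \<le> 1 * \<bar>k n\<bar>" using s by (intro mult_right_mono) auto
    moreover have "dist x (x + s *\<^sub>R (k n *\<^sub>R ?a)) = \<bar>s\<bar> * \<bar>k n\<bar>" by (simp add: dist_norm abs_mult)
    ultimately have "dist x (x + s *\<^sub>R (k n *\<^sub>R ?a)) < e/2" using k[of n] by linarith
    then have "dist y (x + s *\<^sub>R (k n *\<^sub>R ?a)) < e" using y dist_triangle[of y "x + s *\<^sub>R (k n *\<^sub>R ?a)" x] by linarith
    then have "x + s *\<^sub>R (k n *\<^sub>R ?a) \<in> (\<Union>x\<in>K. ball x e)" using y(1) by (auto simp del: scaleR_scaleR)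
    then show "x + s *\<^sub>R (k n *\<^sub>R ?a) \<in> V" using e(2) by (rule rev_subsetD)
  qed
  then have ae2: "AE x in lborel. \<forall>n. x \<in> N \<longrightarrow> U (x + d n) - U x = k n * A n x"
    by (subst AE_all_countable) blast
  define X where "X n = (\<integral>x. T (U x) * ((\<phi> (x - d n) - \<phi> x) / k n) \<partial>lborel)" for n

  \<comment> \<open>The first evaluation: the difference quotients of \<open>\<phi>\<close> converge boundedly.\<close>
  have "X \<longlonglongrightarrow> (\<integral>x. T (U x) * (- pd \<phi> i x) \<partial>lborel)"
    unfolding X_def
  proof (rule integral_dominated_convergence[where w = "\<lambda>x. B * C * indicator (cball 0 (R + 1)) x"])
    show "integrable lborel (\<lambda>x :: real^'n. B * C * indicator (cball 0 (R + 1)) x)"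
      by (rule integrable_bounded_support[of _ "B * C" "R + 1"], measurable) (use B0 C in auto)
    show "AE x in lborel. (\<lambda>n. T (U x) * ((\<phi> (x - d n) - \<phi> x) / k n)) \<longlonglongrightarrow> T (U x) * (- pd \<phi> i x)"
      unfolding d_def by (intro AE_I2 tendsto_mult tendsto_const test_function_quotient_tendsto[OF \<phi> k0 k(1)])
    show "AE x in lborel. norm (T (U x) * ((\<phi> (x - d n) - \<phi> x) / k n)) \<le> B * C * indicator (cball 0 (R + 1)) x" for n
    proof (rule AE_I2)
      fix x
      show "norm (T (U x) * ((\<phi> (x - d n) - \<phi> x) / k n)) \<le> B * C * indicator (cball 0 (R + 1)) x"
      proof (cases "norm x \<le> R + 1")
        case True
        have "\<bar>T (U x)\<bar> * \<bar>(\<phi> (x - d n) - \<phi> x) / k n\<bar> \<le> B * C"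
          using test_function_quotient_bound[OF \<phi> k(1) C(3)] B B0 C(1) unfolding d_def
          by (intro mult_mono) auto
        then show ?thesis using True by (simp add: abs_mult)
      next
        case False
        have "norm x \<le> norm (x - d n) + norm (d n)" using norm_triangle_ineq[of "x - d n" "d n"] by simp
        then have "x \<notin> K" "x - d n \<notin> K" using R[of x] R[of "x - d n"] nd[of n] False by force+
        then show ?thesis using K0 False by simp
      qed
    qed
  qed measurable
  moreover have "X \<longlonglongrightarrow> (\<integral>x. T' (U x) * G x * \<phi> x \<partial>lborel)"
  proof -
    define Y where "Y = (\<integral>x. T' (U x) * G x * \<phi> x \<partial>lborel)"
    define q where "q n x = slope T T' (U x) (U (x + d n))" for n x
    have q_bd: "\<bar>q n x\<bar> \<le> L" for n x unfolding q_def by (rule slope_bound[OF T(1) L])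
    have qm [measurable]: "q n \<in> borel_measurable borel" for n
      unfolding q_def slope_def by measurable
    have bi: "integrable lborel (\<lambda>x. f x * h x * \<phi> x)"
      if h: "integrable lborel h" and f: "f \<in> borel_measurable borel" "\<And>x. \<bar>f x\<bar> \<le> M" for f h M
    proof -
      have "integrable lborel (\<lambda>x. h x * f x * \<phi> x)"
        by (rule integrable_mult_bounded[OF integrable_mult_bounded[OF h _ f(2)] _ C(2)]) (use f(1) in simp_all)
      then show ?thesis by (simp only: mult.commute[of "h _" "f _"])
    qed
    \<comment> \<open>The second evaluation starts by moving the difference quotient from \<open>\<phi>\<close> to \<open>T U\<close>.\<close>
    have Xq: "X n = (\<integral>x. q n x * A n x * \<phi> x \<partial>lborel)" for n
    proof -
      have i\<phi>: "integrable lborel \<phi>"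
        by (rule integrable_bounded_support[of _ C R]) (use C R K0 in \<open>force simp: indicator_def\<close>)+
      have i1: "integrable lborel (\<lambda>x. T (U x) * \<phi> (x - d n))"
        using integrable_mult_bounded[OF integrable_translate[OF i\<phi>, of "- d n"], of "\<lambda>x. T (U x)" B] B
        by (simp add: mult.commute)
      have i2: "integrable lborel (\<lambda>x. T (U x) * \<phi> x)"
        using integrable_mult_bounded[OF i\<phi>, of "\<lambda>x. T (U x)" B] B by (simp add: mult.commute)
      have i3: "integrable lborel (\<lambda>x. T (U (x + d n)) * \<phi> x)" using integrable_translate[OF i1, of "d n"] by simp
      have "X n = (\<integral>x. (1 / k n) * (T (U x) * \<phi> (x - d n)) - (1 / k n) * (T (U x) * \<phi> x) \<partial>lborel)"
        unfolding X_def by (rule Bochner_Integration.integral_cong) (auto simp: diff_divide_distrib right_diff_distrib)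
      also have "\<dots> = (1 / k n) * (\<integral>x. T (U x) * \<phi> (x - d n) \<partial>lborel) - (1 / k n) * (\<integral>x. T (U x) * \<phi> x \<partial>lborel)"
        using i1 i2 by (simp del: times_divide_eq_left)
      also have "(\<integral>x. T (U x) * \<phi> (x - d n) \<partial>lborel) = (\<integral>x. T (U (x + d n)) * \<phi> x \<partial>lborel)"
        using integral_translate[of "\<lambda>x. T (U x) * \<phi> (x - d n)" "d n"] by simp
      also have "(1 / k n) * \<dots> - (1 / k n) * (\<integral>x. T (U x) * \<phi> x \<partial>lborel)
          = (\<integral>x. (1 / k n) * (T (U (x + d n)) * \<phi> x) - (1 / k n) * (T (U x) * \<phi> x) \<partial>lborel)"
        using i2 i3 by (simp del: times_divide_eq_left)
      also have "\<dots> = (\<integral>x. q n x * A n x * \<phi> x \<partial>lborel)"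
      proof (rule integral_cong_AE)
        show "AE x in lborel. (1 / k n) * (T (U (x + d n)) * \<phi> x) - (1 / k n) * (T (U x) * \<phi> x) = q n x * A n x * \<phi> x"
          using ae2
        proof eventually_elim
          case (elim x)
          show ?case
          proof (cases "x \<in> K")
            case True
            then have "T (U (x + d n)) - T (U x) = q n x * (k n * A n x)"
              using elim N(2) slope_mult[of T T' "U x" "U (x + d n)"] by (auto simp: q_def)
            then have "(1 / k n) * (T (U (x + d n)) - T (U x)) * \<phi> x = (1 / k n) * (q n x * (k n * A n x)) * \<phi> x" by simp
            then show ?thesis using k(1)[of n] by (simp add: algebra_simps)
          qed (simp add: K0)
        qed
      qed measurable
      finally show ?thesis .
    qed
    have iq: "integrable lborel (\<lambda>x. q n x * h x * \<phi> x)" if "integrable lborel h" for n h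
      by (rule bi[OF that qm q_bd])
    have iT: "integrable lborel (\<lambda>x. T' (U x) * G x * \<phi> x)" by (rule bi[OF G _ L]) measurable
    have iAG: "integrable lborel (\<lambda>x. A n x - G x)" for n using iA G by auto
    have split: "X n - Y = (\<integral>x. q n x * (A n x - G x) * \<phi> x \<partial>lborel) + (\<integral>x. (q n x - T' (U x)) * G x * \<phi> x \<partial>lborel)" for n
    proof -
      have "(\<integral>x. q n x * (A n x - G x) * \<phi> x \<partial>lborel) = (\<integral>x. q n x * A n x * \<phi> x - q n x * G x * \<phi> x \<partial>lborel)"
        by (rule Bochner_Integration.integral_cong) (auto simp: algebra_simps)
      also have "\<dots> = X n - (\<integral>x. q n x * G x * \<phi> x \<partial>lborel)" unfolding Xq
        by (rule Bochner_Integration.integral_diff[OF iq[OF iA] iq[OF G]])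
      finally have 1: "(\<integral>x. q n x * (A n x - G x) * \<phi> x \<partial>lborel) = X n - (\<integral>x. q n x * G x * \<phi> x \<partial>lborel)" .
      have "(\<integral>x. (q n x - T' (U x)) * G x * \<phi> x \<partial>lborel) = (\<integral>x. q n x * G x * \<phi> x - T' (U x) * G x * \<phi> x \<partial>lborel)"
        by (rule Bochner_Integration.integral_cong) (auto simp: algebra_simps)
      also have "\<dots> = (\<integral>x. q n x * G x * \<phi> x \<partial>lborel) - Y" unfolding Y_def
        by (rule Bochner_Integration.integral_diff[OF iq[OF G] iT])
      finally show ?thesis using 1 by simp
    qed
    have "(\<lambda>n. \<integral>x. q n x * (A n x - G x) * \<phi> x \<partial>lborel) \<longlonglongrightarrow> 0"
    proof (rule Lim_null_comparison)
      have "\<bar>q n x * \<phi> x\<bar> \<le> L * C" for n x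
        using q_bd C(2) B0 by (simp add: abs_mult mult_mono)
      then have "norm (\<integral>x. (A n x - G x) * (q n x * \<phi> x) \<partial>lborel) \<le> L * C * (\<integral>x. \<bar>A n x - G x\<bar> \<partial>lborel)" for n
        by (intro integral_mult_bounded_le[OF iAG]) measurable
      moreover have "(A n x - G x) * (q n x * \<phi> x) = q n x * (A n x - G x) * \<phi> x" for n x by simp
      ultimately show "\<forall>\<^sub>F n in sequentially. norm (\<integral>x. q n x * (A n x - G x) * \<phi> x \<partial>lborel) \<le> L * C * (\<integral>x. \<bar>A n x - G x\<bar> \<partial>lborel)"
        by (intro always_eventually allI) (simp only:)
      show "(\<lambda>n. L * C * (\<integral>x. \<bar>A n x - G x\<bar> \<partial>lborel)) \<longlonglongrightarrow> 0"
        using tendsto_mult[OF tendsto_const segment_average_tendsto_L1[OF G d0], of "L * C"] by (simp add: A_def)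
    qed
    moreover have "(\<lambda>n. \<integral>x. (q n x - T' (U x)) * G x * \<phi> x \<partial>lborel) \<longlonglongrightarrow> (\<integral>x. 0 \<partial>(lborel :: (real^'n) measure))"
    proof (rule integral_dominated_convergence[where w = "\<lambda>x. 2 * L * C * \<bar>G x\<bar>"])
      show "integrable lborel (\<lambda>x. 2 * L * C * \<bar>G x\<bar>)" by (intro integrable_mult_right integrable_abs G)
      show "AE x in lborel. norm ((q n x - T' (U x)) * G x * \<phi> x) \<le> 2 * L * C * \<bar>G x\<bar>" for n
      proof (rule AE_I2)
        fix x
        have "\<bar>q n x - T' (U x)\<bar> \<le> 2 * L" using q_bd[of n x] L[of "U x"] by linarith
        then have "\<bar>q n x - T' (U x)\<bar> * \<bar>G x\<bar> * \<bar>\<phi> x\<bar> \<le> (2 * L) * \<bar>G x\<bar> * C"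
          using C(2)[of x] B0 by (intro mult_mono) auto
        then show "norm ((q n x - T' (U x)) * G x * \<phi> x) \<le> 2 * L * C * \<bar>G x\<bar>" by (simp add: abs_mult mult_ac)
      qed
      show "AE x in lborel. (\<lambda>n. (q n x - T' (U x)) * G x * \<phi> x) \<longlonglongrightarrow> 0"
        using ae1
      proof eventually_elim
        case (elim x)
        have "(\<lambda>n. U (x + d n)) \<longlonglongrightarrow> U x"
          using tendsto_add[OF elim tendsto_const, of "U x"] by (simp add: d_def k_def)
        from slope_tendsto[of T T' "U x", OF T(1) this] have "(\<lambda>n. q n x - T' (U x)) \<longlonglongrightarrow> T' (U x) - T' (U x)"
          unfolding q_def by (intro tendsto_diff tendsto_const)
        from tendsto_mult[OF tendsto_mult[OF this tendsto_const] tendsto_const] show ?case by simp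
      qed
    qed measurable
    ultimately have "(\<lambda>n. X n - Y) \<longlonglongrightarrow> 0 + 0" unfolding split by (intro tendsto_add) simp_all
    then show ?thesis unfolding Y_def[symmetric] by (simp add: LIM_zero_iff)
  qed
  ultimately have "(\<integral>x. T (U x) * (- pd \<phi> i x) \<partial>lborel) = (\<integral>x. T' (U x) * G x * \<phi> x \<partial>lborel)"
    by (rule LIMSEQ_unique)
  then show ?thesis by simp
qed

lemma compact_sets_lebesgue: "compact K \<Longrightarrow> K \<in> sets (lebesgue :: 'a::euclidean_space measure)"
  by (simp add: compact_imp_closed)

lemma integral_test_transfer:
  fixes F :: "real^'n \<Rightarrow> real"
  assumes Q: "compact Q" "Q \<subseteq> S" and S: "open S" and F: "F \<in> borel_measurable (lebesgue_on Q)"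
    and F0: "F0 \<in> borel_measurable borel" and ae: "AE x in lebesgue. x \<in> Q \<longrightarrow> F0 x = F x"
    and \<xi>: "\<xi> \<in> borel_measurable borel" "\<And>x. x \<notin> Q \<Longrightarrow> \<xi> x = 0"
  shows "(\<integral>x. F x * \<xi> x \<partial>lebesgue_on S) = (\<integral>x. F0 x * \<xi> x \<partial>lborel)"
proof -
  have Qm: "Q \<in> sets lebesgue" and Sm: "S \<in> sets lebesgue" using Q S by (auto simp: compact_sets_lebesgue)
  have FQ: "(\<lambda>x. indicator Q x * F x) \<in> borel_measurable lebesgue"
    using F Qm by (simp add: borel_measurable_restrict_space_iff)
  have \<xi>m: "\<xi> \<in> borel_measurable lebesgue" using \<xi>(1) by (intro measurable_completion) simp
  have "(\<integral>x. F x * \<xi> x \<partial>lebesgue_on S) = (\<integral>x. (indicator Q x * F x) * \<xi> x \<partial>lebesgue)"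
    unfolding lebesgue_on_eq_indicator(2)[OF Sm]
    by (rule Bochner_Integration.integral_cong[OF refl]) (use Q(2) \<xi>(2) in \<open>auto simp: indicator_def\<close>)
  also have "\<dots> = (\<integral>x. F0 x * \<xi> x \<partial>lebesgue)"
  proof (rule integral_cong_AE)
    show "(\<lambda>x. indicator Q x * F x * \<xi> x) \<in> borel_measurable lebesgue" by (rule borel_measurable_times[OF FQ \<xi>m])
    show "(\<lambda>x. F0 x * \<xi> x) \<in> borel_measurable lebesgue" using F0 \<xi>(1) by (intro measurable_completion) simp
    show "AE x in lebesgue. indicator Q x * F x * \<xi> x = F0 x * \<xi> x"
      using ae by eventually_elim (use \<xi>(2) in \<open>auto simp: indicator_def\<close>)
  qed
  also have "\<dots> = (\<integral>x. F0 x * \<xi> x \<partial>lborel)" using F0 \<xi>(1) by (intro integral_completion) simp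
  finally show ?thesis .
qed

section \<open>Weak gradients\<close>

lemma has_weak_gradient_integrable:
  assumes "has_weak_gradient S u G" "compact K" "K \<subseteq> S"
  shows "integrable (lebesgue_on K) u" "integrable (lebesgue_on K) G" "integrable (lebesgue_on K) (\<lambda>x. G x $ i)"
proof -
  show *: "integrable (lebesgue_on K) u" "integrable (lebesgue_on K) G" using assms by (auto simp: has_weak_gradient_def)
  show "integrable (lebesgue_on K) (\<lambda>x. G x $ i)"
    by (rule integrable_bounded_linear[OF bounded_linear_vec_nth *(2)])
qed

lemma integrable_times_compact_support:
  fixes u :: "real^'n \<Rightarrow> real"
  assumes S: "open S" and K: "compact K" "K \<subseteq> S" and u: "integrable (lebesgue_on K) u"
    and \<xi>: "\<xi> \<in> borel_measurable borel" "\<And>x. x \<notin> K \<Longrightarrow> \<xi> x = 0" and C: "\<And>x. \<bar>\<xi> x\<bar> \<le> C"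
  shows "integrable (lebesgue_on S) (\<lambda>x. u x * \<xi> x)"
proof -
  have Km: "K \<in> sets lebesgue" and Sm: "S \<in> sets lebesgue" using K S by (auto simp: compact_sets_lebesgue)
  have i: "integrable lebesgue (\<lambda>x. indicator K x * u x)" using u lebesgue_on_eq_indicator(1)[OF Km, of u] by simp
  have \<xi>m: "\<xi> \<in> borel_measurable lebesgue" using \<xi>(1) by (intro measurable_completion) simp
  have "integrable lebesgue (\<lambda>x. (indicator K x * u x) * \<xi> x)"
    by (rule integrable_mult_bounded[OF i \<xi>m C])
  also have "(\<lambda>x. (indicator K x * u x) * \<xi> x) = (\<lambda>x. indicator S x *\<^sub>R (u x * \<xi> x))"
    by (intro ext) (use K(2) \<xi>(2) in \<open>auto simp: indicator_def\<close>)
  finally show ?thesis unfolding lebesgue_on_eq_indicator(1)[OF Sm] .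
qed

lemma has_weak_gradient_test_integrable:
  assumes S: "open S" and G: "has_weak_gradient S u G" and \<phi>: "\<phi> \<in> test_functions S"
  shows "integrable (lebesgue_on S) (\<lambda>x. u x * pd \<phi> i x)" "integrable (lebesgue_on S) (\<lambda>x. G x $ i * \<phi> x)"
proof -
  obtain K where K: "compact K" "K \<subseteq> S" "\<And>x. x \<notin> K \<Longrightarrow> \<phi> x = 0" "\<And>i x. x \<notin> K \<Longrightarrow> pd \<phi> i x = 0"
    using test_function_props[OF \<phi>] by metis
  obtain C where C: "\<And>x. \<bar>\<phi> x\<bar> \<le> C" "\<And>x. \<bar>pd \<phi> i x\<bar> \<le> C" using test_function_bound[OF \<phi>] by metis
  note u = has_weak_gradient_integrable[OF G K(1,2)]
  show "integrable (lebesgue_on S) (\<lambda>x. u x * pd \<phi> i x)"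
    by (rule integrable_times_compact_support[OF S K(1,2) u(1) test_function_cont(5)[OF \<phi>] K(4) C(2)])
  show "integrable (lebesgue_on S) (\<lambda>x. G x $ i * \<phi> x)"
    by (rule integrable_times_compact_support[OF S K(1,2) u(3) test_function_cont(4)[OF \<phi>] K(3) C(1)])
qed

lemma has_weak_gradient_diff:
  assumes S: "open S" and G: "has_weak_gradient S u G" and H: "has_weak_gradient S v H"
  shows "has_weak_gradient S (\<lambda>x. u x - v x) (\<lambda>x. G x - H x)"
  unfolding has_weak_gradient_def
proof (intro conjI allI impI ballI)
  fix K assume "compact K \<and> K \<subseteq> S"
  then show "integrable (lebesgue_on K) (\<lambda>x. u x - v x)" "integrable (lebesgue_on K) (\<lambda>x. G x - H x)"
    using has_weak_gradient_integrable[OF G] has_weak_gradient_integrable[OF H] by auto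
next
  fix \<phi> i assume \<phi>: "\<phi> \<in> test_functions S"
  note i = has_weak_gradient_test_integrable[OF S G \<phi>] has_weak_gradient_test_integrable[OF S H \<phi>]
  have "(\<integral>x. u x * pd \<phi> i x \<partial>lebesgue_on S) = - (\<integral>x. G x $ i * \<phi> x \<partial>lebesgue_on S)"
    "(\<integral>x. v x * pd \<phi> i x \<partial>lebesgue_on S) = - (\<integral>x. H x $ i * \<phi> x \<partial>lebesgue_on S)"
    using G H \<phi> by (auto simp: has_weak_gradient_def)
  then show "(\<integral>x. (u x - v x) * pd \<phi> i x \<partial>lebesgue_on S) = - (\<integral>x. (G x - H x) $ i * \<phi> x \<partial>lebesgue_on S)"
    using i by (simp add: left_diff_distrib)
qed

lemma weak_gradient_unique:
  assumes S: "open S" and G: "has_weak_gradient S u G" and H: "has_weak_gradient S u H"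
  shows "AE x in lebesgue_on S. G x = H x"
proof -
  have "AE x in lebesgue_on S. (G x - H x) $ i = 0" for i
  proof (rule fundamental_lemma[OF S])
    fix K assume "compact K" "K \<subseteq> S"
    then show "integrable (lebesgue_on K) (\<lambda>x. (G x - H x) $ i)"
      using has_weak_gradient_integrable(3)[OF G] has_weak_gradient_integrable(3)[OF H] by auto
  next
    fix \<phi> assume \<phi>: "\<phi> \<in> test_functions S"
    note i = has_weak_gradient_test_integrable(2)[OF S G \<phi>] has_weak_gradient_test_integrable(2)[OF S H \<phi>]
    have "(\<integral>x. u x * pd \<phi> i x \<partial>lebesgue_on S) = - (\<integral>x. G x $ i * \<phi> x \<partial>lebesgue_on S)"
      "(\<integral>x. u x * pd \<phi> i x \<partial>lebesgue_on S) = - (\<integral>x. H x $ i * \<phi> x \<partial>lebesgue_on S)"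
      using G H \<phi> by (auto simp: has_weak_gradient_def)
    then show "(\<integral>x. (G x - H x) $ i * \<phi> x \<partial>lebesgue_on S) = 0" using i by (simp add: left_diff_distrib)
  qed
  then have "AE x in lebesgue_on S. \<forall>i. (G x - H x) $ i = 0" by (simp add: AE_all_countable)
  then show ?thesis by eventually_elim (simp add: vec_eq_iff)
qed

lemma compact_closed_neighbourhood:
  fixes K S :: "'a::euclidean_space set"
  assumes K: "compact K" "K \<subseteq> S" and S: "open S"
  obtains V Q where "open V" "K \<subseteq> V" "V \<subseteq> Q" "compact Q" "Q \<subseteq> S"
proof -
  obtain e where e: "e > 0" "(\<Union>x\<in>K. ball x e) \<subseteq> S" using compact_subset_open_imp_ball_epsilon_subset[OF K(1) S K(2)] .
  define V where "V = (\<Union>x\<in>K. ball x (e/2))"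
  define Q where "Q = {x + y | x y. x \<in> K \<and> y \<in> cball 0 (e/2)}"
  have "open V" "K \<subseteq> V" using e by (auto simp: V_def)
  moreover have "V \<subseteq> Q"
  proof
    fix z assume "z \<in> V"
    then obtain x where "x \<in> K" "dist x z < e/2" by (auto simp: V_def)
    then show "z \<in> Q" unfolding Q_def by (intro CollectI exI[of _ x] exI[of _ "z - x"]) (auto simp: dist_norm norm_minus_commute)
  qed
  moreover have "compact Q" unfolding Q_def using K(1) by (intro compact_sums compact_cball)
  moreover have "Q \<subseteq> S"
  proof
    fix z assume "z \<in> Q"
    then obtain x y where xy: "x \<in> K" "norm y \<le> e/2" "z = x + y" by (auto simp: Q_def)
    then have "z \<in> ball x e" using e(1) by (simp add: dist_norm)
    then show "z \<in> S" using e(2) xy(1) by blast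
  qed
  ultimately show ?thesis by (rule that)
qed

text \<open>
  The statement is local. Near the support of a test function, \<open>u\<close> and its partial derivative agree with Borel
  functions that are integrable on the whole space, to which \<open>chain_rule_tested\<close> applies.
\<close>

theorem chain_rule:
  fixes u :: "real^'n \<Rightarrow> real"
  assumes S: "open S" and G: "has_weak_gradient S u G"
    and T: "\<And>x. (T has_real_derivative T' x) (at x)" "continuous_on UNIV T'"
    and B: "\<And>x. \<bar>T x\<bar> \<le> B" and L: "\<And>x. \<bar>T' x\<bar> \<le> L"
  shows "has_weak_gradient S (\<lambda>x. T (u x)) (\<lambda>x. T' (u x) *\<^sub>R G x)"
  unfolding has_weak_gradient_def
proof (intro conjI allI impI ballI)
  have "continuous_on UNIV T" using T(1) DERIV_isCont by (blast intro: continuous_at_imp_continuous_on)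
  then have Tm [measurable]: "T \<in> borel_measurable borel" by (rule borel_measurable_continuous_onI)
  have T'm [measurable]: "T' \<in> borel_measurable borel" using T(2) by (rule borel_measurable_continuous_onI)
  {
    fix K assume "compact K \<and> K \<subseteq> S"
    then have K: "compact K" "K \<subseteq> S" by auto
    note i = has_weak_gradient_integrable[OF G K]
    have [measurable]: "u \<in> borel_measurable (lebesgue_on K)" "G \<in> borel_measurable (lebesgue_on K)" using i by auto
    have "emeasure lebesgue K < \<infinity>" using compact_imp_bounded[OF K(1)] emeasure_bounded_finite
      by (simp add: K(1) compact_imp_closed)
    then have fin: "finite_measure (lebesgue_on K)" by (intro finite_measureI) (simp add: emeasure_restrict_space compact_sets_lebesgue K)
    show "integrable (lebesgue_on K) (\<lambda>x. T (u x))"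
      by (rule finite_measure.integrable_const_bound[OF fin, of _ B]) (use B in auto)
    show "integrable (lebesgue_on K) (\<lambda>x. T' (u x) *\<^sub>R G x)"
    proof (rule Bochner_Integration.integrable_bound[OF integrable_mult_right[OF integrable_norm[OF i(2)], of L]])
      have "norm (T' (u x) *\<^sub>R G x) \<le> L * norm (G x)" for x using L[of "u x"] by (simp add: mult_right_mono)
      then show "AE x in lebesgue_on K. norm (T' (u x) *\<^sub>R G x) \<le> norm (L * norm (G x))"
        by (intro AE_I2) (metis abs_ge_self order_trans real_norm_def)
    qed measurable
  }
  fix \<phi> i assume \<phi>: "\<phi> \<in> test_functions S"
  obtain K where K: "compact K" "K \<subseteq> S" and KK: "closure {x. \<phi> x \<noteq> 0} \<subseteq> K"
    using \<phi> unfolding test_functions_def by blast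
  obtain V Q where V: "open V" "K \<subseteq> V" "V \<subseteq> Q" "compact Q" "Q \<subseteq> S"
    using compact_closed_neighbourhood[OF K S] .
  have VS: "V \<subseteq> S" using V by blast
  have \<phi>V: "\<phi> \<in> test_functions V" using \<phi> KK V(2) unfolding test_functions_def by blast
  note i = has_weak_gradient_integrable[OF G V(4,5)]
  have Qm: "Q \<in> sets lebesgue" using V(4) by (rule compact_sets_lebesgue)
  obtain U where U: "integrable lborel U" and UQ: "AE x in lebesgue. U x = indicator Q x * u x"
    using borel_version[OF Qm i(1)] .
  obtain g where g: "integrable lborel g" and gQ: "AE x in lebesgue. g x = indicator Q x * (G x $ i)"
    using borel_version[OF Qm i(3)] .
  have Uu: "AE x in lebesgue. x \<in> Q \<longrightarrow> U x = u x" using UQ by eventually_elim simp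
  have gG: "AE x in lebesgue. x \<in> Q \<longrightarrow> g x = G x $ i" using gQ by eventually_elim simp
  have [measurable]: "U \<in> borel_measurable borel" "g \<in> borel_measurable borel" using U g by auto
  have um [measurable]: "u \<in> borel_measurable (lebesgue_on Q)" "(\<lambda>x. G x $ i) \<in> borel_measurable (lebesgue_on Q)"
    using i by auto
  have zero: "\<psi> x = 0" "pd \<psi> i x = 0" if "\<psi> \<in> test_functions V" "x \<notin> Q" for \<psi> x
    using test_function_props[OF that(1)] that(2) V(3) by (metis subsetD)+
  have "(\<integral>x. T (U x) * pd \<phi> i x \<partial>lborel) = - (\<integral>x. T' (U x) * g x * \<phi> x \<partial>lborel)"
  proof (rule chain_rule_tested[OF U g V(1) _ T B L \<phi>V])
    fix \<psi> assume \<psi>: "\<psi> \<in> test_functions V"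
    have "(\<integral>x. U x * pd \<psi> i x \<partial>lborel) = (\<integral>x. u x * pd \<psi> i x \<partial>lebesgue_on S)"
      by (rule integral_test_transfer[OF V(4,5) S _ _ Uu, symmetric])
        (use zero[OF \<psi>] test_function_cont[OF \<psi>] in auto)
    also have "\<dots> = - (\<integral>x. G x $ i * \<psi> x \<partial>lebesgue_on S)"
      using G test_functions_mono[OF VS \<psi>] by (auto simp: has_weak_gradient_def)
    also have "(\<integral>x. G x $ i * \<psi> x \<partial>lebesgue_on S) = (\<integral>x. g x * \<psi> x \<partial>lborel)"
      by (rule integral_test_transfer[OF V(4,5) S _ _ gG])
        (use zero[OF \<psi>] test_function_cont[OF \<psi>] in auto)
    finally show "(\<integral>x. U x * pd \<psi> i x \<partial>lborel) = - (\<integral>x. g x * \<psi> x \<partial>lborel)" .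
  qed
  also have "(\<integral>x. T (U x) * pd \<phi> i x \<partial>lborel) = (\<integral>x. T (u x) * pd \<phi> i x \<partial>lebesgue_on S)"
  proof (rule integral_test_transfer[OF V(4,5) S, symmetric])
    show "AE x in lebesgue. x \<in> Q \<longrightarrow> T (U x) = T (u x)" using Uu by eventually_elim auto
  qed (use zero[OF \<phi>V] test_function_cont[OF \<phi>V] in auto)
  also have "(\<integral>x. T' (U x) * g x * \<phi> x \<partial>lborel) = (\<integral>x. (T' (u x) * G x $ i) * \<phi> x \<partial>lebesgue_on S)"
  proof (rule integral_test_transfer[OF V(4,5) S, symmetric])
    show "AE x in lebesgue. x \<in> Q \<longrightarrow> T' (U x) * g x = T' (u x) * G x $ i" using Uu gG by eventually_elim auto
  qed (use zero[OF \<phi>V] test_function_cont[OF \<phi>V] in auto)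
  finally show "(\<integral>x. T (u x) * pd \<phi> i x \<partial>lebesgue_on S) = - (\<integral>x. (T' (u x) *\<^sub>R G x) $ i * \<phi> x \<partial>lebesgue_on S)"
    by simp
qed

section \<open>Lebesgue norms\<close>

lemma Lq_norm_less_top:
  assumes "1 \<le> q"
  shows "Lq_norm S (ennreal q) u < \<infinity> \<longleftrightarrow> (\<integral>\<^sup>+x. ennreal (\<bar>u x\<bar> powr q) \<partial>lebesgue_on S) < \<infinity>"
  using assms by (simp add: Lq_norm_def Let_def less_top)

lemma Lq_iff_integrable:
  assumes "1 \<le> q"
  shows "u \<in> Lq S (ennreal q) \<longleftrightarrow> u \<in> borel_measurable (lebesgue_on S) \<and> integrable (lebesgue_on S) (\<lambda>x. \<bar>u x\<bar> powr q)"
  using Lq_norm_less_top[OF assms, of S u] by (auto simp: Lq_def integrable_iff_bounded)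

lemma Lq_norm_1: "Lq_norm S 1 u = (\<integral>\<^sup>+x. ennreal \<bar>u x\<bar> \<partial>lebesgue_on S)"
  by (auto simp: Lq_norm_def Let_def powr_one ennreal_enn2real_if)

lemma Lq_1_iff: "u \<in> Lq S 1 \<longleftrightarrow> integrable (lebesgue_on S) u"
  by (auto simp: Lq_def Lq_norm_1 integrable_iff_bounded)

lemma Lq_inftyI:
  assumes "u \<in> borel_measurable (lebesgue_on S)" "AE x in lebesgue_on S. \<bar>u x\<bar> \<le> B"
  shows "u \<in> Lq S \<infinity>"
proof -
  have "Lq_norm S \<infinity> u \<le> ennreal B"
    unfolding Lq_norm_def using assms by (auto intro!: esssup_I ennreal_leI)
  then show ?thesis using assms by (auto simp: Lq_def intro: le_less_trans)
qed

lemma norm_powr_le_sum: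
  fixes v :: "real^'n"
  assumes "p \<ge> 0"
  shows "norm v powr p \<le> real CARD('n) powr p * (\<Sum>i\<in>UNIV. \<bar>v $ i\<bar> powr p)"
proof -
  obtain j where j: "\<And>i. \<bar>v $ i\<bar> \<le> \<bar>v $ j\<bar>"
  proof -
    have "Max (range (\<lambda>i. \<bar>v $ i\<bar>)) \<in> range (\<lambda>i. \<bar>v $ i\<bar>)" by (intro Max_in) auto
    then obtain j where j: "Max (range (\<lambda>i. \<bar>v $ i\<bar>)) = \<bar>v $ j\<bar>" by (rule imageE)
    have "\<bar>v $ i\<bar> \<le> \<bar>v $ j\<bar>" for i unfolding j[symmetric] by (intro Max_ge) auto
    then show ?thesis by (rule that)
  qed
  have "norm v \<le> (\<Sum>i\<in>UNIV. \<bar>v $ i\<bar>)" by (rule norm_le_l1_cart)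
  also have "\<dots> \<le> real CARD('n) * \<bar>v $ j\<bar>" using sum_bounded_above[of UNIV "\<lambda>i. \<bar>v $ i\<bar>" "\<bar>v $ j\<bar>"] j by simp
  finally have "norm v powr p \<le> (real CARD('n) * \<bar>v $ j\<bar>) powr p" using assms by (intro powr_mono2) auto
  also have "\<dots> = real CARD('n) powr p * \<bar>v $ j\<bar> powr p" by (rule powr_mult)
  also have "\<dots> \<le> real CARD('n) powr p * (\<Sum>i\<in>UNIV. \<bar>v $ i\<bar> powr p)"
    by (intro mult_left_mono member_le_sum) auto
  finally show ?thesis .
qed

lemma borel_measurable_lebesgue_on_AE:
  fixes f g :: "'a::euclidean_space \<Rightarrow> 'b::euclidean_space"
  assumes S: "S \<in> sets lebesgue" and f: "f \<in> borel_measurable (lebesgue_on S)" and ae: "AE x in lebesgue_on S. f x = g x"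
  shows "g \<in> borel_measurable (lebesgue_on S)"
proof -
  have "(\<lambda>x. indicator S x *\<^sub>R f x) \<in> borel_measurable lebesgue" using f S by (simp add: borel_measurable_restrict_space_iff)
  moreover have "AE x in lebesgue. x \<in> S \<longrightarrow> f x = g x" using ae S by (subst (asm) AE_restrict_space_iff) auto
  then have "AE x in lebesgue. indicator S x *\<^sub>R f x = indicator S x *\<^sub>R g x" by eventually_elim (auto simp: indicator_def)
  ultimately have "(\<lambda>x. indicator S x *\<^sub>R g x) \<in> borel_measurable lebesgue" by (rule borel_measurable_AE)
  then show ?thesis using S by (simp add: borel_measurable_restrict_space_iff)
qed

text \<open>
  The gradient selected by \<open>weak_gradient\<close> inherits integrability from the one that witnesses membership in the
  Sobolev space, since both agree almost everywhere.
\<close>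

lemma sobolev_weak_gradient:
  fixes S :: "(real^'n) set"
  assumes S: "open S" and p: "p \<ge> 1" and u: "u \<in> sobolev S p"
  shows "has_weak_gradient S u (weak_gradient S u)"
    and "weak_gradient S u \<in> borel_measurable (lebesgue_on S)"
    and "integrable (lebesgue_on S) (\<lambda>x. norm (weak_gradient S u x) powr p)"
proof -
  have Sm: "S \<in> sets lebesgue" using S by auto
  obtain G where G: "has_weak_gradient S u G" "\<And>i. (\<lambda>x. G x $ i) \<in> Lq S (ennreal p)"
    using u by (auto simp: sobolev_def)
  show W: "has_weak_gradient S u (weak_gradient S u)" unfolding weak_gradient_def by (rule someI_ex[of "has_weak_gradient S u"]) (use G(1) in blast)
  have ae: "AE x in lebesgue_on S. G x = weak_gradient S u x" by (rule weak_gradient_unique[OF S G(1) W])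
  have Gi: "(\<lambda>x. G x $ i) \<in> borel_measurable (lebesgue_on S)" "integrable (lebesgue_on S) (\<lambda>x. \<bar>G x $ i\<bar> powr p)" for i
    using G(2)[of i] Lq_iff_integrable[OF p, of "\<lambda>x. G x $ i" S] by blast+
  have Gm [measurable]: "G \<in> borel_measurable (lebesgue_on S)"
    unfolding borel_measurable_euclidean_space[of G] using Gi(1) by (auto simp: Basis_vec_def inner_axis)
  show Wm [measurable]: "weak_gradient S u \<in> borel_measurable (lebesgue_on S)"
    by (rule borel_measurable_lebesgue_on_AE[OF Sm Gm ae])
  have "integrable (lebesgue_on S) (\<lambda>x. norm (G x) powr p)"
  proof (rule Bochner_Integration.integrable_bound)
    show "integrable (lebesgue_on S) (\<lambda>x. real CARD('n) powr p * (\<Sum>i\<in>UNIV. \<bar>G x $ i\<bar> powr p))"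
      using Gi(2) by (intro integrable_mult_right Bochner_Integration.integrable_sum)
    have "norm (norm (G x) powr p) \<le> norm (real CARD('n) powr p * (\<Sum>i\<in>UNIV. \<bar>G x $ i\<bar> powr p))" for x
      using norm_powr_le_sum[of p "G x"] p by (simp add: sum_nonneg)
    then show "AE x in lebesgue_on S. norm (norm (G x) powr p) \<le> norm (real CARD('n) powr p * (\<Sum>i\<in>UNIV. \<bar>G x $ i\<bar> powr p))"
      by simp
  qed measurable
  then show "integrable (lebesgue_on S) (\<lambda>x. norm (weak_gradient S u x) powr p)"
    by (rule integrable_cong_AE_imp) (use ae in \<open>auto elim: eventually_mono\<close>)
qed

section \<open>The flux\<close>

text \<open>
  The \<open>p\<close>-Laplacian flux, with value \<open>0\<close> at \<open>0\<close> for every exponent.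
\<close>

definition flux :: "real \<Rightarrow> 'a::real_normed_vector \<Rightarrow> 'a" where
  "flux p v = (norm v powr (p - 2)) *\<^sub>R v"

lemma norm_flux: "norm (flux p v) = norm v powr (p - 1)"
proof (cases "v = 0")
  case False
  have "norm v powr (p - 1) = norm v powr (p - 2) * norm v powr 1" by (subst powr_add[symmetric]) simp
  then show ?thesis using False by (simp add: flux_def)
qed (simp add: flux_def)

text \<open>
  By the Cauchy-Schwarz inequality the product is at least
  \<open>(\<bar>a\<bar>\<^sup>p\<^sup>-\<^sup>1 - \<bar>b\<bar>\<^sup>p\<^sup>-\<^sup>1) (\<bar>a\<bar> - \<bar>b\<bar>)\<close>, whose factors have the same sign.
\<close>

lemma flux_monotone:
  fixes a b :: "'a::real_inner"
  assumes p: "p > 1"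
  shows "0 \<le> (flux p a - flux p b) \<bullet> (a - b)"
proof -
  have self: "flux p v \<bullet> v = norm v powr (p - 1) * norm v" for v :: 'a
  proof -
    have "flux p v \<bullet> v = norm (flux p v) * norm v" by (simp add: flux_def dot_square_norm power2_eq_square)
    then show ?thesis by (simp add: norm_flux)
  qed
  have cross: "flux p v \<bullet> w \<le> norm v powr (p - 1) * norm w" for v w :: 'a
    using norm_cauchy_schwarz[of "flux p v" w] by (simp add: norm_flux)
  have "(norm a powr (p - 1) - norm b powr (p - 1)) * (norm a - norm b) \<ge> 0"
  proof (cases "norm a \<le> norm b")
    case True
    then have "norm a powr (p - 1) \<le> norm b powr (p - 1)" using p by (intro powr_mono2) auto
    with True show ?thesis by (intro mult_nonpos_nonpos) auto
  next
    case False
    then have "norm b powr (p - 1) \<le> norm a powr (p - 1)" using p by (intro powr_mono2) auto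
    with False show ?thesis by (intro mult_nonneg_nonneg) auto
  qed
  then show ?thesis using self[of a] self[of b] cross[of a b] cross[of b a]
    by (simp add: algebra_simps inner_diff_left inner_diff_right)
qed

text \<open>
  A crude form of Young's inequality, by comparing both factors with the larger number; it replaces
  Hoelder's inequality in the integrability of the flux against a gradient.
\<close>

lemma powr_mult_le_sum:
  fixes a b :: real
  assumes "a \<ge> 0" "b \<ge> 0" "p > 1"
  shows "a powr (p - 1) * b \<le> a powr p + b powr p"
proof -
  have m: "c powr (p - 1) * c = c powr p" if "c \<ge> 0" for c :: real
    using that powr_add[of c "p - 1" 1] by simp
  show ?thesis
  proof (cases "a \<le> b")
    case True
    have "a powr (p - 1) * b \<le> b powr (p - 1) * b" using True assms by (intro mult_right_mono powr_mono2) auto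
    then show ?thesis using m[OF assms(2)] by (smt (verit) powr_ge_zero)
  next
    case False
    have "a powr (p - 1) * b \<le> a powr (p - 1) * a" using False assms by (intro mult_left_mono) auto
    then show ?thesis using m[OF assms(1)] by (smt (verit) powr_ge_zero)
  qed
qed

lemma flux_integrable:
  fixes F H :: "'a \<Rightarrow> 'b::{euclidean_space}"
  assumes p: "p > 1" and [measurable]: "\<gamma> \<in> borel_measurable M" "F \<in> borel_measurable M" "H \<in> borel_measurable M"
    and \<gamma>: "AE x in M. 0 \<le> \<gamma> x \<and> \<gamma> x \<le> c"
    and F: "integrable M (\<lambda>x. norm (F x) powr p)" and H: "integrable M (\<lambda>x. norm (H x) powr p)"
  shows "integrable M (\<lambda>x. \<gamma> x * (flux p (F x) \<bullet> H x))"
proof (rule Bochner_Integration.integrable_bound)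
  show "integrable M (\<lambda>x. c * (norm (F x) powr p + norm (H x) powr p))"
    by (intro integrable_mult_right Bochner_Integration.integrable_add F H)
  show "(\<lambda>x. \<gamma> x * (flux p (F x) \<bullet> H x)) \<in> borel_measurable M" unfolding flux_def by measurable
  show "AE x in M. norm (\<gamma> x * (flux p (F x) \<bullet> H x)) \<le> norm (c * (norm (F x) powr p + norm (H x) powr p))"
    using \<gamma>
  proof eventually_elim
    case (elim x)
    have "\<bar>flux p (F x) \<bullet> H x\<bar> \<le> norm (F x) powr (p - 1) * norm (H x)"
      using Cauchy_Schwarz_ineq2[of "flux p (F x)" "H x"] by (simp add: norm_flux)
    also have "\<dots> \<le> norm (F x) powr p + norm (H x) powr p" using p by (intro powr_mult_le_sum) auto
    finally have "\<bar>\<gamma> x\<bar> * \<bar>flux p (F x) \<bullet> H x\<bar> \<le> c * (norm (F x) powr p + norm (H x) powr p)"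
      using elim by (intro mult_mono) auto
    then have "\<bar>\<gamma> x * (flux p (F x) \<bullet> H x)\<bar> \<le> c * (norm (F x) powr p + norm (H x) powr p)" by (simp only: abs_mult)
    then show ?case by (metis abs_ge_self order_trans real_norm_def)
  qed
qed

section \<open>Testing with a function of the difference\<close>

lemma finite_measure_lebesgue_on:
  fixes S :: "'a::euclidean_space set"
  assumes "open S" "bounded S" shows "finite_measure (lebesgue_on S)"
proof (rule finite_measureI)
  have "emeasure lebesgue S < \<infinity>" using assms emeasure_bounded_finite[of S] by simp
  then show "emeasure (lebesgue_on S) (space (lebesgue_on S)) \<noteq> \<infinity>" using assms by (simp add: emeasure_restrict_space)
qed

lemma integrable_powr_diff:
  fixes F H :: "'a \<Rightarrow> 'b::{euclidean_space}"
  assumes p: "p \<ge> 1" and [measurable]: "F \<in> borel_measurable M" "H \<in> borel_measurable M"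
    and F: "integrable M (\<lambda>x. norm (F x) powr p)" and H: "integrable M (\<lambda>x. norm (H x) powr p)"
  shows "integrable M (\<lambda>x. norm (F x - H x) powr p)"
proof (rule Bochner_Integration.integrable_bound)
  show "integrable M (\<lambda>x. 2 powr p * (norm (F x) powr p + norm (H x) powr p))"
    by (intro integrable_mult_right Bochner_Integration.integrable_add F H)
  have *: "norm (a - b) powr p \<le> 2 powr p * (norm a powr p + norm b powr p)" for a b :: 'b
  proof -
    have "norm (a - b) \<le> 2 * max (norm a) (norm b)" using norm_triangle_ineq4[of a b] by linarith
    then have "norm (a - b) powr p \<le> (2 * max (norm a) (norm b)) powr p" using p by (intro powr_mono2) auto
    also have "\<dots> = 2 powr p * max (norm a) (norm b) powr p" by (rule powr_mult)
    also have "\<dots> \<le> 2 powr p * (norm a powr p + norm b powr p)"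
      by (intro mult_left_mono) (auto simp: max_def)
    finally show ?thesis .
  qed
  then show "AE x in M. norm (norm (F x - H x) powr p) \<le> norm (2 powr p * (norm (F x) powr p + norm (H x) powr p))"
    by (intro AE_I2) simp
qed measurable

lemma sobolev_compose_diff:
  fixes S :: "(real^'n) set"
  assumes S: "open S" "bounded S" and p: "p \<ge> 1" and f: "f \<in> sobolev S p" and h: "h \<in> sobolev S p"
    and T: "\<And>x. (T has_real_derivative T' x) (at x)" "continuous_on UNIV T'"
    and B: "\<And>x. \<bar>T x\<bar> \<le> B" and L: "\<And>x. \<bar>T' x\<bar> \<le> L"
  shows "(\<lambda>x. T (f x - h x)) \<in> sobolev S p \<inter> Lq S \<infinity>"
    and "AE x in lebesgue_on S. weak_gradient S (\<lambda>x. T (f x - h x)) x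
        = T' (f x - h x) *\<^sub>R (weak_gradient S f x - weak_gradient S h x)"
proof -
  interpret finite_measure "lebesgue_on S" by (rule finite_measure_lebesgue_on[OF S])
  have "continuous_on UNIV T" using T(1) DERIV_isCont by (blast intro: continuous_at_imp_continuous_on)
  then have Tm [measurable]: "T \<in> borel_measurable borel" by (rule borel_measurable_continuous_onI)
  have T'm [measurable]: "T' \<in> borel_measurable borel" using T(2) by (rule borel_measurable_continuous_onI)
  have [measurable]: "f \<in> borel_measurable (lebesgue_on S)" "h \<in> borel_measurable (lebesgue_on S)"
    using f h by (auto simp: sobolev_def Lq_def)
  note F = sobolev_weak_gradient[OF S(1) p f] and H = sobolev_weak_gradient[OF S(1) p h]
  note [measurable] = F(2) H(2)
  have L0: "L \<ge> 0" using L[of 0] by auto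
  have B0: "B \<ge> 0" using B[of 0] by auto
  let ?G = "\<lambda>x. T' (f x - h x) *\<^sub>R (weak_gradient S f x - weak_gradient S h x)"
  have G: "has_weak_gradient S (\<lambda>x. T (f x - h x)) ?G"
    by (rule chain_rule[OF S(1) has_weak_gradient_diff[OF S(1) F(1) H(1)] T B L])
  have "\<bar>T (f x - h x)\<bar> powr p \<le> B powr p" for x using p by (intro powr_mono2 B) auto
  then have 1: "(\<lambda>x. T (f x - h x)) \<in> Lq S (ennreal p)"
    unfolding Lq_iff_integrable[OF p] by (intro conjI integrable_const_bound[of _ "B powr p"]) auto
  have Gm: "(\<lambda>x. ?G x $ i) \<in> borel_measurable (lebesgue_on S)" for i
  proof -
    have "(\<lambda>x. ?G x $ i) = (\<lambda>x. ?G x \<bullet> axis i 1)" by (simp add: inner_axis)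
    then show ?thesis by (simp only:) measurable
  qed
  have Gi: "integrable (lebesgue_on S) (\<lambda>x. \<bar>?G x $ i\<bar> powr p)" for i
  proof (rule Bochner_Integration.integrable_bound)
    show "integrable (lebesgue_on S) (\<lambda>x. L powr p * norm (weak_gradient S f x - weak_gradient S h x) powr p)"
      by (intro integrable_mult_right integrable_powr_diff[OF p F(2) H(2) F(3) H(3)])
    show "(\<lambda>x. \<bar>?G x $ i\<bar> powr p) \<in> borel_measurable (lebesgue_on S)" using Gm by measurable
    show "AE x in lebesgue_on S. norm (\<bar>?G x $ i\<bar> powr p) \<le> norm (L powr p * norm (weak_gradient S f x - weak_gradient S h x) powr p)"
    proof (rule AE_I2)
      fix x
      have "\<bar>?G x $ i\<bar> \<le> \<bar>T' (f x - h x)\<bar> * norm (weak_gradient S f x - weak_gradient S h x)"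
        using component_le_norm_cart[of "?G x" i] by simp
      also have "\<dots> \<le> L * norm (weak_gradient S f x - weak_gradient S h x)" using L by (intro mult_right_mono) auto
      finally have "\<bar>?G x $ i\<bar> powr p \<le> (L * norm (weak_gradient S f x - weak_gradient S h x)) powr p"
        using p by (intro powr_mono2) auto
      also have "\<dots> = L powr p * norm (weak_gradient S f x - weak_gradient S h x) powr p" by (rule powr_mult)
      finally show "norm (\<bar>?G x $ i\<bar> powr p) \<le> norm (L powr p * norm (weak_gradient S f x - weak_gradient S h x) powr p)"
        by simp
    qed
  qed
  have 2: "(\<lambda>x. ?G x $ i) \<in> Lq S (ennreal p)" for i
    using Gm Gi Lq_iff_integrable[OF p, of "\<lambda>x. ?G x $ i" S] by blast
  have 3: "(\<lambda>x. T (f x - h x)) \<in> Lq S \<infinity>" by (rule Lq_inftyI[of _ _ B]) (use B in auto)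
  show 4: "(\<lambda>x. T (f x - h x)) \<in> sobolev S p \<inter> Lq S \<infinity>" using 1 2 3 G by (auto simp: sobolev_def)
  show "AE x in lebesgue_on S. weak_gradient S (\<lambda>x. T (f x - h x)) x = ?G x"
    by (rule weak_gradient_unique[OF S(1) sobolev_weak_gradient(1)[OF S(1) p] G]) (use 4 in auto)
qed

text \<open>
  The core of the accretivity: \<open>T (f - h)\<close> tests both weak equations, and the difference of the left-hand sides is the
  integral of a product of nonnegative factors by the chain rule and the monotonicity of the flux.
\<close>

lemma weak_solution_pairing_nonneg:
  fixes S :: "(real^'n) set"
  assumes S: "open S" "bounded S" and p: "p > 1" and f: "f \<in> sobolev S p" and h: "h \<in> sobolev S p"
    and f': "f' \<in> Lq S 1" and h': "h' \<in> Lq S 1"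
    and \<gamma>m: "\<gamma> \<in> borel_measurable (lebesgue_on S)" and \<gamma>: "AE x in lebesgue_on S. 0 \<le> \<gamma> x \<and> \<gamma> x \<le> c"
    and eqf: "\<And>\<phi>. \<phi> \<in> sobolev S p \<inter> Lq S \<infinity> \<Longrightarrow>
      (\<integral>x. \<gamma> x * (flux p (weak_gradient S f x) \<bullet> weak_gradient S \<phi> x) \<partial>lebesgue_on S) = (\<integral>x. f' x * \<phi> x \<partial>lebesgue_on S)"
    and eqh: "\<And>\<phi>. \<phi> \<in> sobolev S p \<inter> Lq S \<infinity> \<Longrightarrow>
      (\<integral>x. \<gamma> x * (flux p (weak_gradient S h x) \<bullet> weak_gradient S \<phi> x) \<partial>lebesgue_on S) = (\<integral>x. h' x * \<phi> x \<partial>lebesgue_on S)"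
    and T: "\<And>x. (T has_real_derivative T' x) (at x)" "continuous_on UNIV T'"
    and B: "\<And>x. \<bar>T x\<bar> \<le> B" and L: "\<And>x. \<bar>T' x\<bar> \<le> L" and mono: "\<And>x. 0 \<le> T' x"
  shows "0 \<le> (\<integral>x. (f' x - h' x) * T (f x - h x) \<partial>lebesgue_on S)"
proof -
  have p1: "p \<ge> 1" using p by simp
  note F = sobolev_weak_gradient[OF S(1) p1 f] and H = sobolev_weak_gradient[OF S(1) p1 h]
  note C = sobolev_compose_diff[OF S p1 f h T B L]
  let ?\<phi> = "\<lambda>x. T (f x - h x)"
  have "?\<phi> \<in> sobolev S p" using C(1) by blast
  note \<Phi> = sobolev_weak_gradient[OF S(1) p1 this]
  have [measurable]: "?\<phi> \<in> borel_measurable (lebesgue_on S)" using C(1) by (auto simp: Lq_def)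
  have i: "integrable (lebesgue_on S) (\<lambda>x. k x * ?\<phi> x)" if "k \<in> Lq S 1" for k
    by (rule integrable_mult_bounded[OF _ _ B]) (use that in \<open>simp_all add: Lq_1_iff\<close>)
  have "(\<integral>x. (f' x - h' x) * ?\<phi> x \<partial>lebesgue_on S) = (\<integral>x. f' x * ?\<phi> x \<partial>lebesgue_on S) - (\<integral>x. h' x * ?\<phi> x \<partial>lebesgue_on S)"
    using i[OF f'] i[OF h'] by (simp add: left_diff_distrib)
  also have "\<dots> = (\<integral>x. \<gamma> x * (flux p (weak_gradient S f x) \<bullet> weak_gradient S ?\<phi> x) \<partial>lebesgue_on S)
      - (\<integral>x. \<gamma> x * (flux p (weak_gradient S h x) \<bullet> weak_gradient S ?\<phi> x) \<partial>lebesgue_on S)"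
    using eqf[OF C(1)] eqh[OF C(1)] by simp
  also have "\<dots> = (\<integral>x. \<gamma> x * (flux p (weak_gradient S f x) \<bullet> weak_gradient S ?\<phi> x)
      - \<gamma> x * (flux p (weak_gradient S h x) \<bullet> weak_gradient S ?\<phi> x) \<partial>lebesgue_on S)"
    by (rule Bochner_Integration.integral_diff[symmetric])
      (rule flux_integrable[OF p \<gamma>m F(2) \<Phi>(2) \<gamma> F(3) \<Phi>(3)], rule flux_integrable[OF p \<gamma>m H(2) \<Phi>(2) \<gamma> H(3) \<Phi>(3)])
  also have "\<dots> \<ge> 0"
  proof (rule integral_nonneg_AE)
    show "AE x in lebesgue_on S. 0 \<le> \<gamma> x * (flux p (weak_gradient S f x) \<bullet> weak_gradient S ?\<phi> x)
      - \<gamma> x * (flux p (weak_gradient S h x) \<bullet> weak_gradient S ?\<phi> x)"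
      using \<gamma> C(2)
    proof eventually_elim
      case (elim x)
      let ?a = "weak_gradient S f x" and ?b = "weak_gradient S h x"
      have "\<gamma> x * (flux p ?a \<bullet> weak_gradient S ?\<phi> x) - \<gamma> x * (flux p ?b \<bullet> weak_gradient S ?\<phi> x)
          = \<gamma> x * T' (f x - h x) * ((flux p ?a - flux p ?b) \<bullet> (?a - ?b))"
        unfolding elim(2) by (simp add: inner_diff_left algebra_simps)
      also have "\<dots> \<ge> 0" using elim(1) mono flux_monotone[OF p, of ?a ?b] by (intro mult_nonneg_nonneg) auto
      finally show ?case .
    qed
  qed
  finally show ?thesis .
qed

section \<open>Completely accretive pairs\<close>

text \<open>
  The derivative is carried along because it is the factor that the chain rule produces.
\<close>

definition truncation :: "(real \<Rightarrow> real) \<Rightarrow> (real \<Rightarrow> real) \<Rightarrow> bool" where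
  "truncation T T' \<longleftrightarrow> (\<forall>x. (T has_real_derivative T' x) (at x)) \<and> continuous_on UNIV T' \<and>
     (\<exists>B. \<forall>x. \<bar>T x\<bar> \<le> B) \<and> (\<exists>L. \<forall>x. \<bar>T' x\<bar> \<le> L) \<and> (\<forall>x. 0 \<le> T' x)"

text \<open>
  A form of the complete accretivity condition of Benilan and Crandall for the difference \<open>(u, v)\<close> of two pairs.
\<close>

definition pairing_nonneg :: "'a measure \<Rightarrow> ('a \<Rightarrow> real) \<Rightarrow> ('a \<Rightarrow> real) \<Rightarrow> bool" where
  "pairing_nonneg M u v \<longleftrightarrow> integrable M u \<and> integrable M v \<and>
     (\<forall>T T'. truncation T T' \<longrightarrow> 0 \<le> (\<integral>x. v x * T (u x) \<partial>M))"

lemma truncation_measurable: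
  assumes "truncation T T'" shows "T \<in> borel_measurable borel" "isCont T x"
proof -
  show "isCont T x" for x using assms DERIV_isCont by (auto simp: truncation_def)
  then show "T \<in> borel_measurable borel"
    by (intro borel_measurable_continuous_onI continuous_at_imp_continuous_on) auto
qed

text \<open>
  Convergence of \<open>u\<close> in \<open>L\<^sup>1\<close> gives convergence almost everywhere along a subsequence, and \<open>T\<close> is bounded and
  continuous, so the integrals of \<open>v * T u\<close> converge along that subsequence.
\<close>

lemma pairing_nonneg_closed:
  assumes u: "integrable M u" and v: "integrable M v"
    and approx: "\<And>e. e > 0 \<Longrightarrow> \<exists>u' v'. pairing_nonneg M u' v' \<and> (\<integral>x. \<bar>u' x - u x\<bar> \<partial>M) < e \<and> (\<integral>x. \<bar>v' x - v x\<bar> \<partial>M) < e"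
  shows "pairing_nonneg M u v"
  unfolding pairing_nonneg_def
proof (intro conjI allI impI u v)
  fix T T' assume T: "truncation T T'"
  obtain B where B: "\<And>x. \<bar>T x\<bar> \<le> B" using T by (auto simp: truncation_def)
  note Tm [measurable] = truncation_measurable(1)[OF T]
  have "\<forall>n. \<exists>u' v'. pairing_nonneg M u' v' \<and> (\<integral>x. \<bar>u' x - u x\<bar> \<partial>M) < inverse (real (Suc n)) \<and> (\<integral>x. \<bar>v' x - v x\<bar> \<partial>M) < inverse (real (Suc n))"
    using approx by (metis of_nat_0_less_iff positive_imp_inverse_positive zero_less_Suc)
  then obtain U V where UV: "\<And>n. pairing_nonneg M (U n) (V n)"
    and Un: "\<And>n. (\<integral>x. \<bar>U n x - u x\<bar> \<partial>M) < inverse (real (Suc n))"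
    and Vn: "\<And>n. (\<integral>x. \<bar>V n x - v x\<bar> \<partial>M) < inverse (real (Suc n))" by metis
  have i: "integrable M (U n)" "integrable M (V n)" for n using UV by (auto simp: pairing_nonneg_def)
  have [measurable]: "u \<in> borel_measurable M" "v \<in> borel_measurable M"
    "U n \<in> borel_measurable M" "V n \<in> borel_measurable M" for n using u v i by auto
  have limU: "(\<lambda>n. \<integral>x. norm (U n x - u x) \<partial>M) \<longlonglongrightarrow> 0"
    by (rule Lim_null_comparison[OF always_eventually LIMSEQ_inverse_real_of_nat]) (use Un in \<open>auto simp: less_imp_le\<close>)
  have limV: "(\<lambda>n. \<integral>x. \<bar>V n x - v x\<bar> \<partial>M) \<longlonglongrightarrow> 0"
    by (rule Lim_null_comparison[OF always_eventually LIMSEQ_inverse_real_of_nat]) (use Vn in \<open>auto simp: less_imp_le\<close>)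
  obtain r where r: "strict_mono r" and ae: "AE x in M. (\<lambda>n. U (r n) x - u x) \<longlonglongrightarrow> 0"
    using tendsto_L1_AE_subseq[of M "\<lambda>n x. U n x - u x", OF _ limU] i u by auto
  have split: "(\<integral>x. V (r n) x * T (U (r n) x) \<partial>M)
      = (\<integral>x. (V (r n) x - v x) * T (U (r n) x) \<partial>M) + (\<integral>x. v x * T (U (r n) x) \<partial>M)" for n
  proof -
    have "(\<integral>x. V (r n) x * T (U (r n) x) \<partial>M) = (\<integral>x. (V (r n) x - v x) * T (U (r n) x) + v x * T (U (r n) x) \<partial>M)"
      by (rule Bochner_Integration.integral_cong) (auto simp: algebra_simps)
    also have "\<dots> = (\<integral>x. (V (r n) x - v x) * T (U (r n) x) \<partial>M) + (\<integral>x. v x * T (U (r n) x) \<partial>M)"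
      by (intro Bochner_Integration.integral_add integrable_mult_bounded[of _ _ _ B] Bochner_Integration.integrable_diff i v)
        (use B in auto)
    finally show ?thesis .
  qed
  have "(\<lambda>n. \<integral>x. (V (r n) x - v x) * T (U (r n) x) \<partial>M) \<longlonglongrightarrow> 0"
  proof (rule Lim_null_comparison)
    show "(\<lambda>n. B * (\<integral>x. \<bar>V (r n) x - v x\<bar> \<partial>M)) \<longlonglongrightarrow> 0"
      using tendsto_mult[OF tendsto_const LIMSEQ_subseq_LIMSEQ[OF limV r], of B] by (simp add: comp_def)
    show "\<forall>\<^sub>F n in sequentially. norm (\<integral>x. (V (r n) x - v x) * T (U (r n) x) \<partial>M) \<le> B * (\<integral>x. \<bar>V (r n) x - v x\<bar> \<partial>M)"
      by (intro always_eventually allI integral_mult_bounded_le[OF Bochner_Integration.integrable_diff[OF i(2) v] _ B]) measurable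
  qed
  moreover have "(\<lambda>n. \<integral>x. v x * T (U (r n) x) \<partial>M) \<longlonglongrightarrow> (\<integral>x. v x * T (u x) \<partial>M)"
  proof (rule integral_dominated_convergence[where w = "\<lambda>x. B * \<bar>v x\<bar>"])
    show "integrable M (\<lambda>x. B * \<bar>v x\<bar>)" by (intro integrable_mult_right integrable_abs v)
    show "AE x in M. norm (v x * T (U (r n) x)) \<le> B * \<bar>v x\<bar>" for n
      by (intro AE_I2 norm_mult_bounded_le B)
    show "AE x in M. (\<lambda>n. v x * T (U (r n) x)) \<longlonglongrightarrow> v x * T (u x)"
      using ae
    proof eventually_elim
      case (elim x)
      have "(\<lambda>n. U (r n) x) \<longlonglongrightarrow> u x" using tendsto_add[OF elim tendsto_const, of "u x"] by simp
      from isCont_tendsto_compose[OF truncation_measurable(2)[OF T] this] show ?case by (intro tendsto_mult tendsto_const)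
    qed
  qed measurable
  ultimately have "(\<lambda>n. \<integral>x. V (r n) x * T (U (r n) x) \<partial>M) \<longlonglongrightarrow> 0 + (\<integral>x. v x * T (u x) \<partial>M)"
    unfolding split by (rule tendsto_add)
  moreover have "0 \<le> (\<integral>x. V (r n) x * T (U (r n) x) \<partial>M)" for n using UV[of "r n"] T by (auto simp: pairing_nonneg_def)
  ultimately show "0 \<le> (\<integral>x. v x * T (u x) \<partial>M)" using LIMSEQ_le_const by fastforce
qed

lemma pairing_limit:
  fixes v u :: "'a \<Rightarrow> real"
  assumes v: "integrable M v" and [measurable]: "u \<in> borel_measurable M"
    and Tn: "\<And>n. T n \<in> borel_measurable borel" and B: "\<And>n s. \<bar>T n s\<bar> \<le> B"
    and lim: "\<And>s. (\<lambda>n. T n s) \<longlonglongrightarrow> T0 s" and pos: "\<And>n. 0 \<le> (\<integral>x. v x * T n (u x) \<partial>M)"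
  shows "0 \<le> (\<integral>x. v x * T0 (u x) \<partial>M)"
proof -
  note [measurable] = Tn
  have T0m [measurable]: "T0 \<in> borel_measurable borel" by (rule borel_measurable_LIMSEQ_real[OF lim Tn])
  have [measurable]: "v \<in> borel_measurable M" using v by auto
  have "(\<lambda>n. \<integral>x. v x * T n (u x) \<partial>M) \<longlonglongrightarrow> (\<integral>x. v x * T0 (u x) \<partial>M)"
  proof (rule integral_dominated_convergence[where w = "\<lambda>x. B * \<bar>v x\<bar>"])
    show "integrable M (\<lambda>x. B * \<bar>v x\<bar>)" by (intro integrable_mult_right integrable_abs v)
    show "AE x in M. norm (v x * T n (u x)) \<le> B * \<bar>v x\<bar>" for n
      by (intro AE_I2 norm_mult_bounded_le B)
  qed (auto intro!: AE_I2 tendsto_mult tendsto_const lim)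
  then show ?thesis using pos LIMSEQ_le_const by fastforce
qed

text \<open>
  With \<open>F\<close> an antiderivative of \<open>T\<close>, the averages \<open>(F (s + h) - F s) / h\<close> of \<open>T\<close> over \<open>[s, s + h]\<close> are
  nondecreasing \<open>C\<^sup>1\<close> functions with derivative \<open>(T (s + h) - T s) / h\<close>, and they converge to \<open>T\<close>.
\<close>

lemma pairing_nonneg_continuous:
  assumes uv: "pairing_nonneg M u v" and T: "continuous_on UNIV T" "mono T" and B: "\<And>s. \<bar>T s\<bar> \<le> B"
  shows "0 \<le> (\<integral>x. v x * T (u x) \<partial>M)"
proof -
  have "\<exists>F. \<forall>x :: real. -\<infinity> < ereal x \<longrightarrow> ereal x < \<infinity> \<longrightarrow> (F has_vector_derivative T x) (at x)"
    using T(1) by (intro einterval_antiderivative) (auto simp: continuous_on_eq_continuous_at)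
  then obtain F where F: "\<And>x. (F has_real_derivative T x) (at x)"
    by (auto simp: has_real_derivative_iff_has_vector_derivative)
  define h where "h n = inverse (real (Suc n))" for n
  have h: "h n > 0" for n by (simp add: h_def)
  define Tn where "Tn n s = (F (s + h n) - F s) / h n" for n s
  define Tn' where "Tn' n s = (T (s + h n) - T s) / h n" for n s
  have Tn_bd: "\<bar>Tn n s\<bar> \<le> B" for n s
  proof -
    obtain z where "F (s + h n) - F s = (s + h n - s) * T z" using MVT2[of s "s + h n" F T] F h[of n] by auto
    then have "Tn n s = T z" using h[of n] by (simp add: Tn_def)
    then show ?thesis using B by simp
  qed
  have tr: "truncation (Tn n) (Tn' n)" for n
    unfolding truncation_def
  proof (intro conjI allI)
    show "(Tn n has_real_derivative Tn' n s) (at s)" for s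
    proof -
      have "((\<lambda>s. F (s + h n)) has_real_derivative T (s + h n)) (at s)"
        using DERIV_shift[of F "T (s + h n)" s "h n"] F by simp
      then have "((\<lambda>s. (F (s + h n) - F s) / h n) has_real_derivative (T (s + h n) - T s) / h n) (at s)"
        by (intro DERIV_cdivide DERIV_diff F)
      then show ?thesis by (simp add: Tn_def[abs_def] Tn'_def)
    qed
    show "continuous_on UNIV (Tn' n)"
      unfolding Tn'_def using h[of n] by (intro continuous_intros continuous_on_compose2[OF T(1)] T(1)) auto
    show "\<exists>B. \<forall>x. \<bar>Tn n x\<bar> \<le> B" using Tn_bd by blast
    show "0 \<le> Tn' n s" for s using monoD[OF T(2), of s "s + h n"] h[of n] by (simp add: Tn'_def)
    have "\<bar>Tn' n s\<bar> \<le> 2 * B / h n" for s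
    proof -
      have "\<bar>T (s + h n) - T s\<bar> \<le> 2 * B" using B[of s] B[of "s + h n"] by linarith
      then show ?thesis using h[of n] by (simp add: Tn'_def abs_divide divide_right_mono)
    qed
    then show "\<exists>L. \<forall>x. \<bar>Tn' n x\<bar> \<le> L" by blast
  qed
  show ?thesis
  proof (rule pairing_limit[where T = Tn and v = v and u = u and ?T0.0 = T])
    show "integrable M v" "u \<in> borel_measurable M" using uv by (auto simp: pairing_nonneg_def)
    show "Tn n \<in> borel_measurable borel" for n by (rule truncation_measurable(1)[OF tr])
    show "0 \<le> (\<integral>x. v x * Tn n (u x) \<partial>M)" for n using uv tr by (auto simp: pairing_nonneg_def)
    show "(\<lambda>n. Tn n s) \<longlonglongrightarrow> T s" for s
    proof -
      have "filterlim h (at 0) sequentially"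
        unfolding h_def[abs_def] using LIMSEQ_inverse_real_of_nat by (intro filterlim_atI) auto
      with F[of s] show ?thesis unfolding Tn_def DERIV_def by (rule filterlim_compose)
    qed
  qed (rule Tn_bd)
qed

section \<open>From pairings to norms\<close>

definition clamp_abs :: "real \<Rightarrow> real \<Rightarrow> real" where
  "clamp_abs k s = max (- k) (min k s)"

text \<open>
  The signed power \<open>sgn t * \<bar>t\<bar>\<^sup>r\<close>. It equals \<open>sgn t\<close> for \<open>r = 0\<close> because \<open>0 powr 0 = 0\<close>, so that
  \<open>q * spow (q - 1)\<close> is a subgradient of \<open>\<bar>t\<bar>\<^sup>q\<close> also for \<open>q = 1\<close>.
\<close>

definition spow :: "real \<Rightarrow> real \<Rightarrow> real" where
  "spow r t = max t 0 powr r - max (- t) 0 powr r"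

lemma spow_simps: "t > 0 \<Longrightarrow> spow r t = t powr r" "t < 0 \<Longrightarrow> spow r t = - ((- t) powr r)" "spow r 0 = 0"
  by (auto simp: spow_def max_def)

lemma abs_spow: "\<bar>spow r t\<bar> = \<bar>t\<bar> powr r"
  by (cases "t > 0"; cases "t < 0") (auto simp: spow_simps not_less)

lemma spow_mult_self: "spow (q - 1) t * t = \<bar>t\<bar> powr q"
proof -
  have m: "c powr (q - 1) * c = c powr q" if "c > 0" for c :: real
    using that powr_add[of c "q - 1" 1] by simp
  consider "t > 0" | "t < 0" | "t = 0" by linarith
  then show ?thesis using m[of t] m[of "- t"] by cases (auto simp: spow_simps)
qed

text \<open>
  The tangent inequality for the convex function \<open>\<bar>t\<bar>\<^sup>q\<close>, which for \<open>q > 1\<close> is Young's inequality for \<open>\<bar>b\<bar>\<close> and \<open>\<bar>a\<bar>\<^sup>q\<^sup>-\<^sup>1\<close>.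
\<close>

lemma powr_subgradient:
  assumes q: "q \<ge> 1"
  shows "\<bar>a\<bar> powr q + q * (spow (q - 1) a * (b - a)) \<le> \<bar>b\<bar> powr q"
proof -
  have "q * (\<bar>a\<bar> powr (q - 1) * \<bar>b\<bar>) \<le> \<bar>b\<bar> powr q + (q - 1) * \<bar>a\<bar> powr q"
  proof (cases "q = 1")
    case True then show ?thesis by (cases "a = 0") auto
  next
    case False
    then have q1: "q > 1" using q by simp
    have "\<bar>b\<bar> * \<bar>a\<bar> powr (q - 1) \<le> \<bar>b\<bar> powr q / q + (\<bar>a\<bar> powr (q - 1)) powr (q / (q - 1)) / (q / (q - 1))"
      by (rule Youngs_inequality) (use q1 in \<open>auto simp: field_simps\<close>)
    also have "(\<bar>a\<bar> powr (q - 1)) powr (q / (q - 1)) = \<bar>a\<bar> powr q" using q1 by (simp add: powr_powr)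
    finally have "q * (\<bar>b\<bar> * \<bar>a\<bar> powr (q - 1)) \<le> q * (\<bar>b\<bar> powr q / q + \<bar>a\<bar> powr q / (q / (q - 1)))"
      using q1 by (intro mult_left_mono) auto
    also have "\<dots> = \<bar>b\<bar> powr q + (q - 1) * \<bar>a\<bar> powr q" using q1 by (simp add: field_simps)
    finally show ?thesis by (simp add: mult.commute)
  qed
  moreover have "spow (q - 1) a * b \<le> \<bar>a\<bar> powr (q - 1) * \<bar>b\<bar>"
    by (metis abs_ge_self abs_mult abs_spow)
  then have "q * (spow (q - 1) a * b) \<le> q * (\<bar>a\<bar> powr (q - 1) * \<bar>b\<bar>)" using q by (intro mult_left_mono) auto
  moreover have "q * (spow (q - 1) a * (b - a)) = q * (spow (q - 1) a * b) - q * \<bar>a\<bar> powr q"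
    by (simp add: right_diff_distrib spow_mult_self)
  ultimately show ?thesis by (simp add: left_diff_distrib)
qed

lemma clamp_abs_props:
  assumes "k \<ge> 0"
  shows "\<bar>clamp_abs k s\<bar> \<le> k" "\<bar>clamp_abs k s\<bar> \<le> \<bar>s\<bar>" "0 \<le> spow r (clamp_abs k s) * (s - clamp_abs k s)"
proof -
  show "\<bar>clamp_abs k s\<bar> \<le> k" "\<bar>clamp_abs k s\<bar> \<le> \<bar>s\<bar>" using assms by (auto simp: clamp_abs_def)
  consider "\<bar>s\<bar> \<le> k" | "s > k" | "s < - k" by linarith
  then show "0 \<le> spow r (clamp_abs k s) * (s - clamp_abs k s)"
  proof cases
    case 1 then show ?thesis by (auto simp: clamp_abs_def abs_le_iff)
  next
    case 2 then show ?thesis using assms by (cases "k = 0") (auto simp: clamp_abs_def spow_simps)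
  next
    case 3 then show ?thesis using assms by (cases "k = 0") (auto simp: clamp_abs_def spow_simps mult_nonneg_nonpos)
  qed
qed

lemma spow_mono: "r > 0 \<Longrightarrow> mono (spow r)"
  unfolding spow_def by (intro monoI diff_mono powr_mono2) auto

lemma continuous_on_spow: "r > 0 \<Longrightarrow> continuous_on UNIV (spow r)"
  unfolding spow_def by (intro continuous_intros continuous_on_powr') auto

lemma clamp_abs_mono: "mono (clamp_abs k)"
  by (auto simp: clamp_abs_def mono_def)

lemma continuous_on_clamp_abs: "continuous_on UNIV (clamp_abs k)"
  unfolding clamp_abs_def by (intro continuous_intros)

text \<open>
  For \<open>q > 1\<close> the truncated signed power is continuous. For \<open>q = 1\<close> it is the sign function, a bounded limit of
  steep continuous ramps.
\<close>

lemma pairing_spow_nonneg: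
  assumes uv: "pairing_nonneg M u v" and q: "q \<ge> 1" and k: "k > 0"
  shows "0 \<le> (\<integral>x. v x * spow (q - 1) (clamp_abs k (u x)) \<partial>M)"
proof (cases "q = 1")
  case False
  then have r: "q - 1 > 0" using q by simp
  show ?thesis
  proof (rule pairing_nonneg_continuous[OF uv, where B = "k powr (q - 1)"])
    show "continuous_on UNIV (\<lambda>s. spow (q - 1) (clamp_abs k s))"
      by (rule continuous_on_compose2[OF continuous_on_spow[OF r] continuous_on_clamp_abs]) simp
    show "mono (\<lambda>s. spow (q - 1) (clamp_abs k s))"
      by (intro monoI monoD[OF spow_mono[OF r]] monoD[OF clamp_abs_mono])
    show "\<bar>spow (q - 1) (clamp_abs k s)\<bar> \<le> k powr (q - 1)" for s
      unfolding abs_spow using clamp_abs_props(1)[of k s] k r by (intro powr_mono2) auto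
  qed
next
  case True
  show ?thesis
  proof (rule pairing_limit[where T = "\<lambda>n s. clamp_abs 1 (real n * s)" and B = 1 and v = v and u = u
        and ?T0.0 = "\<lambda>s. spow (q - 1) (clamp_abs k s)"])
    show "integrable M v" "u \<in> borel_measurable M" using uv by (auto simp: pairing_nonneg_def)
    have c: "continuous_on UNIV (\<lambda>s. clamp_abs 1 (real n * s))" for n
      by (rule continuous_on_compose2[OF continuous_on_clamp_abs]) (auto intro: continuous_intros)
    then show "(\<lambda>s. clamp_abs 1 (real n * s)) \<in> borel_measurable borel" for n by (rule borel_measurable_continuous_onI)
    show bd: "\<bar>clamp_abs 1 (real n * s)\<bar> \<le> 1" for n s by (rule clamp_abs_props) simp
    show "0 \<le> (\<integral>x. v x * clamp_abs 1 (real n * u x) \<partial>M)" for n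
      by (rule pairing_nonneg_continuous[OF uv c _ bd]) (auto intro!: monoI monoD[OF clamp_abs_mono] mult_left_mono)
    show "(\<lambda>n. clamp_abs 1 (real n * s)) \<longlonglongrightarrow> spow (q - 1) (clamp_abs k s)" for s
    proof -
      obtain N where N: "s \<noteq> 0 \<Longrightarrow> real N * \<bar>s\<bar> > 1"
        using reals_Archimedean3[of "\<bar>s\<bar>"] by (cases "s = 0") auto
      have "clamp_abs 1 (real n * s) = spow (q - 1) (clamp_abs k s)" if n: "n \<ge> N" for n
      proof -
        consider "s > 0" | "s < 0" | "s = 0" by linarith
        then show ?thesis
        proof cases
          case 1
          have "real N * s \<le> real n * s" using 1 n by (intro mult_right_mono) auto
          moreover have "1 < real N * s" using N 1 by simp
          ultimately have "1 < real n * s" by linarith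
          then show ?thesis using 1 True k by (auto simp: clamp_abs_def spow_def max_def min_def)
        next
          case 2
          have "real N * (- s) \<le> real n * (- s)" using 2 n by (intro mult_right_mono) auto
          moreover have "1 < real N * (- s)" using N 2 by simp
          ultimately have "real n * s < - 1" by linarith
          then show ?thesis using 2 True k by (auto simp: clamp_abs_def spow_def max_def min_def)
        next
          case 3
          then show ?thesis using k by (simp add: clamp_abs_def spow_def)
        qed
      qed
      then show ?thesis by (intro tendsto_eventually) (auto simp: eventually_sequentially)
    qed
  qed
qed

text \<open>
  The tangent inequality at the truncation of \<open>u\<close> bounds its power by that of \<open>u + \<alpha> v\<close>, up to
  \<open>\<alpha> q v * spow (q - 1)\<close> of the truncation, which has nonnegative integral, and a term with a sign: the signed
  power of the truncation has the sign of what is cut off. Truncation makes all integrals finite; it is removed by monotone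
  convergence.
\<close>

lemma pairing_powr_le:
  assumes uv: "pairing_nonneg M u v" and q: "q \<ge> 1" and \<alpha>: "\<alpha> > 0"
  shows "(\<integral>\<^sup>+x. ennreal (\<bar>u x\<bar> powr q) \<partial>M) \<le> (\<integral>\<^sup>+x. ennreal (\<bar>u x + \<alpha> * v x\<bar> powr q) \<partial>M)"
proof (cases "(\<integral>\<^sup>+x. ennreal (\<bar>u x + \<alpha> * v x\<bar> powr q) \<partial>M) = \<infinity>")
  case False
  have u: "integrable M u" and v: "integrable M v" using uv by (auto simp: pairing_nonneg_def)
  have [measurable]: "u \<in> borel_measurable M" "v \<in> borel_measurable M" using u v by auto
  define w where "w x = u x + \<alpha> * v x" for x
  have [measurable]: "w \<in> borel_measurable M" unfolding w_def by measurable
  have iw: "integrable M (\<lambda>x. \<bar>w x\<bar> powr q)"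
    using False by (simp add: integrable_iff_bounded w_def less_top)
  have [measurable]: "clamp_abs k \<in> borel_measurable borel" for k
    by (rule borel_measurable_continuous_onI[OF continuous_on_clamp_abs])
  have [measurable]: "spow r \<in> borel_measurable borel" for r
    unfolding spow_def by measurable
  define t where "t k x = \<bar>clamp_abs (real (Suc k)) (u x)\<bar> powr q" for k x
  have le: "(\<integral>\<^sup>+x. ennreal (t k x) \<partial>M) \<le> (\<integral>\<^sup>+x. ennreal (\<bar>w x\<bar> powr q) \<partial>M)" for k
  proof -
    let ?c = "\<lambda>x. clamp_abs (real (Suc k)) (u x)"
    let ?s = "\<lambda>x. \<alpha> * q * (v x * spow (q - 1) (?c x))"
    have bd: "\<bar>spow (q - 1) (?c x)\<bar> \<le> real (Suc k) powr (q - 1)" for x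
      unfolding abs_spow using clamp_abs_props(1)[of "real (Suc k)" "u x"] q by (intro powr_mono2) auto
    have iS: "integrable M ?s"
      by (intro integrable_mult_right integrable_mult_bounded[OF v _ bd]) measurable
    have pt: "t k x \<le> \<bar>w x\<bar> powr q - ?s x" for x
    proof -
      have "t k x + q * (spow (q - 1) (?c x) * (w x - ?c x)) \<le> \<bar>w x\<bar> powr q"
        unfolding t_def by (rule powr_subgradient[OF q])
      moreover have "q * (spow (q - 1) (?c x) * (w x - ?c x)) = ?s x + q * (spow (q - 1) (?c x) * (u x - ?c x))"
        by (simp add: w_def algebra_simps)
      moreover have "0 \<le> q * (spow (q - 1) (?c x) * (u x - ?c x))"
        by (rule mult_nonneg_nonneg[OF _ clamp_abs_props(3)]) (use q in auto)
      ultimately show ?thesis by linarith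
    qed
    have it: "integrable M (t k)"
    proof (rule Bochner_Integration.integrable_bound[OF Bochner_Integration.integrable_diff[OF iw iS]])
      show "t k \<in> borel_measurable M" unfolding t_def by measurable
      have "norm (t k x) \<le> norm (\<bar>w x\<bar> powr q - ?s x)" for x
        using pt[of x] by (simp add: t_def)
      then show "AE x in M. norm (t k x) \<le> norm (\<bar>w x\<bar> powr q - ?s x)" by simp
    qed
    have "0 \<le> (\<integral>x. ?s x \<partial>M)"
      using pairing_spow_nonneg[OF uv q, of "real (Suc k)"] \<alpha> q by simp
    moreover have "(\<integral>x. t k x \<partial>M) \<le> (\<integral>x. \<bar>w x\<bar> powr q - ?s x \<partial>M)"
      by (rule integral_mono[OF it Bochner_Integration.integrable_diff[OF iw iS] pt])
    ultimately have "(\<integral>x. t k x \<partial>M) \<le> (\<integral>x. \<bar>w x\<bar> powr q \<partial>M)" using iw iS by simp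
    moreover have "(\<integral>\<^sup>+x. ennreal (t k x) \<partial>M) = ennreal (\<integral>x. t k x \<partial>M)"
      by (rule nn_integral_eq_integral[OF it]) (simp add: t_def)
    moreover have "(\<integral>\<^sup>+x. ennreal (\<bar>w x\<bar> powr q) \<partial>M) = ennreal (\<integral>x. \<bar>w x\<bar> powr q \<partial>M)"
      by (rule nn_integral_eq_integral[OF iw]) simp
    ultimately show ?thesis by (simp only: ennreal_leI)
  qed
  have "(\<lambda>k. \<integral>\<^sup>+x. ennreal (t k x) \<partial>M) \<longlonglongrightarrow> (\<integral>\<^sup>+x. ennreal (\<bar>u x\<bar> powr q) \<partial>M)"
  proof (rule nn_integral_LIMSEQ)
    show "incseq (\<lambda>k x. ennreal (t k x))"
      unfolding t_def using q by (intro incseq_SucI le_funI ennreal_leI powr_mono2) (auto simp: clamp_abs_def)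
    show "(\<lambda>x. ennreal (t k x)) \<in> borel_measurable M" for k unfolding t_def by measurable
    show "(\<lambda>k. ennreal (t k x)) \<longlonglongrightarrow> ennreal (\<bar>u x\<bar> powr q)" for x
    proof (rule tendsto_eventually)
      obtain N where "\<bar>u x\<bar> < real N" using reals_Archimedean2 by blast
      then show "\<forall>\<^sub>F k in sequentially. ennreal (t k x) = ennreal (\<bar>u x\<bar> powr q)"
        unfolding eventually_sequentially t_def by (intro exI[of _ N]) (auto simp: clamp_abs_def)
    qed
  qed
  then show ?thesis using le unfolding w_def by (intro LIMSEQ_le_const2) auto
qed simp

text \<open>
  Let \<open>K\<close> be the bound of \<open>u + \<alpha> v\<close> and let \<open>T\<close> vanish on \<open>[-K, K]\<close> and have the sign of its argument elsewhere. Where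
  \<open>\<bar>u\<bar> > K\<close>, the numbers \<open>\<alpha> v\<close> and \<open>T u\<close> have opposite signs, so \<open>\<integral> v * T u \<ge> 0\<close> leaves no room
  for such points.
\<close>

lemma pairing_esssup_le:
  assumes uv: "pairing_nonneg M u v" and \<alpha>: "\<alpha> > 0"
  shows "esssup M (\<lambda>x. ennreal \<bar>u x\<bar>) \<le> esssup M (\<lambda>x. ennreal \<bar>u x + \<alpha> * v x\<bar>)"
proof (cases "esssup M (\<lambda>x. ennreal \<bar>u x + \<alpha> * v x\<bar>)")
  case (real K)
  have u: "integrable M u" and v: "integrable M v" using uv by (auto simp: pairing_nonneg_def)
  have [measurable]: "u \<in> borel_measurable M" "v \<in> borel_measurable M" using u v by auto
  have w: "AE x in M. \<bar>u x + \<alpha> * v x\<bar> \<le> K"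
    using esssup_AE[of "\<lambda>x. ennreal \<bar>u x + \<alpha> * v x\<bar>" M] unfolding real
    by eventually_elim (use real(1) in simp)
  define T where "T s = clamp_abs 1 (s - clamp_abs K s)" for s
  have Tc: "continuous_on UNIV T"
    unfolding T_def by (intro continuous_on_compose2[OF continuous_on_clamp_abs] continuous_intros continuous_on_clamp_abs) auto
  have [measurable]: "T \<in> borel_measurable borel" by (rule borel_measurable_continuous_onI[OF Tc])
  have Tb: "\<bar>T s\<bar> \<le> 1" for s unfolding T_def by (rule clamp_abs_props) simp
  have "mono T"
    unfolding T_def by (intro monoI monoD[OF clamp_abs_mono]) (use real(1) in \<open>auto simp: clamp_abs_def\<close>)
  from pairing_nonneg_continuous[OF uv Tc this Tb] have "0 \<le> \<alpha> * (\<integral>x. v x * T (u x) \<partial>M)" using \<alpha> by simp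
  then have pos: "(\<integral>x. - (\<alpha> * (v x * T (u x))) \<partial>M) \<le> 0" by simp
  have i: "integrable M (\<lambda>x. - (\<alpha> * (v x * T (u x))))"
    by (intro integrable_minus integrable_mult_right integrable_mult_bounded[OF v _ Tb]) measurable
  have sgn: "0 \<le> - (\<alpha> * (v x * T (u x))) \<and> (- (\<alpha> * (v x * T (u x))) = 0 \<longrightarrow> \<bar>u x\<bar> \<le> K)" if "\<bar>u x + \<alpha> * v x\<bar> \<le> K" for x
  proof -
    consider "\<bar>u x\<bar> \<le> K" | "u x > K" | "u x < - K" by linarith
    then show ?thesis
    proof cases
      case 1 then show ?thesis by (auto simp: T_def clamp_abs_def)
    next
      case 2
      then have "T (u x) > 0" using real(1) by (auto simp: T_def clamp_abs_def)
      moreover have "\<alpha> * v x < 0" using 2 that by linarith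
      ultimately have "(\<alpha> * v x) * T (u x) < 0" by (rule mult_neg_pos[rotated])
      then have "\<alpha> * (v x * T (u x)) < 0" by (simp only: mult.assoc)
      then show ?thesis by (intro conjI impI) linarith+
    next
      case 3
      then have "T (u x) < 0" using real(1) by (auto simp: T_def clamp_abs_def)
      moreover have "\<alpha> * v x > 0" using 3 that by linarith
      ultimately have "(\<alpha> * v x) * T (u x) < 0" by (rule mult_pos_neg[rotated])
      then have "\<alpha> * (v x * T (u x)) < 0" by (simp only: mult.assoc)
      then show ?thesis by (intro conjI impI) linarith+
    qed
  qed
  have nn: "AE x in M. 0 \<le> - (\<alpha> * (v x * T (u x)))" using w by eventually_elim (use sgn in blast)
  then have "(\<integral>x. - (\<alpha> * (v x * T (u x))) \<partial>M) = 0" using pos integral_nonneg_AE[OF nn] by linarith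
  then have "AE x in M. - (\<alpha> * (v x * T (u x))) = 0" using integral_nonneg_eq_0_iff_AE[OF i nn] by blast
  then have "AE x in M. \<bar>u x\<bar> \<le> K" using w by eventually_elim (use sgn in blast)
  then have "esssup M (\<lambda>x. ennreal \<bar>u x\<bar>) \<le> ennreal K" by (intro esssup_I) (auto intro: ennreal_leI)
  then show ?thesis by (simp add: real)
qed simp

lemma pairing_Lq_norm_le:
  assumes uv: "pairing_nonneg (lebesgue_on S) u v" and q: "q \<ge> 1" and \<alpha>: "\<alpha> > 0"
  shows "Lq_norm S q u \<le> Lq_norm S q (\<lambda>x. u x + \<alpha> * v x)"
proof (cases q)
  case (real r)
  then have r: "r \<ge> 1" using q by simp
  let ?I = "\<integral>\<^sup>+x. ennreal (\<bar>u x\<bar> powr r) \<partial>lebesgue_on S" and ?J = "\<integral>\<^sup>+x. ennreal (\<bar>u x + \<alpha> * v x\<bar> powr r) \<partial>lebesgue_on S"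
  have IJ: "?I \<le> ?J" by (rule pairing_powr_le[OF uv r \<alpha>])
  show ?thesis
  proof (cases "?J = \<infinity>")
    case False
    then have "?I \<noteq> \<infinity>" using IJ by (auto simp: top_unique)
    moreover have "enn2real ?I powr (1 / r) \<le> enn2real ?J powr (1 / r)"
      using IJ False r by (intro powr_mono2 enn2real_mono) (auto simp: less_top)
    ultimately show ?thesis using real r False by (simp add: Lq_norm_def Let_def ennreal_leI)
  qed (use real r in \<open>simp add: Lq_norm_def Let_def\<close>)
next
  case top
  then show ?thesis using pairing_esssup_le[OF uv \<alpha>] by (simp add: Lq_norm_def)
qed

section \<open>Separability of $L^1(S)$\<close>

lemma Lq_norm_1_commute: "Lq_norm S 1 (\<lambda>x. u x - v x) = Lq_norm S 1 (\<lambda>x. v x - u x)"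
  by (simp add: Lq_norm_1 abs_minus_commute)

lemma Lq_norm_1_triangle:
  assumes "u \<in> Lq S 1" "v \<in> Lq S 1" "w \<in> Lq S 1"
  shows "Lq_norm S 1 (\<lambda>x. u x - w x) \<le> Lq_norm S 1 (\<lambda>x. u x - v x) + Lq_norm S 1 (\<lambda>x. v x - w x)"
proof -
  have [measurable]: "u \<in> borel_measurable (lebesgue_on S)" "v \<in> borel_measurable (lebesgue_on S)" "w \<in> borel_measurable (lebesgue_on S)"
    using assms by (auto simp: Lq_def)
  have "Lq_norm S 1 (\<lambda>x. u x - w x) \<le> (\<integral>\<^sup>+x. ennreal \<bar>u x - v x\<bar> + ennreal \<bar>v x - w x\<bar> \<partial>lebesgue_on S)"
    unfolding Lq_norm_1 by (intro nn_integral_mono) (simp flip: ennreal_plus)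
  also have "\<dots> = Lq_norm S 1 (\<lambda>x. u x - v x) + Lq_norm S 1 (\<lambda>x. v x - w x)"
    unfolding Lq_norm_1 by (rule nn_integral_add) measurable
  finally show ?thesis .
qed

lemma step_fun_in_L1:
  assumes S: "open S" shows "step_fun l \<in> Lq S 1"
proof -
  have Sm: "S \<in> sets lebesgue" using S by auto
  have "step_fun l \<in> borel_measurable lborel" using integrable_step_fun[of l] by auto
  then have "integrable lebesgue (step_fun l)" using integrable_step_fun[of l] integrable_completion by blast
  then show ?thesis unfolding Lq_1_iff lebesgue_on_eq_indicator(1)[OF Sm] by (rule integrable_mult_indicator[OF Sm])
qed

lemma step_fun_dense_Lq_1:
  fixes S :: "(real^'n) set"
  assumes S: "open S" and u: "u \<in> Lq S 1" and e: "e > (0::real)"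
  obtains l where "Lq_norm S 1 (\<lambda>x. u x - step_fun l x) < ennreal e"
proof -
  have Sm: "S \<in> sets lebesgue" using S by auto
  obtain U where iU: "integrable lborel U" and ae: "AE x in lebesgue. U x = indicator S x * u x"
    using borel_version[OF Sm] u[unfolded Lq_1_iff] .
  obtain l where l: "(\<integral>x. \<bar>U x - step_fun l x\<bar> \<partial>lborel) < e" using step_fun_dense_L1[OF iU e] .
  have i: "integrable lborel (\<lambda>x. \<bar>U x - step_fun l x\<bar>)" using iU integrable_step_fun[of l] by auto
  have "Lq_norm S 1 (\<lambda>x. u x - step_fun l x) = (\<integral>\<^sup>+x. ennreal \<bar>u x - step_fun l x\<bar> * indicator S x \<partial>lebesgue)"
    unfolding Lq_norm_1 by (rule nn_integral_restrict_space) (use Sm in simp)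
  also have "\<dots> \<le> (\<integral>\<^sup>+x. ennreal \<bar>U x - step_fun l x\<bar> \<partial>lebesgue)"
  proof (rule nn_integral_mono_AE)
    show "AE x in lebesgue. ennreal \<bar>u x - step_fun l x\<bar> * indicator S x \<le> ennreal \<bar>U x - step_fun l x\<bar>"
      using ae by eventually_elim (auto simp: indicator_def)
  qed
  also have "\<dots> = (\<integral>\<^sup>+x. ennreal \<bar>U x - step_fun l x\<bar> \<partial>lborel)"
    by (rule nn_integral_completion)
  also have "\<dots> = ennreal (\<integral>x. \<bar>U x - step_fun l x\<bar> \<partial>lborel)" by (rule nn_integral_eq_integral[OF i]) simp
  also have "\<dots> < ennreal e" using l e by (simp add: ennreal_lessI)
  finally show ?thesis by (rule that)
qed

text \<open>
  The distance is a countable infimum of sums of distances to fixed functions. This is how separability makes the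
  distance of two random elements measurable.
\<close>

lemma Lq_norm_1_diff_eq_INF:
  fixes S :: "(real^'n) set"
  assumes S: "open S" and u: "u \<in> Lq S 1" and v: "v \<in> Lq S 1"
  shows "Lq_norm S 1 (\<lambda>x. u x - v x)
    = (INF l. Lq_norm S 1 (\<lambda>x. step_fun l x - u x) + Lq_norm S 1 (\<lambda>x. step_fun l x - v x))" (is "?d = ?i")
proof (rule antisym)
  show "?d \<le> ?i"
  proof (rule INF_greatest)
    fix l
    show "?d \<le> Lq_norm S 1 (\<lambda>x. step_fun l x - u x) + Lq_norm S 1 (\<lambda>x. step_fun l x - v x)"
      using Lq_norm_1_triangle[OF u step_fun_in_L1[OF S] v, of l] by (simp add: Lq_norm_1_commute[of S u])
  qed
  show "?i \<le> ?d"
  proof (rule ennreal_le_epsilon)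
    fix e :: real assume e: "0 < e"
    then obtain l where l: "Lq_norm S 1 (\<lambda>x. u x - step_fun l x) < ennreal (e / 2)"
      using step_fun_dense_Lq_1[OF S u, of "e / 2"] by auto
    let ?s = "step_fun l"
    have "?i \<le> Lq_norm S 1 (\<lambda>x. ?s x - u x) + Lq_norm S 1 (\<lambda>x. ?s x - v x)" by (rule INF_lower) simp
    also have "\<dots> \<le> Lq_norm S 1 (\<lambda>x. ?s x - u x) + (Lq_norm S 1 (\<lambda>x. ?s x - u x) + ?d)"
      by (intro add_left_mono Lq_norm_1_triangle step_fun_in_L1 S u v)
    also have "\<dots> \<le> ennreal (e / 2) + (ennreal (e / 2) + ?d)"
      using l by (intro add_mono order_refl) (simp_all add: Lq_norm_1_commute[of S u] less_imp_le)
    also have "\<dots> = ?d + ennreal e"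
      using e by (simp add: add.assoc[symmetric] ennreal_plus[symmetric] add.commute del: ennreal_plus)
    finally show "?i \<le> ?d + ennreal e" .
  qed
qed

section \<open>Random elements\<close>

lemma space_borel_sigma: "space (borel_sigma X) = topspace X"
  unfolding borel_sigma_def by (rule space_measure_of) (auto dest: openin_subset)

lemma openin_imp_sets_borel_sigma:
  assumes "openin X U" shows "U \<in> sets (borel_sigma X)"
proof -
  have "{U. openin X U} \<subseteq> Pow (topspace X)" by (auto dest: openin_subset)
  then show ?thesis using assms by (auto simp: borel_sigma_def)
qed

lemma L1L1_in_Lq:
  assumes "f \<in> L1L1 P S" "\<omega> \<in> space P" shows "f \<omega> \<in> Lq S 1"
  using assms measurable_space[of f P "borel_sigma (L1_topology S)" \<omega>]
  by (auto simp: L1L1_def space_borel_sigma L1_topology_def)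

text \<open>
  The subtraction of extended reals is harmless because the distance of \<open>k\<close> and \<open>u\<close> is finite.
\<close>

lemma openin_L1_ball:
  assumes k: "k \<in> Lq S 1"
  shows "openin (L1_topology S) {u \<in> Lq S 1. Lq_norm S 1 (\<lambda>x. k x - u x) < c}"
  unfolding L1_topology_def openin_dist_topology dist_open_def
proof (intro conjI ballI)
  fix u assume u: "u \<in> {u \<in> Lq S 1. Lq_norm S 1 (\<lambda>x. k x - u x) < c}"
  let ?e = "c - Lq_norm S 1 (\<lambda>x. k x - u x)"
  have fin: "Lq_norm S 1 (\<lambda>x. k x - u x) < top" using u by (auto intro: less_le_trans[OF _ top_greatest])
  have "?e > 0" using u by (simp add: diff_gr0_ennreal)
  moreover have "v \<in> {u \<in> Lq S 1. Lq_norm S 1 (\<lambda>x. k x - u x) < c}"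
    if v: "v \<in> Lq S 1" "Lq_norm S 1 (\<lambda>x. u x - v x) < ?e" for v
  proof -
    have "Lq_norm S 1 (\<lambda>x. k x - v x) \<le> Lq_norm S 1 (\<lambda>x. u x - v x) + Lq_norm S 1 (\<lambda>x. k x - u x)"
      using Lq_norm_1_triangle[OF k _ v(1), of u] u by (simp add: add.commute)
    also have "\<dots> < c" using v(2) fin by (simp add: less_diff_eq_ennreal)
    finally show ?thesis using v by simp
  qed
  ultimately show "\<exists>e>0. \<forall>v\<in>Lq S 1. Lq_norm S 1 (\<lambda>x. u x - v x) < e \<longrightarrow> v \<in> {u \<in> Lq S 1. Lq_norm S 1 (\<lambda>x. k x - u x) < c}"
    by blast
qed simp

lemma measurable_L1_distance_to:
  assumes f: "f \<in> L1L1 P S" and k: "k \<in> Lq S 1"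
  shows "(\<lambda>\<omega>. Lq_norm S 1 (\<lambda>x. k x - f \<omega> x)) \<in> borel_measurable P"
proof (rule borel_measurableI_less)
  fix c
  let ?U = "{u \<in> Lq S 1. Lq_norm S 1 (\<lambda>x. k x - u x) < c}"
  have fm: "f \<in> P \<rightarrow>\<^sub>M borel_sigma (L1_topology S)" using f by (simp add: L1L1_def)
  have "f -` ?U \<inter> space P \<in> sets P"
    by (rule measurable_sets[OF fm openin_imp_sets_borel_sigma[OF openin_L1_ball[OF k]]])
  also have "f -` ?U \<inter> space P = {\<omega> \<in> space P. Lq_norm S 1 (\<lambda>x. k x - f \<omega> x) < c}"
    using L1L1_in_Lq[OF f] by auto
  finally show "{\<omega> \<in> space P. Lq_norm S 1 (\<lambda>x. k x - f \<omega> x) < c} \<in> sets P" .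
qed

lemma measurable_L1_distance:
  fixes S :: "(real^'n) set"
  assumes S: "open S" and f: "f \<in> L1L1 P S" and h: "h \<in> L1L1 P S"
  shows "(\<lambda>\<omega>. Lq_norm S 1 (\<lambda>x. f \<omega> x - h \<omega> x)) \<in> borel_measurable P"
proof -
  note [measurable] = measurable_L1_distance_to[OF f step_fun_in_L1[OF S]] measurable_L1_distance_to[OF h step_fun_in_L1[OF S]]
  have "(\<lambda>\<omega>. INF l. Lq_norm S 1 (\<lambda>x. step_fun l x - f \<omega> x) + Lq_norm S 1 (\<lambda>x. step_fun l x - h \<omega> x)) \<in> borel_measurable P"
    by (rule borel_measurable_INF) auto
  then show ?thesis
    by (rule measurable_cong[THEN iffD1, rotated]) (use Lq_norm_1_diff_eq_INF[OF S] L1L1_in_Lq[OF f] L1L1_in_Lq[OF h] in auto)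
qed

lemma L1L1_triangle:
  assumes S: "open S" and f: "f \<in> L1L1 P S" and h: "h \<in> L1L1 P S" and k: "k \<in> L1L1 P S"
  shows "L1L1_norm P S (\<lambda>\<omega> x. f \<omega> x - k \<omega> x) \<le> L1L1_norm P S (\<lambda>\<omega> x. f \<omega> x - h \<omega> x) + L1L1_norm P S (\<lambda>\<omega> x. h \<omega> x - k \<omega> x)"
proof -
  note [measurable] = measurable_L1_distance[OF S f h] measurable_L1_distance[OF S h k]
  have "L1L1_norm P S (\<lambda>\<omega> x. f \<omega> x - k \<omega> x)
      \<le> (\<integral>\<^sup>+\<omega>. Lq_norm S 1 (\<lambda>x. f \<omega> x - h \<omega> x) + Lq_norm S 1 (\<lambda>x. h \<omega> x - k \<omega> x) \<partial>P)"
    unfolding L1L1_norm_def by (intro nn_integral_mono Lq_norm_1_triangle L1L1_in_Lq[OF f] L1L1_in_Lq[OF h] L1L1_in_Lq[OF k])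
  also have "\<dots> = L1L1_norm P S (\<lambda>\<omega> x. f \<omega> x - h \<omega> x) + L1L1_norm P S (\<lambda>\<omega> x. h \<omega> x - k \<omega> x)"
    unfolding L1L1_norm_def by (rule nn_integral_add) measurable
  finally show ?thesis .
qed

lemma openin_L1L1_ball:
  assumes S: "open S" and k: "k \<in> L1L1 P S"
  shows "openin (L1L1_topology P S) {u \<in> L1L1 P S. L1L1_norm P S (\<lambda>\<omega> x. k \<omega> x - u \<omega> x) < c}" (is "openin _ ?U")
  unfolding L1L1_topology_def openin_dist_topology dist_open_def
proof (intro conjI ballI)
  fix u assume u: "u \<in> ?U"
  let ?d = "\<lambda>u v. L1L1_norm P S (\<lambda>\<omega> x. u \<omega> x - v \<omega> x)"
  have fin: "?d k u < top" using u by (auto intro: less_le_trans[OF _ top_greatest])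
  have "c - ?d k u > 0" using u by (simp add: diff_gr0_ennreal)
  moreover have "v \<in> ?U" if v: "v \<in> L1L1 P S" "?d u v < c - ?d k u" for v
  proof -
    have "?d k v \<le> ?d u v + ?d k u"
      using L1L1_triangle[OF S k _ v(1), of u] u by (simp add: add.commute)
    also have "\<dots> < c" using v(2) fin by (simp add: less_diff_eq_ennreal)
    finally show ?thesis using v by simp
  qed
  ultimately show "\<exists>e>0. \<forall>v\<in>L1L1 P S. ?d u v < e \<longrightarrow> v \<in> ?U" by blast
qed simp

lemma L1L1_norm_zero: "L1L1_norm P S (\<lambda>\<omega> x. 0) = 0"
  by (simp add: L1L1_norm_def Lq_norm_1)

section \<open>The closure of the operator\<close>

lemma A_closure_approx:
  assumes S: "open S" and ff': "(f, f') \<in> A_closure P S p g"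
  shows "f \<in> L1L1 P S" "f' \<in> L1L1 P S"
    and "e > 0 \<Longrightarrow> \<exists>a a'. (a, a') \<in> A_op P S p g \<and> L1L1_norm P S (\<lambda>\<omega> x. f \<omega> x - a \<omega> x) < e
      \<and> L1L1_norm P S (\<lambda>\<omega> x. f' \<omega> x - a' \<omega> x) < e"
proof -
  let ?X = "prod_topology (L1L1_topology P S) (L1L1_topology P S)"
  have "(f, f') \<in> topspace ?X" using ff' by (auto simp: A_closure_def in_closure_of)
  then show f: "f \<in> L1L1 P S" "f' \<in> L1L1 P S" by (auto simp: L1L1_topology_def)
  assume e: "e > 0"
  let ?U = "\<lambda>k. {u \<in> L1L1 P S. L1L1_norm P S (\<lambda>\<omega> x. k \<omega> x - u \<omega> x) < e}"
  have op: "openin ?X (?U f \<times> ?U f')" using openin_L1L1_ball[OF S f(1)] openin_L1L1_ball[OF S f(2)]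
    by (simp add: openin_prod_Times_iff)
  have mem: "(f, f') \<in> ?U f \<times> ?U f'" using f e by (simp add: L1L1_norm_zero)
  have "\<forall>T. (f, f') \<in> T \<and> openin ?X T \<longrightarrow> (\<exists>y. y \<in> A_op P S p g \<and> y \<in> T)"
    using ff' unfolding A_closure_def in_closure_of by (rule conjunct2)
  from this[rule_format, OF conjI[OF mem op]] obtain y where "y \<in> A_op P S p g" "y \<in> ?U f \<times> ?U f'"
    by (elim exE conjE)
  then show "\<exists>a a'. (a, a') \<in> A_op P S p g \<and> L1L1_norm P S (\<lambda>\<omega> x. f \<omega> x - a \<omega> x) < e
      \<and> L1L1_norm P S (\<lambda>\<omega> x. f' \<omega> x - a' \<omega> x) < e" by (cases y) auto
qed

lemma A_closure_sequence:
  assumes S: "open S" and ff': "(f, f') \<in> A_closure P S p g" and e: "\<And>n::nat. e n > 0"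
  shows "\<exists>a a'. \<forall>n. (a n, a' n) \<in> A_op P S p g \<and> L1L1_norm P S (\<lambda>\<omega> x. f \<omega> x - a n \<omega> x) < e n
    \<and> L1L1_norm P S (\<lambda>\<omega> x. f' \<omega> x - a' n \<omega> x) < e n"
proof -
  let ?Q = "\<lambda>n z. z \<in> A_op P S p g \<and> L1L1_norm P S (\<lambda>\<omega> x. f \<omega> x - fst z \<omega> x) < e n
      \<and> L1L1_norm P S (\<lambda>\<omega> x. f' \<omega> x - snd z \<omega> x) < e n"
  have "\<exists>z. ?Q n z" for n
  proof -
    obtain a a' where "(a, a') \<in> A_op P S p g \<and> L1L1_norm P S (\<lambda>\<omega> x. f \<omega> x - a \<omega> x) < e n
      \<and> L1L1_norm P S (\<lambda>\<omega> x. f' \<omega> x - a' \<omega> x) < e n"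
      using A_closure_approx(3)[OF S ff' e[of n]] by (elim exE)
    then have "?Q n (a, a')" by simp
    then show ?thesis by (rule exI)
  qed
  then have "\<forall>n. \<exists>z. ?Q n z" by (rule allI)
  then obtain z where z: "\<forall>n. ?Q n (z n)" by (rule choice[THEN exE])
  show ?thesis
    by (rule exI[of _ "\<lambda>n. fst (z n)"], rule exI[of _ "\<lambda>n. snd (z n)"]) (use z in simp)
qed

lemma A_op_subset_A_closure: "A_op P S p g \<subseteq> A_closure P S p g"
  unfolding A_closure_def by (rule closure_of_subset) (auto simp: A_op_def L1L1_topology_def)

text \<open>
  Probability \<open>1\<close> entails that the event is measurable, as the measure of any other set is \<open>0\<close>.
\<close>

lemma (in prob_space) prob_Collect_eq_1_imp_AE:
  assumes "\<P>(\<omega> in M. Q \<omega>) = 1" shows "AE \<omega> in M. Q \<omega>"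
  using AE_prob_1[OF assms] by eventually_elim simp

lemma (in prob_space) AE_imp_prob_Collect_eq_1:
  assumes "complete_measure M" "AE \<omega> in M. Q \<omega>" shows "\<P>(\<omega> in M. Q \<omega>) = 1"
proof -
  have "{\<omega> \<in> space M. Q \<omega>} \<in> events"
    by (rule complete_measure.in_sets_AE[OF assms(1), of "space M"]) (use assms(2) in \<open>auto elim: eventually_mono\<close>)
  then show ?thesis using assms(2) by (simp add: prob_Collect_eq_1)
qed

lemma A_op_pairing_nonneg:
  fixes S :: "(real^'n) set"
  assumes P: "prob_space P" and S: "open S" "bounded S" and p: "p > 1" and g: "0 < g1"
    and \<gamma>: "\<P>(\<omega> in P. g \<omega> \<in> L1_between S g1 g2) = 1"
    and a: "(a, a') \<in> A_op P S p g" and b: "(b, b') \<in> A_op P S p g"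
  shows "AE \<omega> in P. pairing_nonneg (lebesgue_on S) (\<lambda>x. a \<omega> x - b \<omega> x) (\<lambda>x. a' \<omega> x - b' \<omega> x)"
proof -
  interpret prob_space P by (rule P)
  let ?sol = "\<lambda>f f' \<omega>. \<forall>\<phi>\<in>sobolev S p \<inter> Lq S \<infinity>.
        (\<integral>x. g \<omega> x * (flux p (weak_gradient S (f \<omega>) x) \<bullet> weak_gradient S \<phi> x) \<partial>lebesgue_on S)
          = (\<integral>x. f' \<omega> x * \<phi> x \<partial>lebesgue_on S)"
  have A: "f \<in> L1L1 P S \<and> f' \<in> L1L1 P S \<and> (AE \<omega> in P. f \<omega> \<in> sobolev S p \<inter> Lq S \<infinity>) \<and> (AE \<omega> in P. ?sol f f' \<omega>)"
    if "(f, f') \<in> A_op P S p g" for f f'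
    using that unfolding A_op_def flux_def by (auto dest!: prob_Collect_eq_1_imp_AE)
  note a = A[OF a] and b = A[OF b]
  have in_L1L1: "a \<in> L1L1 P S" "a' \<in> L1L1 P S" "b \<in> L1L1 P S" "b' \<in> L1L1 P S" using a b by auto
  have ae: "AE \<omega> in P. a \<omega> \<in> sobolev S p \<inter> Lq S \<infinity>" "AE \<omega> in P. ?sol a a' \<omega>"
    "AE \<omega> in P. b \<omega> \<in> sobolev S p \<inter> Lq S \<infinity>" "AE \<omega> in P. ?sol b b' \<omega>" using a b by auto
  show ?thesis
    using ae prob_Collect_eq_1_imp_AE[OF \<gamma>] AE_space
  proof eventually_elim
    case (elim \<omega>)
    have L: "a \<omega> \<in> Lq S 1" "a' \<omega> \<in> Lq S 1" "b \<omega> \<in> Lq S 1" "b' \<omega> \<in> Lq S 1"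
      using in_L1L1[THEN L1L1_in_Lq, OF elim(6)] .
    have gm: "g \<omega> \<in> borel_measurable (lebesgue_on S)" using elim(5) by (simp add: L1_between_def Lq_def)
    have "AE x in lebesgue_on S. g1 \<le> g \<omega> x \<and> g \<omega> x \<le> g2" using elim(5) by (simp add: L1_between_def)
    then have gb: "AE x in lebesgue_on S. 0 \<le> g \<omega> x \<and> g \<omega> x \<le> g2" by eventually_elim (use g in auto)
    show ?case
      unfolding pairing_nonneg_def
    proof (intro conjI allI impI)
      show "integrable (lebesgue_on S) (\<lambda>x. a \<omega> x - b \<omega> x)" "integrable (lebesgue_on S) (\<lambda>x. a' \<omega> x - b' \<omega> x)"
        using L by (auto simp: Lq_1_iff)
      fix T T' assume T: "truncation T T'"
      then obtain B L where BL: "\<And>x. \<bar>T x\<bar> \<le> B" "\<And>x. \<bar>T' x\<bar> \<le> L" unfolding truncation_def by blast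
      show "0 \<le> (\<integral>x. (a' \<omega> x - b' \<omega> x) * T (a \<omega> x - b \<omega> x) \<partial>lebesgue_on S)"
      proof (rule weak_solution_pairing_nonneg[OF S p _ _ L(2,4) gm gb _ _ _ _ BL])
        show "a \<omega> \<in> sobolev S p" "b \<omega> \<in> sobolev S p" using elim(1,3) by blast+
        show "(T has_real_derivative T' s) (at s)" "continuous_on UNIV T'" "0 \<le> T' s" for s
          using T unfolding truncation_def by blast+
      qed (rule elim(2)[rule_format], assumption, rule elim(4)[rule_format], assumption)
    qed
  qed
qed

lemma Lq_norm_1_eq_integral:
  assumes "integrable (lebesgue_on S) u" shows "Lq_norm S 1 u = ennreal (\<integral>x. \<bar>u x\<bar> \<partial>lebesgue_on S)"
  unfolding Lq_norm_1 by (rule nn_integral_eq_integral) (use assms in auto)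

lemma integral_diff_diff_less:
  assumes i: "a \<in> Lq S 1" "b \<in> Lq S 1" "f \<in> Lq S 1" "h \<in> Lq S 1"
    and less: "Lq_norm S 1 (\<lambda>x. f x - a x) + Lq_norm S 1 (\<lambda>x. h x - b x) < ennreal e"
  shows "(\<integral>x. \<bar>(a x - b x) - (f x - h x)\<bar> \<partial>lebesgue_on S) < e"
proof -
  have j [intro!]: "integrable (lebesgue_on S) a" "integrable (lebesgue_on S) b" "integrable (lebesgue_on S) f" "integrable (lebesgue_on S) h"
    using i by (auto simp: Lq_1_iff)
  note [intro!] = integrable_arith
  have k: "integrable (lebesgue_on S) (\<lambda>x. \<bar>f x - a x\<bar>)" "integrable (lebesgue_on S) (\<lambda>x. \<bar>h x - b x\<bar>)" by auto
  have "(\<integral>x. \<bar>(a x - b x) - (f x - h x)\<bar> \<partial>lebesgue_on S) \<le> (\<integral>x. \<bar>f x - a x\<bar> + \<bar>h x - b x\<bar> \<partial>lebesgue_on S)"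
    by (rule integral_mono) auto
  also have "\<dots> = (\<integral>x. \<bar>f x - a x\<bar> \<partial>lebesgue_on S) + (\<integral>x. \<bar>h x - b x\<bar> \<partial>lebesgue_on S)"
    by (rule Bochner_Integration.integral_add[OF k])
  also have "\<dots> < e"
  proof -
    have "Lq_norm S 1 (\<lambda>x. f x - a x) + Lq_norm S 1 (\<lambda>x. h x - b x)
        = ennreal ((\<integral>x. \<bar>f x - a x\<bar> \<partial>lebesgue_on S) + (\<integral>x. \<bar>h x - b x\<bar> \<partial>lebesgue_on S))"
      by (subst (1 2) Lq_norm_1_eq_integral) (auto simp: ennreal_plus)
    then show ?thesis using less by (simp add: ennreal_less_iff del: ennreal_plus)
  qed
  finally show ?thesis .
qed

text \<open>
  The sum \<open>N n\<close> of the four distances to the \<open>n\<close>-th approximants has expectation tending to \<open>0\<close>. Its infimum over \<open>n\<close>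
  is therefore \<open>0\<close> almost surely, which provides approximants as close as desired at almost every \<open>\<omega>\<close> and spares the
  passage to an almost surely convergent subsequence.
\<close>

lemma A_closure_pairing_nonneg:
  fixes S :: "(real^'n) set"
  assumes P: "prob_space P" and S: "open S" "bounded S" and p: "p > 1" and g: "0 < g1"
    and \<gamma>: "\<P>(\<omega> in P. g \<omega> \<in> L1_between S g1 g2) = 1"
    and f: "(f, f') \<in> A_closure P S p g" and h: "(h, h') \<in> A_closure P S p g"
  shows "AE \<omega> in P. pairing_nonneg (lebesgue_on S) (\<lambda>x. f \<omega> x - h \<omega> x) (\<lambda>x. f' \<omega> x - h' \<omega> x)"
proof -
  note F = A_closure_approx[OF S(1) f] and H = A_closure_approx[OF S(1) h]
  let ?d = "\<lambda>u v. L1L1_norm P S (\<lambda>\<omega> x. u \<omega> x - v \<omega> x)"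
  let ?e = "\<lambda>n. ennreal (inverse (real (Suc n)))"
  have e0: "?e n > 0" for n by simp
  obtain a a' where "\<forall>n. (a n, a' n) \<in> A_op P S p g \<and> ?d f (a n) < ?e n \<and> ?d f' (a' n) < ?e n"
    using A_closure_sequence[where e = ?e, OF S(1) f e0] by (elim exE)
  then have a: "(a n, a' n) \<in> A_op P S p g" "?d f (a n) < ?e n" "?d f' (a' n) < ?e n" for n by simp_all
  obtain b b' where "\<forall>n. (b n, b' n) \<in> A_op P S p g \<and> ?d h (b n) < ?e n \<and> ?d h' (b' n) < ?e n"
    using A_closure_sequence[where e = ?e, OF S(1) h e0] by (elim exE)
  then have b: "(b n, b' n) \<in> A_op P S p g" "?d h (b n) < ?e n" "?d h' (b' n) < ?e n" for n by simp_all
  have L: "a n \<in> L1L1 P S" "a' n \<in> L1L1 P S" "b n \<in> L1L1 P S" "b' n \<in> L1L1 P S" for n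
    using a(1)[of n] b(1)[of n] by (auto simp: A_op_def)
  let ?N = "\<lambda>u v \<omega>. Lq_norm S 1 (\<lambda>x. u \<omega> x - v \<omega> x)"
  define N where "N n \<omega> = (?N f (a n) \<omega> + ?N f' (a' n) \<omega>) + (?N h (b n) \<omega> + ?N h' (b' n) \<omega>)" for n \<omega>
  note [measurable] = measurable_L1_distance[OF S(1) F(1) L(1)] measurable_L1_distance[OF S(1) F(2) L(2)]
    measurable_L1_distance[OF S(1) H(1) L(3)] measurable_L1_distance[OF S(1) H(2) L(4)]
  have Nm [measurable]: "N n \<in> borel_measurable P" for n unfolding N_def by measurable
  have N_le: "(\<integral>\<^sup>+\<omega>. N n \<omega> \<partial>P) \<le> ennreal (4 * inverse (real (Suc n)))" for n
  proof -
    have "(\<integral>\<^sup>+\<omega>. N n \<omega> \<partial>P) = (?d f (a n) + ?d f' (a' n)) + (?d h (b n) + ?d h' (b' n))"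
      unfolding N_def L1L1_norm_def by (simp add: nn_integral_add)
    also have "\<dots> \<le> (?e n + ?e n) + (?e n + ?e n)"
      by (intro add_mono less_imp_le a b)
    also have "\<dots> = ennreal (4 * inverse (real (Suc n)))" by (simp add: ennreal_plus[symmetric] del: ennreal_plus)
    finally show ?thesis .
  qed
  have "(\<integral>\<^sup>+\<omega>. (INF n. N n \<omega>) \<partial>P) = 0"
  proof -
    have le: "(\<integral>\<^sup>+\<omega>. (INF n. N n \<omega>) \<partial>P) \<le> ennreal (4 * inverse (real (Suc n)))" for n
      by (rule order_trans[OF nn_integral_mono N_le]) (auto intro: INF_lower)
    have "(\<lambda>n. ennreal (4 * inverse (real (Suc n)))) \<longlonglongrightarrow> ennreal (4 * 0)"
      by (intro tendsto_ennrealI tendsto_intros LIMSEQ_inverse_real_of_nat)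
    then have "(\<integral>\<^sup>+\<omega>. (INF n. N n \<omega>) \<partial>P) \<le> ennreal (4 * 0)"
      by (rule LIMSEQ_le_const) (use le in auto)
    then show ?thesis by simp
  qed
  then have inf0: "AE \<omega> in P. (INF n. N n \<omega>) = 0" by (subst (asm) nn_integral_0_iff_AE) auto
  have pairs: "AE \<omega> in P. \<forall>n. pairing_nonneg (lebesgue_on S) (\<lambda>x. a n \<omega> x - b n \<omega> x) (\<lambda>x. a' n \<omega> x - b' n \<omega> x)"
    unfolding AE_all_countable by (intro allI A_op_pairing_nonneg[OF P S p g \<gamma> a(1) b(1)])
  show ?thesis
    using inf0 pairs AE_space
  proof eventually_elim
    case (elim \<omega>)
    note I = L1L1_in_Lq[OF F(1) elim(3)] L1L1_in_Lq[OF F(2) elim(3)] L1L1_in_Lq[OF H(1) elim(3)] L1L1_in_Lq[OF H(2) elim(3)]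
    note J = L[THEN L1L1_in_Lq, OF elim(3)]
    show ?case
    proof (rule pairing_nonneg_closed)
      show "integrable (lebesgue_on S) (\<lambda>x. f \<omega> x - h \<omega> x)" "integrable (lebesgue_on S) (\<lambda>x. f' \<omega> x - h' \<omega> x)"
        using I by (auto simp: Lq_1_iff)
      fix e :: real assume "e > 0"
      then have "(INF n. N n \<omega>) < ennreal e" using elim(1) by simp
      then obtain n where n: "N n \<omega> < ennreal e" by (auto simp: INF_less_iff)
      have "?N f (a n) \<omega> + ?N h (b n) \<omega> \<le> N n \<omega>" "?N f' (a' n) \<omega> + ?N h' (b' n) \<omega> \<le> N n \<omega>"
        unfolding N_def by (intro add_mono add_increasing2 add_increasing order_refl zero_le)+
      then have "?N f (a n) \<omega> + ?N h (b n) \<omega> < ennreal e" "?N f' (a' n) \<omega> + ?N h' (b' n) \<omega> < ennreal e"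
        using n by (auto intro: le_less_trans)
      then have "(\<integral>x. \<bar>(a n \<omega> x - b n \<omega> x) - (f \<omega> x - h \<omega> x)\<bar> \<partial>lebesgue_on S) < e"
        "(\<integral>x. \<bar>(a' n \<omega> x - b' n \<omega> x) - (f' \<omega> x - h' \<omega> x)\<bar> \<partial>lebesgue_on S) < e"
        using integral_diff_diff_less[OF J(1,3) I(1,3)] integral_diff_diff_less[OF J(2,4) I(2,4)] by auto
      with elim(2) show "\<exists>u' v'. pairing_nonneg (lebesgue_on S) u' v'
          \<and> (\<integral>x. \<bar>u' x - (f \<omega> x - h \<omega> x)\<bar> \<partial>lebesgue_on S) < e
          \<and> (\<integral>x. \<bar>v' x - (f' \<omega> x - h' \<omega> x)\<bar> \<partial>lebesgue_on S) < e" by blast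
    qed
  qed
qed

theorem proposition4p6:
  fixes P :: "'w measure"
    and S :: "(real^'n) set"
    and p g1 g2 :: real
    and g :: "'w \<Rightarrow> real^'n \<Rightarrow> real"
  assumes "CARD('n) \<ge> 2"
    and "p > 1" and "p \<noteq> 2"
    and "S \<noteq> {}" and "open S" and "bounded S" and "connected S" and "C1_domain S"
    and "0 < g1" and "g1 \<le> g2"
    and "prob_space P" and "complete_measure P"
    and "g \<in> L1L1 P S"
    and "\<P>(\<omega> in P. g \<omega> \<in> L1_between S g1 g2) = 1"
  shows "(\<forall>f f' h h'. \<forall>\<alpha>::real. \<forall>q::ennreal.
            (f, f') \<in> A_closure P S p g \<longrightarrow> (h, h') \<in> A_closure P S p g \<longrightarrow> \<alpha> > 0 \<longrightarrow> q \<ge> 1 \<longrightarrow>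
            \<P>(\<omega> in P. (\<lambda>x. f \<omega> x - h \<omega> x + \<alpha> * (f' \<omega> x - h' \<omega> x)) \<in> Lq S q) = 1 \<longrightarrow>
            \<P>(\<omega> in P. Lq_norm S q (\<lambda>x. f \<omega> x - h \<omega> x)
                 \<le> Lq_norm S q (\<lambda>x. f \<omega> x - h \<omega> x + \<alpha> * (f' \<omega> x - h' \<omega> x))) = 1)
       \<and> accretive P S (A_op P S p g)
       \<and> accretive P S (A_closure P S p g)"
proof -
  have AE_le: "AE \<omega> in P. Lq_norm S q (\<lambda>x. f \<omega> x - h \<omega> x)
      \<le> Lq_norm S q (\<lambda>x. f \<omega> x - h \<omega> x + \<alpha> * (f' \<omega> x - h' \<omega> x))"
    if "(f, f') \<in> A_closure P S p g" "(h, h') \<in> A_closure P S p g" "\<alpha> > 0" "q \<ge> 1" for f f' h h' \<alpha> q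
    using A_closure_pairing_nonneg[OF assms(11,5,6,2,9,14) that(1,2)]
    by eventually_elim (rule pairing_Lq_norm_le[OF _ that(4,3)])
  have closure: "accretive P S (A_closure P S p g)"
    unfolding accretive_def L1L1_norm_def by (auto intro!: nn_integral_mono_AE AE_le)
  then have "accretive P S (A_op P S p g)"
    using A_op_subset_A_closure unfolding accretive_def by fast
  with closure show ?thesis
    by (auto intro!: prob_space.AE_imp_prob_Collect_eq_1[OF assms(11,12)] AE_le)
qed

end
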